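(* Let $K$ be a field and $R=K[x_1,\ldots,x_5]$ (so $n=5$ and $\dim R=5$). Let $I\subset R$ be a squarefree monomial ideal of single degree $d$, i.e. all minimal monomial generators of $I$ have the same degree $d$, with $1\leq d\leq\dim R$. Let $I^{\vee}$ be the Alexander dual of $I$. Then $R/I^{\vee}$ is sequentially Cohen-Macaulay if and only if $R/I^{\vee}$ is pretty clean.
   Context: For a simplicial complex $\Delta$ on $V=\{x_1,\ldots,x_n\}$ and $R=K[x_1,\ldots,x_n]$, the Stanley-Reisner ideal $I_\Delta\subset R$ is generated by the squarefree monomials $x_F=\prod_{x_j\in F}x_j$ with $F\subseteq V$, $F\notin\Delta$. The Alexander dual complex is $\Delta^{\vee}=\{V\setminus A : A\subseteq V,\ A\notin\Delta\}$. Every squarefree monomial ideal $I$ equals $I_\Delta$ for a unique $\Delta$, and its Alexander dual is $I^{\vee}=I_{\Delta^{\vee}}$. For a monomial ideal $J\subset R$, a monomial prime filtration of $R/J$ is a chain of monomial ideals $J=I_0\subset I_1\subset\cdots\subset I_r=R$ such that for each $i=1,\ldots,r$ one has $I_i/I_{i-1}\cong R/\mathfrak{p}_i$ with $\mathfrak{p}_i$ a monomial prime ideal; equivalently, $I_i=(I_{i-1},u_i)$ and $\mathfrak{p}_i=(I_{i-1}:u_i)$ for some monomial $u_i\in I_i$. The module $R/J$ is pretty clean if it has a monomial prime filtration such that whenever $\mathfrak{p}_i\subsetneq\mathfrak{p}_j$, then $j<i$. The module $R/J$ is sequentially Cohen-Macaulay if there is a chain of monomial ideals $J=I_0\subset I_1\subset\cdots\subset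 I_r=R$ such that each factor $I_i/I_{i-1}$ is Cohen-Macaulay and $\dim I_i/I_{i-1}<\dim I_{i+1}/I_i$ for $i=1,\ldots,r-1$. *)

theory Defs
  imports
    "HOL-Algebra.QuotRing"
    "HOL-Algebra.Module"
    "HOL-Algebra.Algebraic_Closure_Type"
    "HOL-Library.Poly_Mapping"
    "HOL-Library.Extended_Nat"
    "HOL-Library.Cardinality"
begin

section \<open>Modules over a commutative ring\<close>

text \<open>The \<open>mult\<close> and \<open>one\<close> fields of a \<open>module\<close> record play no role in
  the locale \<open>module\<close>; below they are only given some value.\<close>

definition ideal_module :: "('a, 'm) ring_scheme \<Rightarrow> 'a set \<Rightarrow> ('a, 'a) module" where
  "ideal_module R I = \<lparr>carrier = I, monoid.mult = monoid.mult R, one = one R,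
     zero = ring.zero R, add = ring.add R, module.smult = monoid.mult R\<rparr>"

definition quotient_module :: "('a, 'b, 'm) module_scheme \<Rightarrow> 'b set \<Rightarrow> ('a, 'b set) module" where
  "quotient_module M N = \<lparr>carrier = a_rcosets\<^bsub>M\<^esub> N, monoid.mult = rcoset_mult M N,
     one = N +>\<^bsub>M\<^esub> \<one>\<^bsub>M\<^esub>, ring.zero = N, add = set_add M,
     module.smult = (\<lambda>r A. \<Union>x\<in>A. N +>\<^bsub>M\<^esub> (r \<odot>\<^bsub>M\<^esub> x))\<rparr>"

definition module_iso ::
    "('a, 'm) ring_scheme \<Rightarrow> ('a, 'b, 'n) module_scheme \<Rightarrow> ('a, 'c, 'p) module_scheme \<Rightarrow> ('b \<Rightarrow> 'c) set" where
  "module_iso R M N = {h \<in> iso (add_monoid M) (add_monoid N).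
     \<forall>r\<in>carrier R. \<forall>x\<in>carrier M. h (r \<odot>\<^bsub>M\<^esub> x) = r \<odot>\<^bsub>N\<^esub> h x}"

definition module_isomorphic ::
    "('a, 'm) ring_scheme \<Rightarrow> ('a, 'b, 'n) module_scheme \<Rightarrow> ('a, 'c, 'p) module_scheme \<Rightarrow> bool" where
  "module_isomorphic R M N \<longleftrightarrow> module_iso R M N \<noteq> {}"

definition annihilator :: "('a, 'm) ring_scheme \<Rightarrow> ('a, 'b, 'n) module_scheme \<Rightarrow> 'a set" where
  "annihilator R M = {r \<in> carrier R. \<forall>x\<in>carrier M. r \<odot>\<^bsub>M\<^esub> x = \<zero>\<^bsub>M\<^esub>}"

text \<open>The Krull dimension of \<open>R / Ann M\<close>. It is \<open>0\<close> (and not \<open>- \<infinity>\<close>) for \<open>M = 0\<close>; it is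
  only used for nonzero modules.\<close>

definition module_dim :: "('a, 'm) ring_scheme \<Rightarrow> ('a, 'b, 'n) module_scheme \<Rightarrow> enat" where
  "module_dim R M = Sup {enat r | r. \<exists>P.
     (\<forall>i\<le>r. primeideal (P i) R \<and> annihilator R M \<subseteq> P i) \<and> (\<forall>i<r. P i \<subset> P (Suc i))}"

text \<open>For \<open>S\<close> a set of ring elements, the submodule \<open>(S) M\<close>. Scalars can be absorbed into the
  elements of \<open>M\<close>, so finite sums of products \<open>x m\<close> suffice.\<close>

definition set_smult :: "'a set \<Rightarrow> ('a, 'b, 'n) module_scheme \<Rightarrow> 'b set" where
  "set_smult S M = generate (add_monoid M) {x \<odot>\<^bsub>M\<^esub> m | x m. x \<in> S \<and> m \<in> carrier M}"

definition regular_sequence ::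
    "('a, 'm) ring_scheme \<Rightarrow> ('a, 'b, 'n) module_scheme \<Rightarrow> 'a list \<Rightarrow> bool" where
  "regular_sequence R M xs \<longleftrightarrow> set xs \<subseteq> carrier R \<and>
     (\<forall>i<length xs. \<forall>m\<in>carrier M.
        xs ! i \<odot>\<^bsub>M\<^esub> m \<in> set_smult (set (take i xs)) M \<longrightarrow> m \<in> set_smult (set (take i xs)) M) \<and>
     set_smult (set xs) M \<noteq> carrier M"

definition module_depth ::
    "('a, 'm) ring_scheme \<Rightarrow> 'a set \<Rightarrow> ('a, 'b, 'n) module_scheme \<Rightarrow> enat" where
  "module_depth R I M = Sup {enat (length xs) | xs. set xs \<subseteq> I \<and> regular_sequence R M xs}"


section \<open>Monomial ideals in a polynomial ring\<close>

text \<open>Polynomials over \<open>'k\<close> in the variables \<open>'v\<close>: finitely supported coefficient functions on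
  exponent vectors, with the convolution product of \<^theory>\<open>HOL-Library.Poly_Mapping\<close>.\<close>

type_synonym ('v, 'k) mpoly = "('v \<Rightarrow>\<^sub>0 nat) \<Rightarrow>\<^sub>0 'k"

abbreviation poly_ring :: "('v, 'k :: comm_ring_1) mpoly ring" where
  "poly_ring \<equiv> ring_of_type_algebra"

definition monomial :: "('v \<Rightarrow>\<^sub>0 nat) \<Rightarrow> ('v, 'k :: comm_ring_1) mpoly" where
  "monomial e = Poly_Mapping.single e 1"

definition var :: "'v \<Rightarrow> ('v, 'k :: comm_ring_1) mpoly" where
  "var v = monomial (Poly_Mapping.single v 1)"

definition total_degree :: "('v \<Rightarrow>\<^sub>0 nat) \<Rightarrow> nat" where
  "total_degree e = (\<Sum>v\<in>Poly_Mapping.keys e. Poly_Mapping.lookup e v)"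

definition sqfree_monomial :: "'v set \<Rightarrow> ('v, 'k :: comm_ring_1) mpoly" where
  "sqfree_monomial F = (\<Prod>v\<in>F. var v)"

definition max_graded_ideal :: "('v, 'k :: comm_ring_1) mpoly set" where
  "max_graded_ideal = Idl\<^bsub>poly_ring\<^esub> (range var)"

definition monomial_ideal :: "('v, 'k :: comm_ring_1) mpoly set \<Rightarrow> bool" where
  "monomial_ideal I \<longleftrightarrow> (\<exists>G. I = Idl\<^bsub>poly_ring\<^esub> (monomial ` G))"

definition sqfree_monomial_ideal :: "('v, 'k :: comm_ring_1) mpoly set \<Rightarrow> bool" where
  "sqfree_monomial_ideal I \<longleftrightarrow> (\<exists>S. I = Idl\<^bsub>poly_ring\<^esub> (sqfree_monomial ` S))"

definition minimal_monomial_generators ::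
    "('v \<Rightarrow>\<^sub>0 nat) set \<Rightarrow> ('v, 'k :: comm_ring_1) mpoly set \<Rightarrow> bool" where
  "minimal_monomial_generators G I \<longleftrightarrow>
     I = Idl\<^bsub>poly_ring\<^esub> (monomial ` G) \<and> (\<forall>G'. G' \<subset> G \<longrightarrow> I \<noteq> Idl\<^bsub>poly_ring\<^esub> (monomial ` G'))"

text \<open>The minimal set of monomial generators exists and is unique. For the zero ideal
  it is empty, so the zero ideal is of single degree \<open>d\<close> for every \<open>d\<close>.\<close>

definition single_degree :: "nat \<Rightarrow> ('v, 'k :: comm_ring_1) mpoly set \<Rightarrow> bool" where
  "single_degree d I \<longleftrightarrow> (\<exists>G. minimal_monomial_generators G I \<and> (\<forall>e\<in>G. total_degree e = d))"


section \<open>Stanley-Reisner ideals and Alexander duality\<close>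

text \<open>The vertex set is the whole type of variables. A complex need not contain all singletons,
  and the void complex is allowed; otherwise not every squarefree monomial ideal is a
  Stanley-Reisner ideal.\<close>

definition simplicial_complex :: "'v set set \<Rightarrow> bool" where
  "simplicial_complex \<Delta> \<longleftrightarrow> (\<forall>F\<in>\<Delta>. \<forall>G. G \<subseteq> F \<longrightarrow> G \<in> \<Delta>)"

definition stanley_reisner_ideal :: "'v set set \<Rightarrow> ('v, 'k :: comm_ring_1) mpoly set" where
  "stanley_reisner_ideal \<Delta> = Idl\<^bsub>poly_ring\<^esub> {sqfree_monomial F | F. F \<notin> \<Delta>}"

definition alexander_dual_complex :: "'v set set \<Rightarrow> 'v set set" where
  "alexander_dual_complex \<Delta> = {UNIV - A | A. A \<notin> \<Delta>}"

definition alexander_dual :: "('v, 'k :: comm_ring_1) mpoly set \<Rightarrow> ('v, 'k) mpoly set" where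
  "alexander_dual I = stanley_reisner_ideal (alexander_dual_complex
     (THE \<Delta>. simplicial_complex \<Delta> \<and> I = stanley_reisner_ideal \<Delta>))"


section \<open>Filtrations\<close>

text \<open>The subquotient \<open>L / J\<close> of the polynomial ring, for ideals \<open>J \<subseteq> L\<close>.\<close>

definition factor_module ::
    "('v, 'k :: comm_ring_1) mpoly set \<Rightarrow> ('v, 'k) mpoly set \<Rightarrow>
      (('v, 'k) mpoly, ('v, 'k) mpoly set) module" where
  "factor_module L J = quotient_module (ideal_module poly_ring L) J"

text \<open>Used for graded modules only, so the depth is taken in the graded maximal ideal. The zero
  module is excluded.\<close>

definition cohen_macaulay :: "(('v, 'k :: comm_ring_1) mpoly, 'b, 'n) module_scheme \<Rightarrow> bool" where
  "cohen_macaulay M \<longleftrightarrow> carrier M \<noteq> {\<zero>\<^bsub>M\<^esub>} \<and>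
     module_depth poly_ring max_graded_ideal M = module_dim poly_ring M"

text \<open>A chain \<open>J = I 0 \<subset> \<dots> \<subset> I r = R\<close>; the degenerate chain with \<open>r = 0\<close> is the one for \<open>J = R\<close>.\<close>

definition monomial_ideal_chain ::
    "('v, 'k :: comm_ring_1) mpoly set \<Rightarrow> nat \<Rightarrow> (nat \<Rightarrow> ('v, 'k) mpoly set) \<Rightarrow> bool" where
  "monomial_ideal_chain J r I \<longleftrightarrow> I 0 = J \<and> I r = UNIV \<and>
     (\<forall>i\<le>r. monomial_ideal (I i)) \<and> (\<forall>i<r. I i \<subset> I (Suc i))"

definition monomial_prime_filtration ::
    "('v, 'k :: comm_ring_1) mpoly set \<Rightarrow> nat \<Rightarrow> (nat \<Rightarrow> ('v, 'k) mpoly set) \<Rightarrow>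
      (nat \<Rightarrow> ('v, 'k) mpoly set) \<Rightarrow> bool" where
  "monomial_prime_filtration J r I p \<longleftrightarrow> monomial_ideal_chain J r I \<and>
     (\<forall>i\<in>{1..r}. primeideal (p i) poly_ring \<and> monomial_ideal (p i) \<and>
        module_isomorphic poly_ring (factor_module (I i) (I (i - 1))) (factor_module UNIV (p i)))"

definition pretty_clean :: "('v, 'k :: comm_ring_1) mpoly set \<Rightarrow> bool" where
  "pretty_clean J \<longleftrightarrow> (\<exists>r I p. monomial_prime_filtration J r I p \<and>
     (\<forall>i\<in>{1..r}. \<forall>j\<in>{1..r}. p i \<subset> p j \<longrightarrow> j < i))"

definition sequentially_cohen_macaulay :: "('v, 'k :: comm_ring_1) mpoly set \<Rightarrow> bool" where
  "sequentially_cohen_macaulay J \<longleftrightarrow> (\<exists>r I. monomial_ideal_chain J r I \<and>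
     (\<forall>i\<in>{1..r}. cohen_macaulay (factor_module (I i) (I (i - 1)))) \<and>
     (\<forall>i\<in>{1..<r}. module_dim poly_ring (factor_module (I i) (I (i - 1)))
        < module_dim poly_ring (factor_module (I (i + 1)) (I i))))"

end

theory Submission
  imports Defs
begin

text \<open>
  All generators having degree \<open>d\<close>, the ideal \<open>J = I\<^sup>\<or>\<close> is the intersection of the primes \<open>P F\<close> generated
  by the variables outside \<open>F\<close>, where \<open>F\<close> ranges over facets of the same size \<open>m = 5 - d\<close>. Such an ideal
  is unmixed, so \<open>R / J\<close> is sequentially Cohen-Macaulay only if it is Cohen-Macaulay.

  In a pretty clean filtration of \<open>R / J\<close> all primes are of the form \<open>P F\<close>. The elementary symmetric
  polynomials \<open>e m, \<dots>, e 1\<close> are a regular sequence on every \<open>R / P F\<close>, hence on \<open>R / J\<close>. Neither depth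
  nor dimension can exceed \<open>m\<close>: counting monomials shows that more than \<open>m\<close> polynomials are
  algebraically dependent modulo \<open>J\<close>, and a Coquand-Lombardi identity derived from the dependence
  contradicts a longer regular sequence or chain of primes.

  Conversely, depth \<open>m\<close> forces the Koszul cohomology of \<open>R / J\<close> to vanish below degree \<open>m\<close>. For \<open>m = 2\<close>
  the complex is therefore a connected graph. For \<open>m = 3\<close>, explicit cocycles show that the
  complement of the graph of complements of facets has no induced cycle of length \<open>4\<close> or \<open>5\<close>, so that it
  is chordal; a perfect elimination order gives a shelling. For other \<open>m\<close> any two facets meet in a
  ridge. A shelling yields a filtration with factors \<open>R / P F\<close>, and it is pretty clean because these
  primes are pairwise incomparable.
\<close>

section \<open>Ideals and factor modules\<close>

text \<open>The criterion for m = 3 has its origin in two theorems. There d = 2, so the generators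
  of I are the edges of a graph. By Eagon-Reiner, R / J is Cohen-Macaulay exactly if I has a linear
  resolution, by Froberg exactly if the complementary graph is chordal. Resolutions are avoided
  here: the cocycles exhibit the cohomology of the complex, or of the link of a vertex, that
  Reisner's criterion forbids. Depth is a supremum over arbitrary sequences in the graded maximal
  ideal, not only homogeneous ones. The Koszul argument tolerates this, because it uses only that
  each element is a combination of the variables; the grading enters at the end, when one
  coefficient of a cochain is compared. Five vertices keep the obstructions few and independent of
  the field. On six vertices the statement fails: the triangulated projective plane is
  Cohen-Macaulay outside characteristic 2, but a pretty clean filtration would make it so over every
  field.\<close>

definition is_ideal :: "'a::comm_ring_1 set \<Rightarrow> bool" where
  "is_ideal I \<longleftrightarrow> 0 \<in> I \<and> (\<forall>x\<in>I. \<forall>y\<in>I. x + y \<in> I) \<and> (\<forall>x\<in>I. \<forall>r. r * x \<in> I)"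

definition is_prime :: "'a::comm_ring_1 set \<Rightarrow> bool" where
  "is_prime P \<longleftrightarrow> is_ideal P \<and> 1 \<notin> P \<and> (\<forall>x y. x * y \<in> P \<longrightarrow> x \<in> P \<or> y \<in> P)"

lemma is_idealD:
  assumes "is_ideal I"
  shows "0 \<in> I" "x \<in> I \<Longrightarrow> y \<in> I \<Longrightarrow> x + y \<in> I" "x \<in> I \<Longrightarrow> r * x \<in> I"
    "x \<in> I \<Longrightarrow> x * r \<in> I" "x \<in> I \<Longrightarrow> - x \<in> I" "x \<in> I \<Longrightarrow> y \<in> I \<Longrightarrow> x - y \<in> I"
proof -
  show 0: "0 \<in> I" and p: "\<And>x y. x \<in> I \<Longrightarrow> y \<in> I \<Longrightarrow> x + y \<in> I" and m: "\<And>x r. x \<in> I \<Longrightarrow> r * x \<in> I"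
    using assms by (auto simp: is_ideal_def)
  show "x \<in> I \<Longrightarrow> x * r \<in> I" using m[of x r] by (simp add: mult.commute)
  show n: "- x \<in> I" if "x \<in> I" for x using m[OF that, of "-1"] by simp
  show "x - y \<in> I" if "x \<in> I" "y \<in> I" using p[OF that(1) n[OF that(2)]] by simp
qed

lemma is_ideal_sum:
  assumes "is_ideal I" "\<And>i. i \<in> A \<Longrightarrow> f i \<in> I"
  shows "sum f A \<in> I"
  using assms(2) by (induction A rule: infinite_finite_induct) (auto intro: is_idealD[OF assms(1)])

lemma ring_of_type_algebra_simps [simp]:
  "carrier (ring_of_type_algebra :: 'a::comm_ring_1 ring) = UNIV"
  "(x::'a) \<otimes>\<^bsub>ring_of_type_algebra\<^esub> y = x * y"
  "(x::'a) \<oplus>\<^bsub>ring_of_type_algebra\<^esub> y = x + y"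
  "\<one>\<^bsub>ring_of_type_algebra\<^esub> = (1::'a)"
  "\<zero>\<^bsub>ring_of_type_algebra\<^esub> = (0::'a)"
  by (auto simp: ring_of_type_algebra_def)

lemma ideal_iff_is_ideal:
  "ideal (I :: 'a::comm_ring_1 set) ring_of_type_algebra \<longleftrightarrow> is_ideal I"
proof
  assume "ideal I ring_of_type_algebra"
  then interpret ideal I "ring_of_type_algebra :: 'a ring" .
  show "is_ideal I"
    unfolding is_ideal_def
    using additive_subgroup.zero_closed[OF additive_subgroup_axioms]
      additive_subgroup.a_closed[OF additive_subgroup_axioms] I_l_closed
    by simp
next
  assume I: "is_ideal I"
  interpret R: cring "ring_of_type_algebra :: 'a ring" ..
  show "ideal I ring_of_type_algebra"
  proof (rule idealI)
    have neg: "\<ominus>\<^bsub>ring_of_type_algebra\<^esub> x = - x" for x :: 'a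
      using R.minus_equality[of "- x" x] by simp
    show "subgroup I (add_monoid ring_of_type_algebra)"
      by (rule R.add.subgroupI) (use I in \<open>auto simp: neg a_inv_def[symmetric] intro: is_idealD\<close>)
  qed (use I in \<open>auto intro: is_idealD R.ring_axioms\<close>)
qed

lemma primeideal_iff_is_prime:
  "primeideal (P :: 'a::comm_ring_1 set) ring_of_type_algebra \<longleftrightarrow> is_prime P"
proof
  assume "primeideal P ring_of_type_algebra"
  then interpret primeideal P "ring_of_type_algebra :: 'a ring" .
  have "is_ideal P" using is_ideal by (simp add: ideal_iff_is_ideal)
  then show "is_prime P"
    using I_notcarr I_prime one_imp_carrier unfolding is_prime_def by force
next
  assume P: "is_prime P"
  interpret R: cring "ring_of_type_algebra :: 'a ring" ..
  show "primeideal P ring_of_type_algebra"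
    by (rule primeidealI) (use P R.cring_axioms in \<open>auto simp: ideal_iff_is_ideal is_prime_def\<close>)
qed

abbreviation idl :: "'a::comm_ring_1 set \<Rightarrow> 'a set" where
  "idl S \<equiv> Idl\<^bsub>ring_of_type_algebra\<^esub> S"

lemma is_ideal_idl [simp]: "is_ideal (idl S)"
proof -
  interpret R: cring "ring_of_type_algebra :: 'a ring" ..
  show ?thesis using R.genideal_ideal[of S] by (simp add: ideal_iff_is_ideal)
qed

lemma idl_superset: "S \<subseteq> idl (S :: 'a::comm_ring_1 set)"
proof -
  interpret R: cring "ring_of_type_algebra :: 'a ring" ..
  show ?thesis using R.genideal_self[of S] by simp
qed

lemma idl_minimal: "is_ideal I \<Longrightarrow> S \<subseteq> I \<Longrightarrow> idl S \<subseteq> (I :: 'a::comm_ring_1 set)"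
proof -
  interpret R: cring "ring_of_type_algebra :: 'a ring" ..
  show "is_ideal I \<Longrightarrow> S \<subseteq> I \<Longrightarrow> idl S \<subseteq> I"
    using R.genideal_minimal[of I S] by (simp add: ideal_iff_is_ideal)
qed

lemma idl_eqI: "is_ideal I \<Longrightarrow> S \<subseteq> I \<Longrightarrow> (\<And>I'. is_ideal I' \<Longrightarrow> S \<subseteq> I' \<Longrightarrow> I \<subseteq> I') \<Longrightarrow> idl S = I"
  using idl_minimal[of I S] idl_superset[of S] is_ideal_idl[of S] by blast


definition coset :: "'a::comm_ring_1 set \<Rightarrow> 'a \<Rightarrow> 'a set" where
  "coset J x = (\<lambda>j. j + x) ` J"

lemma coset_eq_iff:
  assumes "is_ideal J"
  shows "coset J x = coset J y \<longleftrightarrow> x - y \<in> J"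
proof
  assume "coset J x = coset J y"
  then have "0 + x \<in> coset J y" using is_idealD(1)[OF assms] unfolding coset_def by blast
  then show "x - y \<in> J" by (auto simp: coset_def)
next
  assume xy: "x - y \<in> J"
  have "j + x \<in> coset J y" if "j \<in> J" for j
    unfolding coset_def by (rule image_eqI[of _ _ "j + (x - y)"]) (use that xy assms in \<open>auto intro: is_idealD\<close>)
  moreover have "j + y \<in> coset J x" if "j \<in> J" for j
    unfolding coset_def by (rule image_eqI[of _ _ "j - (x - y)"]) (use that xy assms in \<open>auto intro: is_idealD\<close>)
  ultimately show "coset J x = coset J y" unfolding coset_def[of J x] coset_def[of J y]
    by (auto simp: coset_def)
qed

lemma coset_zero [simp]: "coset J 0 = J"
  by (simp add: coset_def)

lemma coset_eq_self_iff: "is_ideal J \<Longrightarrow> coset J x = J \<longleftrightarrow> x \<in> J"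
  using coset_eq_iff[of J x 0] by simp

lemma factor_module_carrier: "carrier (factor_module L J) = coset J ` L"
  by (auto simp: factor_module_def quotient_module_def ideal_module_def A_RCOSETS_def RCOSETS_def
      r_coset_def coset_def)

lemma factor_module_zero: "\<zero>\<^bsub>factor_module L J\<^esub> = J"
  by (simp add: factor_module_def quotient_module_def)

lemma factor_module_add:
  assumes "is_ideal J"
  shows "coset J x \<oplus>\<^bsub>factor_module L J\<^esub> coset J y = coset J (x + y)"
proof -
  have "coset J x \<oplus>\<^bsub>factor_module L J\<^esub> coset J y = (\<Union>h\<in>coset J x. \<Union>k\<in>coset J y. {h + k})"
    by (simp add: factor_module_def quotient_module_def ideal_module_def set_add_def set_mult_def)
  also have "\<dots> = coset J (x + y)"
  proof (intro equalityI subsetI)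
    fix z assume "z \<in> (\<Union>h\<in>coset J x. \<Union>k\<in>coset J y. {h + k})"
    then obtain i j where ij: "i \<in> J" "j \<in> J" "z = (i + x) + (j + y)" by (auto simp: coset_def)
    then have "z = (i + j) + (x + y)" "i + j \<in> J" using assms by (auto intro: is_idealD)
    then show "z \<in> coset J (x + y)" by (auto simp: coset_def)
  next
    fix z assume "z \<in> coset J (x + y)"
    then obtain j where j: "j \<in> J" "z = (j + x) + (0 + y)" by (auto simp: coset_def add.assoc)
    moreover have "0 + y \<in> coset J y" unfolding coset_def using assms by (blast intro: is_idealD)
    moreover have "j + x \<in> coset J x" unfolding coset_def using j by blast
    ultimately show "z \<in> (\<Union>h\<in>coset J x. \<Union>k\<in>coset J y. {h + k})" by blast
  qed
  finally show ?thesis .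
qed

lemma factor_module_smult:
  assumes "is_ideal J"
  shows "r \<odot>\<^bsub>factor_module L J\<^esub> coset J x = coset J (r * x)"
proof -
  have "r \<odot>\<^bsub>factor_module L J\<^esub> coset J x = (\<Union>y\<in>coset J x. coset J (r * y))"
    by (auto simp: factor_module_def quotient_module_def ideal_module_def a_r_coset_def r_coset_def
        coset_def)
  also have "\<dots> = (\<Union>y\<in>coset J x. coset J (r * x))"
  proof (rule SUP_cong)
    fix y assume "y \<in> coset J x"
    then obtain j where "j \<in> J" "y = j + x" by (auto simp: coset_def)
    then show "coset J (r * y) = coset J (r * x)"
      using assms by (auto simp: coset_eq_iff algebra_simps intro: is_idealD)
  qed simp
  also have "\<dots> = coset J (r * x)" using assms is_idealD(1)[of J] by (auto simp: coset_def)
  finally show ?thesis .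
qed

lemma annihilator_factor_module:
  assumes "is_ideal J"
  shows "annihilator poly_ring (factor_module L J) = {r. \<forall>x\<in>L. r * x \<in> J}"
  by (auto simp: annihilator_def factor_module_carrier factor_module_zero factor_module_smult
      coset_eq_self_iff assms)

text \<open>A module isomorphic to \<open>R / p\<close> is cyclic: \<open>u\<close> is a preimage of the class of \<open>1\<close>.\<close>

lemma module_isomorphic_cyclicD:
  fixes L J p :: "('v, 'k::comm_ring_1) mpoly set"
  assumes J: "is_ideal J" and L: "is_ideal L" and p: "is_ideal p" and JL: "J \<subseteq> L"
    and iso: "module_isomorphic poly_ring (factor_module L J) (factor_module UNIV p)"
  obtains u where "u \<in> L" "\<And>x. x \<in> L \<Longrightarrow> \<exists>r. x - r * u \<in> J" "\<And>r. r * u \<in> J \<longleftrightarrow> r \<in> p"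
proof -
  obtain h where h: "bij_betw h (coset J ` L) (coset p ` UNIV)"
    and hr: "\<And>r x. x \<in> L \<Longrightarrow> h (coset J (r * x)) = r \<odot>\<^bsub>factor_module UNIV p\<^esub> h (coset J x)"
    using iso by (auto simp: module_isomorphic_def module_iso_def iso_def factor_module_carrier
        factor_module_smult J)
  obtain u where u: "u \<in> L" "h (coset J u) = coset p 1"
    using bij_betw_imp_surj_on[OF h] by (metis (no_types, lifting) UNIV_I imageE image_eqI)
  have hu: "h (coset J (r * u)) = coset p r" for r
    using hr[OF u(1), of r] u(2) by (simp add: factor_module_smult p)
  have inj: "coset J x = coset J y" if "h (coset J x) = h (coset J y)" "x \<in> L" "y \<in> L" for x y
    using that bij_betw_imp_inj_on[OF h] by (auto dest: inj_onD)
  show ?thesis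
  proof (rule that[OF u(1)])
    fix x assume x: "x \<in> L"
    obtain r where "h (coset J x) = coset p r"
      using x bij_betw_imp_surj_on[OF h] by (metis (no_types, lifting) imageE image_eqI)
    then have "coset J x = coset J (r * u)"
      using hu inj x u(1) L by (metis is_idealD(3))
    then show "\<exists>r. x - r * u \<in> J" by (auto simp: coset_eq_iff J)
  next
    fix r
    have "r * u \<in> J \<longleftrightarrow> coset J (r * u) = coset J (0 * u)" by (simp add: coset_eq_self_iff J)
    also have "\<dots> \<longleftrightarrow> h (coset J (r * u)) = h (coset J (0 * u))"
      using inj[of "r * u" "0 * u"] u(1) L by (metis is_idealD(3))
    also have "\<dots> \<longleftrightarrow> r \<in> p" by (simp only: hu coset_eq_iff[OF p] diff_zero)
    finally show "r * u \<in> J \<longleftrightarrow> r \<in> p" .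
  qed
qed

text \<open>The isomorphism is the inverse of multiplication by \<open>u\<close> from R / p to L /
  J.\<close>

lemma module_isomorphic_cyclicI:
  fixes L J p :: "('v, 'k::comm_ring_1) mpoly set"
  assumes J: "is_ideal J" and L: "is_ideal L" and p: "is_ideal p" and JL: "J \<subseteq> L"
    and u: "u \<in> L" "\<And>x. x \<in> L \<Longrightarrow> \<exists>r. x - r * u \<in> J" "\<And>r. r * u \<in> J \<longleftrightarrow> r \<in> p"
  shows "module_isomorphic poly_ring (factor_module L J) (factor_module UNIV p)"
proof -
  obtain q where q: "\<And>x. x \<in> L \<Longrightarrow> x - q x * u \<in> J" using u(2) by metis
  \<comment> \<open>\<open>h\<close> acts on cosets, hence the choice of a representative. The fact
    \<open>h\<close> below shows that neither the representative nor the coefficient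
    matters.\<close>
  define h where "h A = coset p (q (SOME x. x \<in> L \<and> A = coset J x))" for A
  have h: "h (coset J x) = coset p r" if x: "x \<in> L" and xr: "x - r * u \<in> J" for x r
  proof -
    define y where "y = (SOME y. y \<in> L \<and> coset J x = coset J y)"
    have y: "y \<in> L \<and> coset J x = coset J y"
      unfolding y_def by (rule someI[of _ x]) (use x in auto)
    then have "x - y \<in> J" by (simp add: coset_eq_iff J)
    then have "(x - r * u) - (x - y) - (y - q y * u) \<in> J"
      using xr q[of y] y by (blast intro: is_idealD(6)[OF J])
    then have "(q y - r) * u \<in> J" by (simp add: algebra_simps)
    then show ?thesis by (simp add: h_def coset_eq_iff p u(3) flip: y_def)
  qed
  have cl: "h (coset J x) \<in> range (coset p)" if "x \<in> L" for x
      using h[OF that q[OF that]] by simp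
  have add: "h (coset J x \<oplus>\<^bsub>factor_module L J\<^esub> coset J y) =
      h (coset J x) \<oplus>\<^bsub>factor_module UNIV p\<^esub> h (coset J y)" if xy: "x \<in> L" "y \<in> L" for x y
    proof -
      have "(x - q x * u) + (y - q y * u) \<in> J" using q xy by (intro is_idealD(2)[OF J])
      then have "(x + y) - (q x + q y) * u \<in> J" by (simp add: algebra_simps)
      from h[OF _ this] show ?thesis
        by (simp add: factor_module_add J p h[OF xy(1) q[OF xy(1)]] h[OF xy(2) q[OF xy(2)]]
            is_idealD[OF L] xy)
    qed
  have sm: "h (r \<odot>\<^bsub>factor_module L J\<^esub> coset J x) = r \<odot>\<^bsub>factor_module UNIV p\<^esub> h (coset J x)"
      if x: "x \<in> L" for r x
    proof -
      have "r * (x - q x * u) \<in> J" using q x by (intro is_idealD(3)[OF J])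
      then have "r * x - (r * q x) * u \<in> J" by (simp add: algebra_simps)
      from h[OF _ this] show ?thesis
        by (simp add: factor_module_smult J p h[OF x q[OF x]] is_idealD[OF L] x)
    qed
  have bij: "bij_betw h (coset J ` L) (range (coset p))"
      unfolding bij_betw_def
    proof (safe intro!: inj_onI)
      fix x y assume xy: "x \<in> L" "y \<in> L" and "h (coset J x) = h (coset J y)"
      then have "coset p (q x) = coset p (q y)"
        using h[OF xy(1) q[OF xy(1)]] h[OF xy(2) q[OF xy(2)]] by simp
      then have "(q x - q y) * u \<in> J" by (simp add: coset_eq_iff p u(3))
      then have "(q x - q y) * u + (x - q x * u) - (y - q y * u) \<in> J"
        using q xy by (blast intro: is_idealD(2,6)[OF J])
      then have "coset J x = coset J y" by (simp add: coset_eq_iff J algebra_simps)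
      then show "a \<in> coset J x \<Longrightarrow> a \<in> coset J y" "a \<in> coset J y \<Longrightarrow> a \<in> coset J x" for a by auto
    next
      show "h (coset J x) \<in> range (coset p)" if "x \<in> L" for x
        using cl[OF that] .
      show "coset p x \<in> h ` coset J ` L" for x
        using h[of "x * u" x] is_idealD[OF L] is_idealD[OF J] u(1)
        by (metis diff_self image_eqI)
    qed
  have "h \<in> module_iso poly_ring (factor_module L J) (factor_module UNIV p)"
    unfolding module_iso_def iso_def hom_def using cl add sm bij
    by (auto simp: factor_module_carrier)
  then show ?thesis by (auto simp: module_isomorphic_def)
qed


section \<open>Regular sequences\<close>

text \<open>For ideals this is f A + B. With \<open>A = UNIV\<close> it adjoins \<open>f\<close> to
  \<open>B\<close>; with \<open>f = 1\<close> it is the sum of the two ideals.\<close>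

definition combine :: "'a::comm_ring_1 \<Rightarrow> 'a set \<Rightarrow> 'a set \<Rightarrow> 'a set" where
  "combine f A B = {f * a + b | a b. a \<in> A \<and> b \<in> B}"

text \<open>For ideals \<open>A\<close> and \<open>B\<close>, \<open>wreg fs A B\<close> says that \<open>fs\<close> is a weakly regular sequence on
  \<open>A / (A \<inter> B)\<close>. Not requiring \<open>B \<subseteq> A\<close> spares the use of isomorphism theorems.\<close>

fun wreg :: "'a::comm_ring_1 list \<Rightarrow> 'a set \<Rightarrow> 'a set \<Rightarrow> bool" where
  "wreg [] A B \<longleftrightarrow> True"
| "wreg (f # fs) A B \<longleftrightarrow> (\<forall>y\<in>A. f * y \<in> B \<longrightarrow> y \<in> B) \<and> wreg fs A (combine f A B)"

lemma is_ideal_combine: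
  assumes "is_ideal A" "is_ideal B"
  shows "is_ideal (combine f A B)"
  unfolding is_ideal_def
proof (intro conjI ballI allI)
  show "0 \<in> combine f A B"
    using is_idealD(1)[OF assms(1)] is_idealD(1)[OF assms(2)] by (force simp: combine_def)
next
  fix x y assume "x \<in> combine f A B" "y \<in> combine f A B"
  then obtain a b a' b' where *: "a \<in> A" "b \<in> B" "a' \<in> A" "b' \<in> B"
    and "x = f * a + b" "y = f * a' + b'" by (auto simp: combine_def)
  then have "x + y = f * (a + a') + (b + b')" by (simp add: algebra_simps)
  moreover have "a + a' \<in> A" "b + b' \<in> B" using * assms by (auto intro: is_idealD)
  ultimately show "x + y \<in> combine f A B" by (auto simp: combine_def)
next
  fix x r assume "x \<in> combine f A B"
  then obtain a b where *: "a \<in> A" "b \<in> B" "x = f * a + b" by (auto simp: combine_def)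
  then have "r * x = f * (r * a) + r * b" by (simp add: algebra_simps)
  moreover have "r * a \<in> A" "r * b \<in> B" using * assms by (auto intro: is_idealD)
  ultimately show "r * x \<in> combine f A B" by (auto simp: combine_def)
qed

text \<open>Moves one generator into the base ideal, which matches the recursion of
  \<open>wreg\<close> with the prefixes of a regular sequence.\<close>

lemma idl_insert:
  assumes J: "is_ideal J"
  shows "idl (insert f (S \<union> J)) = idl (S \<union> combine f UNIV J)"
proof (rule antisym; rule idl_minimal)
  have "f * 1 + 0 \<in> combine f UNIV J" "\<And>j. j \<in> J \<Longrightarrow> f * 0 + j \<in> combine f UNIV J"
    using is_idealD(1)[OF J] unfolding combine_def by blast+
  then show "insert f (S \<union> J) \<subseteq> idl (S \<union> combine f UNIV J)"
    using idl_superset[of "S \<union> combine f UNIV J"] by auto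
  have "f * a + b \<in> idl (insert f (S \<union> J))" if "b \<in> J" for a b
    using that idl_superset[of "insert f (S \<union> J)"] by (intro is_idealD(2,4)[OF is_ideal_idl]) auto
  then show "S \<union> combine f UNIV J \<subseteq> idl (insert f (S \<union> J))"
    using idl_superset[of "insert f (S \<union> J)"] by (auto simp: combine_def)
qed simp_all

lemma idl_self: "is_ideal J \<Longrightarrow> idl J = J"
  by (rule idl_eqI) auto

lemma wreg_iff:
  assumes "is_ideal J"
  shows "wreg xs UNIV J \<longleftrightarrow>
    (\<forall>i<length xs. \<forall>m. xs ! i * m \<in> idl (set (take i xs) \<union> J) \<longrightarrow> m \<in> idl (set (take i xs) \<union> J))"
  using assms
proof (induction xs arbitrary: J)
  case (Cons f xs)
  have *: "is_ideal (combine f UNIV J)"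
    using Cons.prems by (intro is_ideal_combine) (auto simp: is_ideal_def)
  show ?case
    using Cons.prems by (auto simp: All_less_Suc2 Cons.IH[OF *] idl_insert idl_self)
qed simp

lemma factor_module_a_inv:
  assumes "is_ideal J"
  shows "inv\<^bsub>add_monoid (factor_module UNIV J)\<^esub> (coset J x) = coset J (- x)"
  unfolding m_inv_def
proof (rule the_equality, safe)
  fix A assume "A \<in> carrier (add_monoid (factor_module UNIV J))"
    and e: "coset J x \<otimes>\<^bsub>add_monoid (factor_module UNIV J)\<^esub> A = \<one>\<^bsub>add_monoid (factor_module UNIV J)\<^esub>"
  then obtain y where y: "A = coset J y" by (auto simp: factor_module_carrier)
  with e have "y - - x \<in> J"
    by (simp add: factor_module_add factor_module_zero coset_eq_self_iff assms add.commute)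
  then have "A = coset J (- x)" by (simp add: y coset_eq_iff assms)
  then show "a \<in> A \<Longrightarrow> a \<in> coset J (- x)" "a \<in> coset J (- x) \<Longrightarrow> a \<in> A" for a by auto
qed (auto simp: factor_module_carrier factor_module_add factor_module_zero assms)

lemma set_smult_factor_module:
  fixes J :: "('v, 'k::comm_ring_1) mpoly set"
  assumes J: "is_ideal J"
  shows "set_smult S (factor_module UNIV J) = coset J ` idl (S \<union> J)"
proof (rule antisym)
  have I: "is_ideal (idl (S \<union> J))" and S: "S \<subseteq> idl (S \<union> J)" and JJ: "J \<subseteq> idl (S \<union> J)"
    using idl_superset[of "S \<union> J"] by auto
  show "set_smult S (factor_module UNIV J) \<subseteq> coset J ` idl (S \<union> J)"
  proof
    fix A assume "A \<in> set_smult S (factor_module UNIV J)"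
    then show "A \<in> coset J ` idl (S \<union> J)"
      unfolding set_smult_def
    proof induction
      case one
      then show ?case using is_idealD(1)[OF I] by (force simp: factor_module_zero)
    next
      case (incl A)
      then show ?case using S is_idealD(4)[OF I]
        by (force simp: factor_module_carrier factor_module_smult J)
    next
      case (inv A)
      then obtain x m where "x \<in> S" "A = coset J (x * m)"
        by (auto simp: factor_module_carrier factor_module_smult J)
      then show ?case using S is_idealD(4,5)[OF I] by (force simp: factor_module_a_inv J)
    next
      case (eng A B)
      then show ?case using is_idealD(2)[OF I] by (force simp: factor_module_add J)
    qed
  qed
  \<comment> \<open>\<open>generate\<close> closes only under sums and inverses, so closure under
    scalars takes its own induction. It runs over cosets, hence the quantified
    representative.\<close>
  have sm: "coset J y \<in> set_smult S (factor_module UNIV J) \<Longrightarrow>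
    coset J (r * y) \<in> set_smult S (factor_module UNIV J)" for r y
  proof -
    let ?M = "factor_module UNIV J"
    have "A \<in> set_smult S ?M \<Longrightarrow> \<forall>y. A = coset J y \<longrightarrow> coset J (r * y) \<in> set_smult S ?M" for A
      unfolding set_smult_def
    proof (induction rule: generate.induct)
      case one
      have "coset J (r * y) = \<one>\<^bsub>add_monoid ?M\<^esub>" if "J = coset J y" for y
        using that[symmetric] is_idealD(3)[OF J] by (simp add: factor_module_zero coset_eq_self_iff J)
      then show ?case using generate.one[of "add_monoid ?M"] by (auto simp: factor_module_zero)
    next
      case (incl A)
      then obtain x m where xm: "x \<in> S" "A = coset J (x * m)"
        by (auto simp: factor_module_carrier factor_module_smult J)
      have "coset J (r * y) = x \<odot>\<^bsub>?M\<^esub> coset J (r * m)" if "A = coset J y" for y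
      proof -
        have "r * (y - x * m) \<in> J" using that xm by (intro is_idealD(3)[OF J]) (metis coset_eq_iff[OF J])
        then show ?thesis by (simp add: factor_module_smult coset_eq_iff J algebra_simps)
      qed
      then show ?case using xm
        by (auto intro!: generate.incl simp: factor_module_carrier)
    next
      case (inv A)
      then obtain x m where xm: "x \<in> S" "A = coset J (x * m)"
        by (auto simp: factor_module_carrier factor_module_smult J)
      have "coset J (r * y) = x \<odot>\<^bsub>?M\<^esub> coset J (- (r * m))"
        if "inv\<^bsub>add_monoid ?M\<^esub> A = coset J y" for y
      proof -
        have "r * (y - - (x * m)) \<in> J"
          using that xm by (intro is_idealD(3)[OF J]) (metis coset_eq_iff[OF J] factor_module_a_inv[OF J])
        then show ?thesis by (simp add: factor_module_smult coset_eq_iff J algebra_simps)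
      qed
      then show ?case using xm
        by (auto intro!: generate.incl simp: factor_module_carrier)
    next
      case (eng A B)
      have "A \<in> coset J ` UNIV" "B \<in> coset J ` UNIV"
        using eng(1,2) \<open>set_smult S ?M \<subseteq> coset J ` idl (S \<union> J)\<close> unfolding set_smult_def by auto
      then obtain a b where ab: "A = coset J a" "B = coset J b" by auto
      have "coset J (r * y) = coset J (r * a) \<oplus>\<^bsub>?M\<^esub> coset J (r * b)" if "coset J (a + b) = coset J y" for y
      proof -
        have "r * (y - (a + b)) \<in> J" using that by (intro is_idealD(3)[OF J]) (metis coset_eq_iff[OF J])
        then show ?thesis by (simp add: factor_module_add coset_eq_iff J algebra_simps)
      qed
      moreover have "coset J (r * a) \<oplus>\<^bsub>?M\<^esub> coset J (r * b) \<in>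
        generate (add_monoid ?M) {x \<odot>\<^bsub>?M\<^esub> m | x m. x \<in> S \<and> m \<in> carrier ?M}"
        using generate.eng[of _ "add_monoid ?M"] eng.IH ab by simp
      ultimately show ?case by (auto simp: ab factor_module_add J)
    qed
    then show "coset J y \<in> set_smult S ?M \<Longrightarrow> coset J (r * y) \<in> set_smult S ?M" by blast
  qed
  have "idl (S \<union> J) \<subseteq> {y. coset J y \<in> set_smult S (factor_module UNIV J)}"
  proof (rule idl_minimal)
    have J0: "J \<in> set_smult S (factor_module UNIV J)"
      using generate.one[of "add_monoid (factor_module UNIV J)"]
      by (simp add: set_smult_def factor_module_zero)
    have "coset J (x + y) \<in> set_smult S (factor_module UNIV J)"
      if "coset J x \<in> set_smult S (factor_module UNIV J)" "coset J y \<in> set_smult S (factor_module UNIV J)" for x y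
      using generate.eng[OF that[unfolded set_smult_def]] by (simp add: factor_module_add J set_smult_def)
    then show "is_ideal {y. coset J y \<in> set_smult S (factor_module UNIV J)}"
      unfolding is_ideal_def using J0 sm by simp
    have "coset J (x * 1) \<in> set_smult S (factor_module UNIV J)" if "x \<in> S" for x
      unfolding set_smult_def factor_module_smult[OF J, symmetric, where L = UNIV]
      using that by (intro generate.incl) (auto simp: factor_module_carrier)
    moreover have "coset J x = J" if "x \<in> J" for x using that by (simp add: coset_eq_self_iff J)
    ultimately show "S \<union> J \<subseteq> {y. coset J y \<in> set_smult S (factor_module UNIV J)}"
      using J0 by auto
  qed
  then show "coset J ` idl (S \<union> J) \<subseteq> set_smult S (factor_module UNIV J)" by auto
qed

lemma coset_image_mem_iff:
  assumes "is_ideal J" "is_ideal L" "J \<subseteq> L"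
  shows "coset J y \<in> coset J ` L \<longleftrightarrow> y \<in> L"
proof
  assume "coset J y \<in> coset J ` L"
  then obtain x where "x \<in> L" "y - x \<in> L" using assms by (auto simp: coset_eq_iff)
  from is_idealD(2)[OF assms(2) this] show "y \<in> L" by simp
qed simp

lemma regular_sequence_iff:
  fixes J :: "('v, 'k::comm_ring_1) mpoly set"
  assumes J: "is_ideal J"
  shows "regular_sequence poly_ring (factor_module UNIV J) xs \<longleftrightarrow>
    wreg xs UNIV J \<and> 1 \<notin> idl (set xs \<union> J)"
proof -
  have *: "coset J y \<in> coset J ` idl (S \<union> J) \<longleftrightarrow> y \<in> idl (S \<union> J)" for S y
    using idl_superset[of "S \<union> J"] by (intro coset_image_mem_iff) (auto simp: J)
  have "coset J ` I \<noteq> coset J ` UNIV \<longleftrightarrow> 1 \<notin> I" if I: "is_ideal I" "J \<subseteq> I" for I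
  proof -
    have "coset J ` I = coset J ` UNIV \<longleftrightarrow> I = UNIV"
      using coset_image_mem_iff[OF J I] by (metis UNIV_eq_I rangeI)
    also have "\<dots> \<longleftrightarrow> 1 \<in> I" using is_idealD(3)[OF I(1), of 1] by auto
    finally show ?thesis by blast
  qed
  then have "coset J ` idl (set xs \<union> J) \<noteq> coset J ` UNIV \<longleftrightarrow> 1 \<notin> idl (set xs \<union> J)"
    using idl_superset[of "set xs \<union> J"] by auto
  then show ?thesis
    unfolding regular_sequence_def set_smult_factor_module[OF J] wreg_iff[OF J]
    by (auto simp: factor_module_carrier factor_module_smult[OF J] *)
qed


section \<open>Monomial ideals\<close>

definition up_closed :: "('v \<Rightarrow>\<^sub>0 nat) set \<Rightarrow> bool" where
  "up_closed U \<longleftrightarrow> (\<forall>e\<in>U. \<forall>a. a + e \<in> U)"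

text \<open>For up-closed \<open>U\<close> these sets are exactly the monomial ideals.\<close>

definition mideal :: "('v \<Rightarrow>\<^sub>0 nat) set \<Rightarrow> ('v, 'k::comm_ring_1) mpoly set" where
  "mideal U = {f. Poly_Mapping.keys f \<subseteq> U}"

lemma lookup_monomial_mult [simp]:
  "Poly_Mapping.lookup (monomial a * f) (a + e) = Poly_Mapping.lookup f e"
proof -
  have "Poly_Mapping.lookup (monomial a * f) (a + e) =
    (\<Sum>b. (1 when a = b) * (\<Sum>c. Poly_Mapping.lookup f c when a + e = b + c))"
    unfolding monomial_def lookup_mult lookup_single by simp
  also have "\<dots> = (\<Sum>b. (\<Sum>c. Poly_Mapping.lookup f c when a + e = b + c) when a = b)"
    by (rule Sum_any.cong) (auto simp: when_def)
  also have "\<dots> = (\<Sum>c. Poly_Mapping.lookup f c when e = c)" by simp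
  finally show ?thesis by simp
qed

lemma keys_monomial [simp]: "Poly_Mapping.keys (monomial a :: ('v, 'k::comm_ring_1) mpoly) = {a}"
  by (simp add: monomial_def)

lemma keys_monomial_mult: "Poly_Mapping.keys (monomial a * f) = (+) a ` Poly_Mapping.keys f"
proof (intro equalityI subsetI)
  fix x assume x: "x \<in> Poly_Mapping.keys (monomial a * f)"
  obtain e where "x = a + e" "e \<in> Poly_Mapping.keys f"
    using subsetD[OF keys_mult x] by auto
  then show "x \<in> (+) a ` Poly_Mapping.keys f" by blast
next
  fix x assume "x \<in> (+) a ` Poly_Mapping.keys f"
  then show "x \<in> Poly_Mapping.keys (monomial a * f)"
    by (auto simp: in_keys_iff)
qed

lemma monomial_mult: "monomial a * monomial b = monomial (a + b)"
  by (simp add: monomial_def mult_single)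

lemma poly_mapping_expand: "f = (\<Sum>e\<in>Poly_Mapping.keys f. Poly_Mapping.single e (Poly_Mapping.lookup f e))"
  by (rule poly_mapping_eqI) (auto simp: lookup_sum lookup_single when_def in_keys_iff)

lemma mpoly_expand:
  "f = (\<Sum>e\<in>Poly_Mapping.keys f. Poly_Mapping.single 0 (Poly_Mapping.lookup f e) * monomial e)"
  by (subst poly_mapping_expand) (simp add: monomial_def mult_single)

lemma monomial_mem_mideal [simp]: "monomial e \<in> mideal U \<longleftrightarrow> e \<in> U"
  by (simp add: mideal_def)

lemma is_ideal_mideal: "up_closed U \<Longrightarrow> is_ideal (mideal U)"
proof -
  assume U: "up_closed U"
  have "Poly_Mapping.keys (x + y) \<subseteq> U" if "Poly_Mapping.keys x \<subseteq> U" "Poly_Mapping.keys y \<subseteq> U"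
    for x y :: "('a, 'b) mpoly"
    using that Poly_Mapping.keys_add[of x y] by blast
  moreover have "Poly_Mapping.keys (r * x) \<subseteq> U" if "Poly_Mapping.keys x \<subseteq> U" for r x :: "('a, 'b) mpoly"
  proof
    fix e assume "e \<in> Poly_Mapping.keys (r * x)"
    then obtain a b where "b \<in> Poly_Mapping.keys x" "e = a + b" using keys_mult[of r x] by blast
    then show "e \<in> U" using U that by (auto simp: up_closed_def)
  qed
  ultimately show ?thesis by (simp add: is_ideal_def mideal_def)
qed

lemma mideal_subset_ideal:
  fixes I :: "('v, 'k::comm_ring_1) mpoly set"
  assumes "is_ideal I" "\<And>e. e \<in> U \<Longrightarrow> monomial e \<in> I"
  shows "mideal U \<subseteq> I"
proof
  fix f :: "('v, 'k) mpoly" assume "f \<in> mideal U"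
  then show "f \<in> I" using assms
    by (subst mpoly_expand) (auto intro!: is_ideal_sum is_idealD(3)[OF assms(1)] simp: mideal_def)
qed

lemma mideal_mono_iff: "(mideal U :: ('v, 'k::comm_ring_1) mpoly set) \<subseteq> mideal U' \<longleftrightarrow> U \<subseteq> U'"
  using monomial_mem_mideal unfolding mideal_def by blast

lemma mideal_UNIV [simp]: "mideal UNIV = UNIV"
  by (simp add: mideal_def)

lemma up_closed_multiples: "up_closed {a + g | a g. g \<in> G}"
  by (force simp: up_closed_def add.assoc[symmetric])

lemma idl_monomials: "idl (monomial ` G) = mideal {a + g | a g. g \<in> G}"
proof (rule idl_eqI)
  show "is_ideal (mideal {a + g |a g. g \<in> G} :: ('a, 'b) mpoly set)"
    by (rule is_ideal_mideal[OF up_closed_multiples])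
  have "\<exists>a h. g = a + h \<and> h \<in> G" if "g \<in> G" for g
    using that by (intro exI[of _ 0] exI[of _ g]) simp
  then show "monomial ` G \<subseteq> mideal {a + g |a g. g \<in> G}" by auto
  show "mideal {a + g |a g. g \<in> G} \<subseteq> I'" if "is_ideal I'" "monomial ` G \<subseteq> I'"
    for I' :: "('a, 'b) mpoly set"
    using that by (intro mideal_subset_ideal) (auto simp: monomial_mult[symmetric] intro!: is_idealD(3))
qed

lemma monomial_ideal_iff: "monomial_ideal I \<longleftrightarrow> (\<exists>U. up_closed U \<and> I = mideal U)"
proof
  assume "monomial_ideal I"
  then show "\<exists>U. up_closed U \<and> I = mideal U"
    unfolding monomial_ideal_def idl_monomials using up_closed_multiples by blast
next
  assume "\<exists>U. up_closed U \<and> I = mideal U"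
  then obtain U where U: "up_closed U" "I = mideal U" by blast
  have "0 + e \<in> {a + g | a g. g \<in> U}" if "e \<in> U" for e using that by blast
  then have "{a + g | a g. g \<in> U} = U" using U(1) by (auto simp: up_closed_def)
  then show "monomial_ideal I"
    unfolding monomial_ideal_def using U(2) idl_monomials[of U] by metis
qed

definition indicator_exponent :: "'v::finite set \<Rightarrow> 'v \<Rightarrow>\<^sub>0 nat" where
  "indicator_exponent F = (\<Sum>v\<in>F. Poly_Mapping.single v 1)"

lemma lookup_indicator_exponent [simp]:
  "Poly_Mapping.lookup (indicator_exponent F) v = (if v \<in> F then 1 else 0)"
  by (simp add: indicator_exponent_def lookup_sum lookup_single when_def)

lemma keys_indicator_exponent [simp]: "Poly_Mapping.keys (indicator_exponent F) = F"
  by (auto simp: in_keys_iff split: if_splits)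

lemma sqfree_monomial_eq: "sqfree_monomial F = monomial (indicator_exponent (F :: 'v::finite set))"
proof -
  have "finite F" by simp
  then show ?thesis
    unfolding sqfree_monomial_def indicator_exponent_def var_def
    by (induction F) (auto simp: monomial_mult, simp add: monomial_def)
qed

lemma keys_add_nat: "Poly_Mapping.keys (a + b :: 'v \<Rightarrow>\<^sub>0 nat) = Poly_Mapping.keys a \<union> Poly_Mapping.keys b"
  by (auto simp: in_keys_iff lookup_add)

lemma exponent_le_obtain:
  fixes e g :: "'v \<Rightarrow>\<^sub>0 nat"
  assumes "\<And>v. Poly_Mapping.lookup g v \<le> Poly_Mapping.lookup e v"
  obtains a where "e = a + g"
proof
  show "e = (e - g) + g"
    using assms by (intro poly_mapping_eqI) (simp add: lookup_add lookup_minus)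
qed

lemma indicator_exponent_divides:
  fixes F :: "'v::finite set"
  shows "(\<exists>a. e = a + indicator_exponent F) \<longleftrightarrow> F \<subseteq> Poly_Mapping.keys e"
proof
  assume "F \<subseteq> Poly_Mapping.keys e"
  then have "Poly_Mapping.lookup (indicator_exponent F) v \<le> Poly_Mapping.lookup e v" for v
    by (auto simp: in_keys_iff Suc_le_eq)
  then show "\<exists>a. e = a + indicator_exponent F" by (rule exponent_le_obtain) blast
qed (auto simp: keys_add_nat)

text \<open>The prime ideal generated by the variables outside \<open>F\<close>.\<close>

definition face_prime :: "'v set \<Rightarrow> ('v, 'k::comm_ring_1) mpoly set" where
  "face_prime F = mideal {e. \<not> Poly_Mapping.keys e \<subseteq> F}"

text \<open>The Stanley-Reisner ideal of the complex with facets (or just faces) \<open>\<F>\<close>.\<close>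

definition facet_ideal :: "'v set set \<Rightarrow> ('v, 'k::comm_ring_1) mpoly set" where
  "facet_ideal \<F> = mideal {e. \<forall>F\<in>\<F>. \<not> Poly_Mapping.keys e \<subseteq> F}"

lemma facet_ideal_Inter: "facet_ideal \<F> = (\<Inter>F\<in>\<F>. face_prime F)"
  by (auto simp: facet_ideal_def face_prime_def mideal_def)

lemma up_closed_nonface: "up_closed {e. \<forall>F\<in>\<F>. \<not> Poly_Mapping.keys e \<subseteq> F}"
  by (auto simp: up_closed_def keys_add_nat)

lemma up_closed_nonface1: "up_closed {e. \<not> Poly_Mapping.keys e \<subseteq> F}"
  by (auto simp: up_closed_def keys_add_nat)

lemma is_ideal_facet_ideal: "is_ideal (facet_ideal \<F>)"
  unfolding facet_ideal_def by (rule is_ideal_mideal[OF up_closed_nonface])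

lemma is_ideal_face_prime: "is_ideal (face_prime F)"
  unfolding face_prime_def by (rule is_ideal_mideal[OF up_closed_nonface1])

lemma monomial_ideal_facet_ideal: "monomial_ideal (facet_ideal \<F>)"
  unfolding monomial_ideal_iff facet_ideal_def using up_closed_nonface by blast

lemma monomial_ideal_face_prime: "monomial_ideal (face_prime F)"
  unfolding monomial_ideal_iff face_prime_def using up_closed_nonface1 by blast

lemma face_prime_mono_iff:
  "(face_prime F :: ('v::finite, 'k::comm_ring_1) mpoly set) \<subseteq> face_prime G \<longleftrightarrow> G \<subseteq> F"
proof -
  have "G \<subseteq> F" if "\<And>e. \<not> Poly_Mapping.keys e \<subseteq> F \<Longrightarrow> \<not> Poly_Mapping.keys (e :: 'v \<Rightarrow>\<^sub>0 nat) \<subseteq> G"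
    using that[of "indicator_exponent G"] by auto
  then show ?thesis unfolding face_prime_def mideal_mono_iff by blast
qed

lemma max_graded_ideal_eq: "max_graded_ideal = (face_prime {} :: ('v, 'k::comm_ring_1) mpoly set)"
proof -
  have "range var = (monomial ` range (\<lambda>v. Poly_Mapping.single v 1) :: ('v, 'k) mpoly set)"
    by (auto simp: var_def)
  moreover have "{a + g | a g. g \<in> range (\<lambda>v. Poly_Mapping.single v 1)} =
      {e :: 'v \<Rightarrow>\<^sub>0 nat. \<not> Poly_Mapping.keys e \<subseteq> {}}"
  proof (intro equalityI subsetI)
    fix e :: "'v \<Rightarrow>\<^sub>0 nat" assume "e \<in> {e. \<not> Poly_Mapping.keys e \<subseteq> {}}"
    then obtain v where "v \<in> Poly_Mapping.keys e" by blast
    then have "Poly_Mapping.lookup e v \<ge> 1" by (simp add: in_keys_iff Suc_le_eq)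
    then have "Poly_Mapping.lookup (Poly_Mapping.single v 1) w \<le> Poly_Mapping.lookup e w" for w
      by (auto simp: lookup_single when_def)
    then obtain a where "e = a + Poly_Mapping.single v 1" by (rule exponent_le_obtain)
    then show "e \<in> {a + g | a g. g \<in> range (\<lambda>v. Poly_Mapping.single v 1)}" by blast
  next
    fix e :: "'v \<Rightarrow>\<^sub>0 nat" assume "e \<in> {a + g | a g. g \<in> range (\<lambda>v. Poly_Mapping.single v 1)}"
    then obtain a v where "e = a + Poly_Mapping.single v 1" by blast
    then have "v \<in> Poly_Mapping.keys e" by (simp add: keys_add_nat)
    then show "e \<in> {e. \<not> Poly_Mapping.keys e \<subseteq> {}}" by blast
  qed
  ultimately show ?thesis
    unfolding max_graded_ideal_def face_prime_def by (simp only: idl_monomials)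
qed

lemma max_graded_ideal_obtain:
  fixes f :: "('v::finite, 'k::comm_ring_1) mpoly"
  assumes "f \<in> max_graded_ideal"
  obtains u where "f = (\<Sum>v\<in>UNIV. u v * var v)"
proof -
  have "max_graded_ideal \<subseteq> {f :: ('v, 'k) mpoly. \<exists>u. f = (\<Sum>v\<in>UNIV. u v * var v)}"
    unfolding max_graded_ideal_def
  proof (rule idl_minimal)
    show "is_ideal {f :: ('v, 'k) mpoly. \<exists>u. f = (\<Sum>v\<in>UNIV. u v * var v)}"
      unfolding is_ideal_def
    proof (safe)
      show "\<exists>u. (0::('v, 'k) mpoly) = (\<Sum>v\<in>UNIV. u v * var v)" by (rule exI[of _ "\<lambda>_. 0"]) simp
      show "\<exists>w. (\<Sum>i\<in>UNIV. u i * var i) + (\<Sum>i\<in>UNIV. u' i * var i) = (\<Sum>i\<in>UNIV. w i * var i)"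
        for u u' :: "'v \<Rightarrow> ('v, 'k) mpoly"
        by (rule exI[of _ "\<lambda>i. u i + u' i"]) (simp add: sum.distrib algebra_simps)
      show "\<exists>w. r * (\<Sum>i\<in>UNIV. u i * var i) = (\<Sum>i\<in>UNIV. w i * var i)"
        for r and u :: "'v \<Rightarrow> ('v, 'k) mpoly"
        by (rule exI[of _ "\<lambda>i. r * u i"]) (simp add: sum_distrib_left algebra_simps)
    qed
    have "var v = (\<Sum>i\<in>UNIV. (if i = v then 1 else 0) * var i :: ('v, 'k) mpoly)" for v
      by (simp add: if_distrib[of "\<lambda>x. x * _"] cong: if_cong)
    then have "\<exists>u. (var v :: ('v, 'k) mpoly) = (\<Sum>i\<in>UNIV. u i * var i)" for v
      by (intro exI[of _ "\<lambda>i. if i = v then 1 else 0"])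
    then show "range var \<subseteq> {f::('v, 'k) mpoly. \<exists>u. f = (\<Sum>v\<in>UNIV. u v * var v)}" by auto
  qed
  then show ?thesis using that assms by blast
qed

text \<open>An embedding of the exponents into the linearly ordered monoid of exponents over \<open>nat\<close>;
  the leading terms for the induced order show that a product does not lie in a face prime.\<close>

definition nat_exponent :: "('v::finite \<Rightarrow>\<^sub>0 nat) \<Rightarrow> nat \<Rightarrow>\<^sub>0 nat" where
  "nat_exponent e = (\<Sum>v\<in>UNIV. Poly_Mapping.single (to_nat_on UNIV v) (Poly_Mapping.lookup e v))"

lemma nat_exponent_add: "nat_exponent (a + b) = nat_exponent a + nat_exponent b"
  by (simp add: nat_exponent_def lookup_add single_add sum.distrib)

lemma inj_nat_exponent: "inj nat_exponent"
proof (rule injI)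
  fix a b :: "'v::finite \<Rightarrow>\<^sub>0 nat"
  have l: "Poly_Mapping.lookup (nat_exponent e) (to_nat_on UNIV v) = Poly_Mapping.lookup e v"
    for e and v :: 'v
  proof -
    have "to_nat_on UNIV w = to_nat_on UNIV v \<longleftrightarrow> w = v" for w :: 'v
      using inj_on_to_nat_on[of "UNIV :: 'v set"] by (auto dest: injD simp: countable_finite)
    then show ?thesis by (simp add: nat_exponent_def lookup_sum lookup_single when_def)
  qed
  assume "nat_exponent a = nat_exponent b"
  then show "a = b" by (metis l poly_mapping_eqI)
qed

lemma is_prime_face_prime: "is_prime (face_prime F :: ('v::finite, 'k::idom) mpoly set)"
  unfolding is_prime_def
proof (intro conjI allI impI is_ideal_face_prime)
  show "1 \<notin> (face_prime F :: ('v, 'k) mpoly set)" by (simp add: face_prime_def mideal_def)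
next
  fix x y :: "('v, 'k) mpoly" assume xy: "x * y \<in> face_prime F"
  show "x \<in> face_prime F \<or> y \<in> face_prime F"
  proof (rule ccontr)
    assume n: "\<not> (x \<in> face_prime F \<or> y \<in> face_prime F)"
    \<comment> \<open>The exponents of the terms of \<open>f\<close> that survive modulo
      \<open>face_prime F\<close>.\<close>
    define K where "K f = {e \<in> Poly_Mapping.keys f. Poly_Mapping.keys e \<subseteq> F}" for f :: "('v, 'k) mpoly"
    have fin: "finite (K f)" for f by (simp add: K_def)
    have ne: "K x \<noteq> {}" "K y \<noteq> {}" using n by (auto simp: K_def face_prime_def mideal_def)
    have max: "\<exists>a\<in>K f. \<forall>b\<in>K f. nat_exponent b \<le> nat_exponent a" if "K f \<noteq> {}" for f
    proof -
      have "Max (nat_exponent ` K f) \<in> nat_exponent ` K f" using fin that by (intro Max_in) auto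
      then obtain a where a: "a \<in> K f" "Max (nat_exponent ` K f) = nat_exponent a" by auto
      have "nat_exponent b \<le> nat_exponent a" if "b \<in> K f" for b
        using Max_ge[OF finite_imageI[OF fin[of f], of nat_exponent] imageI[OF that]] unfolding a(2) .
      then show ?thesis using a(1) by blast
    qed
    obtain a where a: "a \<in> K x" "\<And>c. c \<in> K x \<Longrightarrow> nat_exponent c \<le> nat_exponent a"
      using max[OF ne(1)] by blast
    obtain b where b: "b \<in> K y" "\<And>c. c \<in> K y \<Longrightarrow> nat_exponent c \<le> nat_exponent b"
      using max[OF ne(2)] by blast
    \<comment> \<open>The two leading exponents are the only pair with sum \<open>a + b\<close>: any
      such pair is supported in \<open>F\<close>, hence bounded by the maxima, and the order is
      compatible with addition.\<close>
    have eq: "c = a \<and> d = b" if "c + d = a + b" "c \<in> Poly_Mapping.keys x" "d \<in> Poly_Mapping.keys y" for c d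
    proof -
      have "Poly_Mapping.keys (c + d) \<subseteq> F"
        unfolding that(1) using a(1) b(1) by (auto simp: K_def keys_add_nat)
      then have "c \<in> K x" "d \<in> K y" using that(2,3) by (auto simp: K_def keys_add_nat)
      then have le: "nat_exponent c \<le> nat_exponent a" "nat_exponent d \<le> nat_exponent b" using a b by auto
      moreover have s: "nat_exponent c + nat_exponent d = nat_exponent a + nat_exponent b"
        using that(1) by (metis nat_exponent_add)
      ultimately have "nat_exponent c = nat_exponent a"
        by (metis add_less_le_mono order.strict_iff_order order_less_irrefl)
      then have "nat_exponent c = nat_exponent a" "nat_exponent d = nat_exponent b" using s by auto
      then show ?thesis using inj_nat_exponent by (auto dest: injD)
    qed
    have "Poly_Mapping.lookup (x * y) (a + b) =
      (\<Sum>c\<in>Poly_Mapping.keys x. \<Sum>d\<in>Poly_Mapping.keys y.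
        Poly_Mapping.lookup (Poly_Mapping.single (c + d) (Poly_Mapping.lookup x c * Poly_Mapping.lookup y d)) (a + b))"
      by (subst poly_mapping_expand[of x], subst poly_mapping_expand[of y])
        (simp add: sum_product mult_single lookup_sum)
    also have "\<dots> = (\<Sum>c\<in>Poly_Mapping.keys x. \<Sum>d\<in>Poly_Mapping.keys y.
        if c = a then if d = b then Poly_Mapping.lookup x a * Poly_Mapping.lookup y b else 0 else 0)"
      using eq by (intro sum.cong refl) (auto simp: lookup_single when_def)
    also have "\<dots> = (\<Sum>c\<in>Poly_Mapping.keys x. if c = a then Poly_Mapping.lookup x a * Poly_Mapping.lookup y b else 0)"
      using b(1) by (intro sum.cong refl) (auto simp: K_def)
    also have "\<dots> = Poly_Mapping.lookup x a * Poly_Mapping.lookup y b"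
      using a(1) by (simp add: K_def)
    also have "\<dots> \<noteq> 0" using a(1) b(1) by (auto simp: K_def in_keys_iff)
    finally have "a + b \<in> Poly_Mapping.keys (x * y)" by (simp add: in_keys_iff)
    then have "\<not> Poly_Mapping.keys (a + b) \<subseteq> F" using xy by (auto simp: face_prime_def mideal_def)
    then show False using a(1) b(1) by (auto simp: K_def keys_add_nat)
  qed
qed


section \<open>Bounds for dimension and depth\<close>

text \<open>Gaussian elimination, one equation at a time: a pivot \<open>p\<close> eliminates one
  unknown, and an equation without pivot holds for free.\<close>

lemma homogeneous_system:
  fixes v :: "'a \<Rightarrow> 'e \<Rightarrow> 'k::field"
  assumes "finite E" "finite A" "card E < card A"
  shows "\<exists>c. (\<exists>a\<in>A. c a \<noteq> 0) \<and> (\<forall>e\<in>E. (\<Sum>a\<in>A. c a * v a e) = 0)"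
  using assms
proof (induction E arbitrary: A v rule: finite_induct)
  case empty
  then obtain a where "a \<in> A" by fastforce
  then show ?case by (intro exI[of _ "\<lambda>_. 1"]) auto
next
  case (insert e E)
  show ?case
  proof (cases "\<exists>p\<in>A. v p e \<noteq> 0")
    case False
    then show ?thesis using insert.IH[of A v] insert.prems insert.hyps by auto
  next
    case True
    then obtain p where p: "p \<in> A" "v p e \<noteq> 0" by blast
    define w where "w a x = v a x - v a e / v p e * v p x" for a x
    have "card E < card (A - {p})" using insert.prems insert.hyps p by simp
    then obtain c where c: "\<exists>a\<in>A - {p}. c a \<noteq> 0" "\<And>x. x \<in> E \<Longrightarrow> (\<Sum>a\<in>A - {p}. c a * w a x) = 0"
      using insert.IH[of "A - {p}" w] insert.prems by auto
    define s where "s = (\<Sum>a\<in>A - {p}. c a * v a e)"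
    define d where "d a = (if a = p then - (s / v p e) else c a)" for a
    have sum: "(\<Sum>a\<in>A. d a * v a x) = (\<Sum>a\<in>A - {p}. c a * v a x) - s / v p e * v p x" for x
      using insert.prems(1) p(1) by (subst sum.remove[of _ p]) (auto simp: d_def intro!: sum.cong)
    have "(\<Sum>a\<in>A. d a * v a x) = 0" if "x \<in> E" for x
    proof -
      have "(\<Sum>a\<in>A - {p}. c a * w a x) = (\<Sum>a\<in>A - {p}. c a * v a x) - s / v p e * v p x"
        by (simp add: w_def s_def sum_subtractf right_diff_distrib sum_distrib_right sum_divide_distrib mult.assoc)
      then show ?thesis using c(2)[OF that] sum by simp
    qed
    moreover have "(\<Sum>a\<in>A. d a * v a e) = 0" using sum[of e] p(2) by (simp add: s_def)
    moreover have "\<exists>a\<in>A. d a \<noteq> 0" using c(1) by (auto simp: d_def)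
    ultimately show ?thesis by (intro exI[of _ d]) auto
  qed
qed

text \<open>The Coquand-Lombardi identities: an algebraic dependence of \<open>ys\<close>, arranged according to
  its lexicographically smallest term, has this shape.\<close>

fun nested :: "('v, 'k::comm_ring_1) mpoly list \<Rightarrow> ('v, 'k) mpoly set" where
  "nested [] = {Poly_Mapping.single 0 c | c. c \<noteq> 0}"
| "nested (y # ys) = {y ^ k * (b + a * y) | k a b. b \<in> nested ys}"

fun power_product :: "'a::comm_monoid_mult list \<Rightarrow> nat list \<Rightarrow> 'a" where
  "power_product (y # ys) (i # \<alpha>) = y ^ i * power_product ys \<alpha>"
| "power_product _ _ = 1"

definition bounded_lists :: "nat \<Rightarrow> nat \<Rightarrow> nat list set" where
  "bounded_lists N n = {\<alpha>. set \<alpha> \<subseteq> {..<N} \<and> length \<alpha> = n}"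

lemma finite_bounded_lists: "finite (bounded_lists N n)"
  by (simp add: bounded_lists_def finite_lists_length_eq)

lemma sum_bounded_lists_Suc:
  "(\<Sum>\<alpha>\<in>bounded_lists N (Suc n). f \<alpha>) = (\<Sum>i<N. \<Sum>\<alpha>\<in>bounded_lists N n. f (i # \<alpha>))"
proof -
  have "(\<Sum>i<N. \<Sum>\<alpha>\<in>bounded_lists N n. f (i # \<alpha>)) =
      (\<Sum>(i, \<alpha>)\<in>{..<N} \<times> bounded_lists N n. f (i # \<alpha>))"
    by (simp add: sum.cartesian_product)
  also have "\<dots> = (\<Sum>\<alpha>\<in>bounded_lists N (Suc n). f \<alpha>)"
    by (rule sum.reindex_bij_witness[of _ "\<lambda>\<alpha>. (hd \<alpha>, tl \<alpha>)" "\<lambda>(i, \<alpha>). i # \<alpha>"])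
      (auto simp: bounded_lists_def length_Suc_conv)
  finally show ?thesis by simp
qed

text \<open>Factor out the least power \<open>y ^ k\<close> with a nonzero inner coefficient. What
  remains is the inner sum \<open>S k\<close>, covered by induction, plus a multiple of
  \<open>y\<close>.\<close>

lemma dependence_mem_nested:
  fixes ys :: "('v, 'k::field) mpoly list"
  assumes "\<alpha> \<in> bounded_lists N (length ys)" "c \<alpha> \<noteq> 0"
  shows "(\<Sum>\<alpha>\<in>bounded_lists N (length ys). Poly_Mapping.single 0 (c \<alpha>) * power_product ys \<alpha>) \<in> nested ys"
  using assms
proof (induction ys arbitrary: c \<alpha>)
  case Nil
  have "bounded_lists N 0 = {[]}" by (auto simp: bounded_lists_def)
  then show ?case using Nil by auto
next
  case (Cons y ys)
  define S where "S i = (\<Sum>\<alpha>\<in>bounded_lists N (length ys).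
    Poly_Mapping.single 0 (c (i # \<alpha>)) * power_product ys \<alpha>)" for i
  define Q where "Q i \<longleftrightarrow> i < N \<and> (\<exists>\<alpha>\<in>bounded_lists N (length ys). c (i # \<alpha>) \<noteq> 0)" for i
  have "\<exists>i. Q i"
    using Cons.prems by (cases \<alpha>) (auto simp: bounded_lists_def Q_def)
  then have Qk: "Q (LEAST i. Q i)" by (rule LeastI_ex)
  define k where "k = (LEAST i. Q i)"
  obtain \<beta> where k: "k < N" and \<beta>: "\<beta> \<in> bounded_lists N (length ys)" "c (k # \<beta>) \<noteq> 0"
    using Qk unfolding k_def[symmetric] unfolding Q_def by blast
  have Sk: "S k \<in> nested ys" unfolding S_def using Cons.IH[of \<beta> "\<lambda>\<alpha>. c (k # \<alpha>)"] \<beta> by blast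
  have S0: "S i = 0" if "i < k" for i
  proof -
    have "\<not> Q i" using not_less_Least[of i Q] that by (simp add: k_def)
    then show ?thesis using that k by (simp add: S_def Q_def)
  qed
  have "(\<Sum>\<alpha>\<in>bounded_lists N (length (y # ys)). Poly_Mapping.single 0 (c \<alpha>) * power_product (y # ys) \<alpha>)
      = (\<Sum>i<N. y ^ i * S i)"
    by (simp add: sum_bounded_lists_Suc S_def sum_distrib_left algebra_simps)
  also have "\<dots> = (\<Sum>i\<in>{k..<N}. y ^ i * S i)"
    by (rule sum.mono_neutral_right) (auto simp: S0 not_le)
  also have "\<dots> = y ^ k * S k + (\<Sum>i\<in>{Suc k..<N}. y ^ i * S i)"
    using k by (simp add: sum.atLeast_Suc_lessThan)
  also have "(\<Sum>i\<in>{Suc k..<N}. y ^ i * S i) = (\<Sum>i\<in>{Suc k..<N}. y ^ k * (y ^ (i - Suc k) * S i) * y)"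
  proof (rule sum.cong)
    fix i assume "i \<in> {Suc k..<N}"
    then have "y ^ i = y ^ k * y ^ (i - Suc k) * y"
      by (metis atLeastLessThan_iff le_add_diff_inverse mult.assoc power_Suc2 power_add add_Suc add_Suc_right)
    then show "y ^ i * S i = y ^ k * (y ^ (i - Suc k) * S i) * y" by (simp add: algebra_simps)
  qed simp
  also have "y ^ k * S k + \<dots> = y ^ k * (S k + (\<Sum>i\<in>{Suc k..<N}. y ^ (i - Suc k) * S i) * y)"
    by (simp add: algebra_simps sum_distrib_left sum_distrib_right)
  finally show ?case using Sk by auto
qed

lemma total_degree_eq: "total_degree (e :: 'v::finite \<Rightarrow>\<^sub>0 nat) = (\<Sum>v\<in>UNIV. Poly_Mapping.lookup e v)"
  unfolding total_degree_def by (rule sum.mono_neutral_left) (auto simp: in_keys_iff)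

lemma total_degree_add: "total_degree (a + b :: 'v::finite \<Rightarrow>\<^sub>0 nat) = total_degree a + total_degree b"
  by (simp add: total_degree_eq lookup_add sum.distrib)

lemma lookup_single_0_mult:
  "Poly_Mapping.lookup (Poly_Mapping.single 0 c * f) e = c * Poly_Mapping.lookup (f :: ('v, 'k::comm_ring_1) mpoly) e"
  by (simp add: Poly_Mapping.map.rep_eq when_def flip: mult_map_scale_conv_mult)

lemma degree_power:
  fixes y :: "('v::finite, 'k::comm_ring_1) mpoly"
  assumes "\<And>e. e \<in> Poly_Mapping.keys y \<Longrightarrow> total_degree e \<le> D" "e \<in> Poly_Mapping.keys (y ^ i)"
  shows "total_degree e \<le> i * D"
  using assms(2)
proof (induction i arbitrary: e)
  case 0
  then show ?case by (simp add: total_degree_def)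
next
  case (Suc i)
  then obtain a b where "a \<in> Poly_Mapping.keys y" "b \<in> Poly_Mapping.keys (y ^ i)" "e = a + b"
    using keys_mult[of y "y ^ i"] by auto
  then show ?case using assms(1)[of a] Suc.IH[of b] by (simp add: total_degree_add)
qed

lemma degree_power_product:
  fixes ys :: "('v::finite, 'k::comm_ring_1) mpoly list"
  assumes "\<And>y e. y \<in> set ys \<Longrightarrow> e \<in> Poly_Mapping.keys y \<Longrightarrow> total_degree e \<le> D"
    and "\<alpha> \<in> bounded_lists N (length ys)" "e \<in> Poly_Mapping.keys (power_product ys \<alpha>)"
  shows "total_degree e \<le> length ys * (N * D)"
  using assms
proof (induction ys arbitrary: \<alpha> e)
  case Nil
  then show ?case by (simp add: total_degree_def)
next
  case (Cons y ys)
  obtain i \<beta> where \<alpha>: "\<alpha> = i # \<beta>" "i < N" "\<beta> \<in> bounded_lists N (length ys)"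
    using Cons.prems(2) by (auto simp: bounded_lists_def length_Suc_conv)
  obtain a b where ab: "a \<in> Poly_Mapping.keys (y ^ i)" "b \<in> Poly_Mapping.keys (power_product ys \<beta>)" "e = a + b"
    using keys_mult[of "y ^ i" "power_product ys \<beta>"] Cons.prems(3) \<alpha> by auto
  have "total_degree a \<le> i * D" using degree_power[of y D a i] Cons.prems(1) ab(1) by auto
  also have "\<dots> \<le> N * D" using \<alpha>(2) by simp
  finally have "total_degree a \<le> N * D" .
  moreover have "total_degree b \<le> length ys * (N * D)"
    using Cons.prems(1) by (intro Cons.IH[OF _ \<alpha>(3) ab(2)]) auto
  ultimately show ?case using ab(3) by (simp add: total_degree_add)
qed

text \<open>A box bound suffices: each of the \<open>card F\<close> exponents lies between 0 and
  \<open>T\<close>.\<close>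

lemma card_bounded_exponents:
  fixes F :: "'v::finite set"
  shows "finite {e. Poly_Mapping.keys e \<subseteq> F \<and> total_degree e \<le> T}"
    "card {e. Poly_Mapping.keys e \<subseteq> F \<and> total_degree e \<le> T} \<le> Suc T ^ card F"
proof -
  let ?E = "{e. Poly_Mapping.keys e \<subseteq> F \<and> total_degree e \<le> T}"
  let ?r = "\<lambda>e. restrict (Poly_Mapping.lookup e) F"
  have inj: "inj_on ?r ?E"
  proof (rule inj_onI, rule poly_mapping_eqI)
    fix a b v assume ab: "a \<in> ?E" "b \<in> ?E" "?r a = ?r b"
    show "Poly_Mapping.lookup a v = Poly_Mapping.lookup b v"
    proof (cases "v \<in> F")
      case True
      then show ?thesis using fun_cong[OF ab(3), of v] by simp
    next
      case False
      then have "v \<notin> Poly_Mapping.keys a" "v \<notin> Poly_Mapping.keys b" using ab by auto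
      then show ?thesis by (simp add: in_keys_iff)
    qed
  qed
  have sub: "?r ` ?E \<subseteq> F \<rightarrow>\<^sub>E {..T}"
  proof -
    have "Poly_Mapping.lookup e v \<le> total_degree e" for e :: "'v \<Rightarrow>\<^sub>0 nat" and v
      unfolding total_degree_eq by (rule member_le_sum) auto
    then show ?thesis by (fastforce intro: order_trans)
  qed
  have PE: "finite (F \<rightarrow>\<^sub>E {..T})" "card (F \<rightarrow>\<^sub>E {..T}) = Suc T ^ card F"
    by (simp_all add: finite_PiE card_PiE)
  show "finite ?E" by (rule inj_on_finite[OF inj sub PE(1)])
  show "card ?E \<le> Suc T ^ card F" using card_inj_on_le[OF inj sub PE(1)] unfolding PE(2) .
qed

text \<open>A count of unknowns and equations. The \<open>N ^ n\<close> products with exponents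
  below \<open>N\<close> involve, outside the ideal, only monomials supported on a member of
  \<open>\<F>\<close> and of degree at most \<open>T\<close>. There are at most a constant times
  \<open>N ^ m\<close> of these, and n > m, so for large \<open>N\<close> a nontrivial combination
  avoids them all.\<close>

lemma nested_meets_facet_ideal:
  fixes ys :: "('v::finite, 'k::field) mpoly list"
  assumes m: "\<And>F. F \<in> \<F> \<Longrightarrow> card F \<le> m" and len: "m < length ys"
  shows "nested ys \<inter> facet_ideal \<F> \<noteq> {}"
proof -
  define n where "n = length ys"
  \<comment> \<open>The inserted 0 keeps \<open>Max\<close> meaningful when all polynomials are
    zero.\<close>
  define D where "D = Max (insert 0 (total_degree ` (\<Union>y\<in>set ys. Poly_Mapping.keys y)))"
  have D: "total_degree e \<le> D" if "y \<in> set ys" "e \<in> Poly_Mapping.keys y" for y e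
    unfolding D_def using that by (intro Max_ge) auto
  define q where "q = card \<F>"
  \<comment> \<open>One more than the constant \<open>q * Suc (n * D) ^ m\<close>, which times
    \<open>N ^ m\<close> bounds \<open>card E\<close>.\<close>
  define N where "N = Suc (q * Suc (n * D) ^ m)"
  define T where "T = n * (N * D)"
  define E where "E = (\<Union>F\<in>\<F>. {e. Poly_Mapping.keys e \<subseteq> F \<and> total_degree e \<le> T})"
  have finE: "finite E" unfolding E_def by (intro finite_UN_I finite card_bounded_exponents(1))
  have "card E \<le> (\<Sum>F\<in>\<F>. card {e. Poly_Mapping.keys e \<subseteq> F \<and> total_degree e \<le> T})"
    unfolding E_def by (rule card_UN_le) simp
  also have "\<dots> \<le> (\<Sum>F\<in>\<F>. Suc T ^ m)"
  proof (rule sum_mono)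
    fix F assume "F \<in> \<F>"
    then have "Suc T ^ card F \<le> Suc T ^ m" using m by (intro power_increasing) auto
    then show "card {e. Poly_Mapping.keys e \<subseteq> F \<and> total_degree e \<le> T} \<le> Suc T ^ m"
      using card_bounded_exponents(2)[of F T] by linarith
  qed
  also have "\<dots> = q * Suc T ^ m" by (simp add: q_def)
  also have "\<dots> \<le> q * (Suc (n * D) * N) ^ m"
  proof (intro mult_left_mono power_mono)
    have "Suc T \<le> N + n * (N * D)" by (simp add: T_def N_def)
    then show "Suc T \<le> Suc (n * D) * N" by (simp add: algebra_simps)
  qed simp_all
  also have "\<dots> = (q * Suc (n * D) ^ m) * N ^ m"
    by (simp only: power_mult_distrib mult.assoc)
  also have "\<dots> < N * N ^ m" by (intro mult_strict_right_mono) (auto simp: N_def)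
  also have "\<dots> \<le> N ^ n"
    using len power_increasing[of "Suc m" n N] by (simp add: n_def N_def)
  also have "\<dots> = card (bounded_lists N n)" by (simp add: bounded_lists_def card_lists_length_eq)
  finally obtain c where c: "\<exists>\<alpha>\<in>bounded_lists N n. c \<alpha> \<noteq> 0"
    "\<And>e. e \<in> E \<Longrightarrow> (\<Sum>\<alpha>\<in>bounded_lists N n. c \<alpha> * Poly_Mapping.lookup (power_product ys \<alpha>) e) = 0"
    using homogeneous_system[OF finE finite_bounded_lists, of N n "\<lambda>\<alpha>. Poly_Mapping.lookup (power_product ys \<alpha>)"]
    by blast
  define f where "f = (\<Sum>\<alpha>\<in>bounded_lists N n. Poly_Mapping.single 0 (c \<alpha>) * power_product ys \<alpha>)"
  have lf: "Poly_Mapping.lookup f e =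
      (\<Sum>\<alpha>\<in>bounded_lists N n. c \<alpha> * Poly_Mapping.lookup (power_product ys \<alpha>) e)" for e
    by (simp add: f_def lookup_sum lookup_single_0_mult)
  have "f \<in> nested ys" unfolding f_def n_def using c(1) dependence_mem_nested n_def by blast
  moreover have "f \<in> facet_ideal \<F>"
    unfolding facet_ideal_def mideal_def
  proof safe
    fix e F assume e: "e \<in> Poly_Mapping.keys f" and F: "F \<in> \<F>" "Poly_Mapping.keys e \<subseteq> F"
    have "Poly_Mapping.lookup f e \<noteq> 0" using e by (simp add: in_keys_iff)
    then obtain \<alpha> where "\<alpha> \<in> bounded_lists N n" "Poly_Mapping.lookup (power_product ys \<alpha>) e \<noteq> 0"
      unfolding lf by (metis (no_types, lifting) mult_zero_right sum.neutral)
    then have "total_degree e \<le> T"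
      using degree_power_product[of ys D \<alpha> N e] D by (simp add: in_keys_iff T_def n_def)
    then have "e \<in> E" using F by (auto simp: E_def)
    then show False using c(2) \<open>Poly_Mapping.lookup f e \<noteq> 0\<close> lf by simp
  qed
  ultimately show ?thesis by blast
qed

text \<open>If y^k (b + a y) lies in \<open>P i\<close> for y = \<open>y i\<close>, then the power
  can be stripped, as \<open>y i\<close> is not in \<open>P i\<close>, and \<open>b\<close> lies in
  \<open>P (Suc i)\<close>, as \<open>y i\<close> does. The descent ends with a nonzero constant in
  \<open>P r\<close>.\<close>

lemma nested_prime_chain:
  fixes P :: "nat \<Rightarrow> ('v, 'k::field) mpoly set"
  assumes P: "\<And>i. i \<le> r \<Longrightarrow> is_prime (P i)" and sub: "\<And>i. i < r \<Longrightarrow> P i \<subseteq> P (Suc i)"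
    and y: "\<And>i. i < r \<Longrightarrow> y i \<in> P (Suc i)" "\<And>i. i < r \<Longrightarrow> y i \<notin> P i" and i: "i \<le> r"
  shows "nested (map y [i..<r]) \<inter> P i = {}"
  using i
proof (induction rule: inc_induct)
  case base
  have "1 \<in> P r" if "Poly_Mapping.single 0 c \<in> P r" "c \<noteq> 0" for c
    using is_idealD(3)[of "P r" "Poly_Mapping.single 0 c" "Poly_Mapping.single 0 (inverse c)"] P[of r] that
    by (auto simp: is_prime_def mult_single)
  then show ?case using P[of r] by (auto simp: is_prime_def)
next
  case (step i)
  have pw: "y i ^ k \<notin> P i" for k
    using P[of i] y(2)[of i] step.hyps by (induction k) (auto simp: is_prime_def)
  have "b \<in> P (Suc i)" if "y i ^ k * (b + a * y i) \<in> P i" for a b k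
  proof -
    have "b + a * y i \<in> P (Suc i)"
      using that pw P[of i] step.hyps sub[of i] by (auto simp: is_prime_def)
    moreover have I: "is_ideal (P (Suc i))" using P[of "Suc i"] step.hyps by (simp add: is_prime_def)
    moreover have "a * y i \<in> P (Suc i)" using is_idealD(3)[OF I] y(1)[of i] step.hyps by simp
    ultimately have "(b + a * y i) - a * y i \<in> P (Suc i)" by (blast intro: is_idealD(6))
    then show ?thesis by simp
  qed
  then show ?case using step.IH step.hyps by (auto simp: upt_conv_Cons)
qed

text \<open>The descent of \<open>nested_prime_chain\<close> with \<open>combine y UNIV B\<close> as
  the next ideal: powers of \<open>y\<close> are stripped because \<open>y\<close> is regular modulo
  \<open>B\<close>.\<close>

lemma nested_wreg:
  fixes ys :: "('v, 'k::field) mpoly list"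
  assumes "is_ideal B" "wreg ys UNIV B" "1 \<notin> idl (set ys \<union> B)"
  shows "nested ys \<inter> B = {}"
  using assms
proof (induction ys arbitrary: B)
  case Nil
  have "1 \<in> B" if "Poly_Mapping.single 0 c \<in> B" "c \<noteq> 0" for c
    using is_idealD(3)[of B "Poly_Mapping.single 0 c" "Poly_Mapping.single 0 (inverse c)"] Nil.prems that
    by (auto simp: mult_single)
  then show ?case using Nil.prems by (auto simp: idl_self)
next
  case (Cons y ys)
  have I: "is_ideal (combine y UNIV B)"
    by (rule is_ideal_combine[OF _ Cons.prems(1)]) (simp add: is_ideal_def)
  have IH: "nested ys \<inter> combine y UNIV B = {}"
    using Cons.prems(2,3) by (intro Cons.IH I) (simp_all add: idl_insert Cons.prems(1))
  have pw: "y ^ k * z \<in> B \<Longrightarrow> z \<in> B" for k z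
    by (induction k) (use Cons.prems(2) in \<open>simp_all add: mult.assoc\<close>)
  have "b \<in> combine y UNIV B" if "y ^ k * (b + a * y) \<in> B" for a b k
  proof -
    have "b = y * (- a) + (b + a * y)" by (simp add: algebra_simps)
    then show ?thesis using pw[OF that] unfolding combine_def by blast
  qed
  then show ?case using IH by auto
qed

lemma prime_chain_length_le:
  fixes P :: "nat \<Rightarrow> ('v::finite, 'k::field) mpoly set"
  assumes "\<And>F. F \<in> \<F> \<Longrightarrow> card F \<le> m" "facet_ideal \<F> \<subseteq> P 0"
    and P: "\<And>i. i \<le> r \<Longrightarrow> is_prime (P i)" "\<And>i. i < r \<Longrightarrow> P i \<subset> P (Suc i)"
  shows "r \<le> m"
proof (rule ccontr)
  assume "\<not> r \<le> m"
  define y where "y i = (SOME z. z \<in> P (Suc i) - P i)" for i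
  have y: "y i \<in> P (Suc i) - P i" if "i < r" for i
    unfolding y_def by (rule someI_ex[OF psubset_imp_ex_mem[OF P(2)[OF that]]])
  have "nested (map y [0..<r]) \<inter> facet_ideal \<F> \<noteq> {}"
    by (rule nested_meets_facet_ideal[OF assms(1)]) (use \<open>\<not> r \<le> m\<close> in simp_all)
  moreover have "nested (map y [0..<r]) \<inter> P 0 = {}"
    using y P by (intro nested_prime_chain) (auto simp: psubset_eq)
  ultimately show False using assms(2) by blast
qed

lemma regular_sequence_length_le:
  fixes xs :: "('v::finite, 'k::field) mpoly list"
  assumes "\<And>F. F \<in> \<F> \<Longrightarrow> card F \<le> m"
    and "regular_sequence poly_ring (factor_module UNIV (facet_ideal \<F>)) xs"
  shows "length xs \<le> m"
proof (rule ccontr)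
  assume "\<not> length xs \<le> m"
  then have "nested xs \<inter> facet_ideal \<F> \<noteq> {}"
    by (intro nested_meets_facet_ideal[OF assms(1)]) simp_all
  then show False
    using nested_wreg[OF is_ideal_facet_ideal] assms(2)
    unfolding regular_sequence_iff[OF is_ideal_facet_ideal] by blast
qed


section \<open>Regular sequences on extensions; vanishing of Koszul cohomology\<close>

lemma is_ideal_UNIV [simp]: "is_ideal UNIV"
  by (simp add: is_ideal_def)

text \<open>Modular law: since f A lies in A, the intersection of A with f A + B is f A + (A
  \<inter> B), which sees B only through A \<inter> B.\<close>

lemma combine_cong:
  assumes "is_ideal A" "A \<inter> B = A \<inter> B'"
  shows "A \<inter> combine f A B = A \<inter> combine f A B'"
proof -
  have "A \<inter> combine f A B \<subseteq> combine f A B'" if "A \<inter> B = A \<inter> B'" for B B'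
  proof
    fix y assume y: "y \<in> A \<inter> combine f A B"
    then obtain a b where ab: "a \<in> A" "b \<in> B" "y = f * a + b" by (auto simp: combine_def)
    have "y - f * a \<in> A" using y ab assms(1) by (blast intro: is_idealD(3,6))
    then have "b \<in> B'" using ab that by auto
    then show "y \<in> combine f A B'" using ab by (auto simp: combine_def)
  qed
  from this[OF assms(2)] this[OF assms(2)[symmetric]] show ?thesis by blast
qed

lemma wreg_cong:
  assumes "is_ideal A" "A \<inter> B = A \<inter> B'"
  shows "wreg fs A B \<longleftrightarrow> wreg fs A B'"
  using assms(2)
proof (induction fs arbitrary: B B')
  case (Cons f fs)
  have "(\<forall>y\<in>A. f * y \<in> B \<longrightarrow> y \<in> B) \<longleftrightarrow> (\<forall>y\<in>A. f * y \<in> B' \<longrightarrow> y \<in> B')"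
    using Cons.prems is_idealD(3)[OF assms(1)] by blast
  then show ?case using Cons.IH[OF combine_cong[OF assms(1) Cons.prems]] by simp
qed simp

text \<open>Passes from the ends to the middle of 0 -> A / (A \<inter> B) -> C / (C \<inter> B) -> C
  / (C \<inter> (A + B)) -> 0. Dividing by an element that is regular on the ends keeps the sequence
  exact, so the induction can repeat.\<close>

lemma wreg_extension:
  assumes A: "is_ideal A" and C: "is_ideal C" and AC: "A \<subseteq> C" and B: "is_ideal B"
    and "wreg fs A B" "wreg fs C (combine 1 A B)"
  shows "wreg fs C B"
  using B assms(5,6)
proof (induction fs arbitrary: B)
  case (Cons f fs)
  have reg: "y \<in> combine 1 A B" if "y \<in> C" "f * y \<in> combine 1 A B" for y
    using Cons.prems(3) that by simp
  have BAB: "B \<subseteq> combine 1 A B" using is_idealD(1)[OF A] by (force simp: combine_def)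
  have "y \<in> B" if y: "y \<in> C" "f * y \<in> B" for y
  proof -
    obtain a b where ab: "a \<in> A" "b \<in> B" "y = 1 * a + b"
      using reg[OF y(1)] y(2) BAB unfolding combine_def by blast
    then have "f * a = f * y - f * b" by (simp add: algebra_simps)
    then have "f * a \<in> B" using y ab(2) Cons.prems(1) by (simp add: is_idealD)
    then have "a \<in> B" using Cons.prems(2) ab(1) by simp
    then show ?thesis using ab Cons.prems(1) by (simp add: is_idealD)
  qed
  moreover have "wreg fs C (combine f C B)"
  proof (rule Cons.IH)
    show "is_ideal (combine f C B)" using C Cons.prems(1) by (rule is_ideal_combine)
    \<comment> \<open>Injectivity of the induced map from the left term to the middle one modulo
      \<open>f\<close>: regularity of \<open>f\<close> on the right term moves \<open>c\<close> into
      \<open>A\<close> up to \<open>B\<close>.\<close>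
    have "A \<inter> combine f C B = A \<inter> combine f A B"
    proof (intro equalityI subsetI)
      fix y assume y: "y \<in> A \<inter> combine f C B"
      then obtain c b where cb: "c \<in> C" "b \<in> B" "y = f * c + b" by (auto simp: combine_def)
      then have "f * c = 1 * y + (- b)" by simp
      then have "f * c \<in> combine 1 A B" using y cb is_idealD(5)[OF Cons.prems(1)]
        unfolding combine_def by blast
      then obtain a b' where ab: "a \<in> A" "b' \<in> B" "c = 1 * a + b'"
        using reg[OF cb(1)] by (auto simp: combine_def)
      then have "y = f * a + (f * b' + b)" by (simp add: cb(3) algebra_simps)
      moreover have "f * b' + b \<in> B" using ab cb Cons.prems(1) by (simp add: is_idealD)
      ultimately show "y \<in> A \<inter> combine f A B" using y ab(1) by (auto simp: combine_def)
    qed (use AC in \<open>auto simp: combine_def\<close>)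
    moreover have "wreg fs A (combine f A B)" using Cons.prems(2) by simp
    ultimately show "wreg fs A (combine f C B)" using wreg_cong[OF A] by blast
    have "combine 1 A (combine f C B) = combine f C (combine 1 A B)"
    proof (intro equalityI subsetI)
      fix y assume "y \<in> combine 1 A (combine f C B)"
      then obtain a b c where *: "a \<in> A" "c \<in> C" "b \<in> B" "y = 1 * a + (f * c + b)" by (auto simp: combine_def)
      then have "y = f * c + (1 * a + b)" by simp
      with *(1-3) show "y \<in> combine f C (combine 1 A B)" unfolding combine_def by blast
    next
      fix y assume "y \<in> combine f C (combine 1 A B)"
      then obtain a b c where *: "a \<in> A" "c \<in> C" "b \<in> B" "y = f * c + (1 * a + b)" by (auto simp: combine_def)
      then have "y = 1 * a + (f * c + b)" by simp
      with *(1-3) show "y \<in> combine 1 A (combine f C B)" unfolding combine_def by blast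
    qed
    then show "wreg fs C (combine 1 A (combine f C B))" using Cons.prems(3) by simp
  qed
  ultimately show ?case by simp
qed simp

lemma is_ideal_multiples: "is_ideal (range (\<lambda>r. r * u))"
  unfolding is_ideal_def
proof safe
  show "0 \<in> range (\<lambda>r. r * u)" by (rule image_eqI[of _ _ 0]) auto
  show "a * u + b * u \<in> range (\<lambda>r. r * u)" for a b by (rule image_eqI[of _ _ "a + b"]) (auto simp: algebra_simps)
  show "c * (a * u) \<in> range (\<lambda>r. r * u)" for a c by (rule image_eqI[of _ _ "c * a"]) (auto simp: algebra_simps)
qed

text \<open>Multiplication by \<open>u\<close> identifies R / p with (u) / ((u) \<inter> L), and
  this persists after dividing by \<open>f\<close>.\<close>

lemma wreg_multiples:
  assumes "is_ideal L" "\<And>r. r * u \<in> L \<longleftrightarrow> r \<in> p" "wreg fs UNIV p"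
  shows "wreg fs (range (\<lambda>r. r * u)) L"
  using assms
proof (induction fs arbitrary: L p)
  case (Cons f fs)
  have "wreg fs (range (\<lambda>r. r * u)) (combine f (range (\<lambda>r. r * u)) L)"
  proof (rule Cons.IH)
    show "is_ideal (combine f (range (\<lambda>r. r * u)) L)"
      using is_ideal_multiples Cons.prems(1) by (rule is_ideal_combine)
    show "r * u \<in> combine f (range (\<lambda>r. r * u)) L \<longleftrightarrow> r \<in> combine f UNIV p" for r
    proof
      assume "r * u \<in> combine f (range (\<lambda>r. r * u)) L"
      then obtain a b where *: "b \<in> L" "r * u = f * (a * u) + b" by (auto simp: combine_def)
      then have "(r - f * a) * u = b" by (simp add: algebra_simps)
      then have "r - f * a \<in> p" using *(1) Cons.prems(2) by metis
      moreover have "r = f * a + (r - f * a)" by simp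
      ultimately show "r \<in> combine f UNIV p" unfolding combine_def by blast
    next
      assume "r \<in> combine f UNIV p"
      then obtain a b where "b \<in> p" "r = f * a + b" by (auto simp: combine_def)
      then have "b * u \<in> L" "r * u = f * (a * u) + b * u" using Cons.prems(2) by (auto simp: algebra_simps)
      then show "r * u \<in> combine f (range (\<lambda>r. r * u)) L" unfolding combine_def by blast
    qed
    show "wreg fs UNIV (combine f UNIV p)" using Cons.prems(3) by simp
  qed
  moreover have "y * u \<in> L" if "f * (y * u) \<in> L" for y
    using that Cons.prems(2)[of "f * y"] Cons.prems(2)[of y] Cons.prems(3) by (simp add: mult.assoc)
  ultimately show ?case by auto
qed simp

text \<open>One step of a filtration: R / J is an extension of R / L by a copy of R / p, since L =
  (u) + J.\<close>

lemma wreg_cyclic_extension: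
  assumes J: "is_ideal J" and "is_ideal L" "J \<subseteq> L" "u \<in> L" "\<And>x. x \<in> L \<Longrightarrow> \<exists>r. x - r * u \<in> J"
    and p: "\<And>r. r * u \<in> J \<longleftrightarrow> r \<in> p" "wreg fs UNIV p" and "wreg fs UNIV L"
  shows "wreg fs UNIV J"
proof (rule wreg_extension[OF is_ideal_multiples is_ideal_UNIV _ J])
  show "wreg fs (range (\<lambda>r. r * u)) J" by (rule wreg_multiples[OF J p])
  have "L = combine 1 (range (\<lambda>r. r * u)) J"
  proof (intro equalityI subsetI)
    fix x assume "x \<in> L"
    then obtain r where "x - r * u \<in> J" using assms(5) by blast
    moreover have "x = 1 * (r * u) + (x - r * u)" by simp
    ultimately show "x \<in> combine 1 (range (\<lambda>r. r * u)) J" unfolding combine_def by blast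
  qed (use assms(2-4) in \<open>auto simp: combine_def intro!: is_idealD(2,3)\<close>)
  then show "wreg fs UNIV (combine 1 (range (\<lambda>r. r * u)) J)" using assms(8) by simp
qed simp

lemma wreg_UNIV [simp]: "wreg fs UNIV UNIV"
proof (induction fs)
  case (Cons f fs)
  have "combine f UNIV UNIV = (UNIV :: 'a set)"
  proof -
    have "y \<in> combine f UNIV UNIV" for y
    proof -
      have "y = f * 0 + y" by simp
      then show ?thesis unfolding combine_def by blast
    qed
    then show ?thesis by blast
  qed
  then show ?case using Cons by simp
qed simp

text \<open>The Koszul cohomology of \<open>R / L\<close> with respect to \<open>x\<close> vanishes in degree \<open>0\<close>, \<open>1\<close>, \<open>2\<close> when
  the ideal generated by \<open>x\<close> contains a weakly regular sequence of length \<open>1\<close>, \<open>2\<close>, \<open>3\<close>.\<close>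

definition generated_by :: "('i::finite \<Rightarrow> 'a::comm_ring_1) \<Rightarrow> 'a \<Rightarrow> bool" where
  "generated_by x f \<longleftrightarrow> (\<exists>u. f = (\<Sum>i\<in>UNIV. u i * x i))"

lemma koszul_0:
  assumes L: "is_ideal L" and "generated_by x f" and "wreg [f] UNIV L" and m: "\<And>i. x i * m \<in> L"
  shows "m \<in> L"
proof -
  obtain u where "f = (\<Sum>i\<in>UNIV. u i * x i)" using assms(2) by (auto simp: generated_by_def)
  then have "f * m = (\<Sum>i\<in>UNIV. u i * (x i * m))" by (simp add: sum_distrib_right mult.assoc)
  also have "\<dots> \<in> L" by (intro is_ideal_sum[OF L] is_idealD(3)[OF L m])
  finally show ?thesis using assms(3) by simp
qed

text \<open>Contraction with the coefficients of \<open>f\<close> is a homotopy for multiplication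
  by \<open>f\<close>: it turns the cocycle \<open>m\<close> into \<open>M\<close> with
  \<open>x i * M\<close> equal to \<open>f * m i\<close> modulo \<open>L\<close>. Then
  \<open>koszul_0\<close>, applied to \<open>g\<close>, puts \<open>M\<close> into (f) + L, and
  cancelling \<open>f\<close> yields \<open>n\<close>.\<close>

lemma koszul_1:
  assumes L: "is_ideal L" and f: "generated_by x f" and g: "generated_by x g"
    and reg: "wreg [f, g] UNIV L" and m: "\<And>i j. x i * m j - x j * m i \<in> L"
  shows "\<exists>n. \<forall>i. m i - x i * n \<in> L"
proof -
  obtain u where u: "f = (\<Sum>i\<in>UNIV. u i * x i)" using f by (auto simp: generated_by_def)
  define M where "M = (\<Sum>j\<in>UNIV. u j * m j)"
  have fm: "x i * M - f * m i \<in> L" for i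
  proof -
    have "x i * M - f * m i = (\<Sum>j\<in>UNIV. u j * (x i * m j - x j * m i))"
      by (simp add: u M_def sum_distrib_left sum_distrib_right algebra_simps sum_subtractf)
    also have "\<dots> \<in> L" using m by (intro is_ideal_sum[OF L] is_idealD(3)[OF L])
    finally show ?thesis .
  qed
  have I: "is_ideal (combine f UNIV L)" using is_ideal_UNIV L by (rule is_ideal_combine)
  have "M \<in> combine f UNIV L"
  proof (rule koszul_0[OF I g])
    show "wreg [g] UNIV (combine f UNIV L)" using reg by simp
    show "x i * M \<in> combine f UNIV L" for i
    proof -
      have "x i * M = f * m i + (x i * M - f * m i)" by simp
      then show ?thesis unfolding combine_def using fm[of i] by blast
    qed
  qed
  then obtain n l where n: "l \<in> L" "M = f * n + l" by (auto simp: combine_def)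
  have "m i - x i * n \<in> L" for i
  proof -
    have "f * (m i - x i * n) = x i * l - (x i * M - f * m i)" by (simp add: n(2) algebra_simps)
    also have "\<dots> \<in> L" using fm[of i] n(1) L by (blast intro: is_idealD(3,6))
    finally show ?thesis using reg by simp
  qed
  then show ?thesis by blast
qed

text \<open>The same contraction one degree higher: \<open>M\<close> is a 1-cocycle modulo
  \<open>f\<close>, so that \<open>koszul_1\<close> applies to it with \<open>g\<close> and
  \<open>h\<close>.\<close>

lemma koszul_2:
  assumes L: "is_ideal L" and f: "generated_by x f" and g: "generated_by x g" and h: "generated_by x h"
    and reg: "wreg [f, g, h] UNIV L"
    and m: "\<And>k i j. x k * m i j - x i * m k j + x j * m k i \<in> L"
  shows "\<exists>n. \<forall>i j. m i j - (x i * n j - x j * n i) \<in> L"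
proof -
  obtain u where u: "f = (\<Sum>i\<in>UNIV. u i * x i)" using f by (auto simp: generated_by_def)
  define M where "M j = (\<Sum>k\<in>UNIV. u k * m k j)" for j
  have fm: "f * m i j - (x i * M j - x j * M i) \<in> L" for i j
  proof -
    have "f * m i j - (x i * M j - x j * M i) =
        (\<Sum>k\<in>UNIV. u k * (x k * m i j - x i * m k j + x j * m k i))"
      by (simp add: u M_def sum_distrib_left sum_distrib_right algebra_simps sum_subtractf sum.distrib)
    also have "\<dots> \<in> L" using m by (intro is_ideal_sum[OF L] is_idealD(3)[OF L])
    finally show ?thesis .
  qed
  have I: "is_ideal (combine f UNIV L)" using is_ideal_UNIV L by (rule is_ideal_combine)
  have "\<exists>n. \<forall>i. M i - x i * n \<in> combine f UNIV L"
  proof (rule koszul_1[OF I g h])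
    show "wreg [g, h] UNIV (combine f UNIV L)" using reg by simp
    show "x i * M j - x j * M i \<in> combine f UNIV L" for i j
    proof -
      have "x i * M j - x j * M i = f * m i j + - (f * m i j - (x i * M j - x j * M i))" by simp
      then show ?thesis unfolding combine_def using is_idealD(5)[OF L fm[of i j]] by blast
    qed
  qed
  then obtain n where n: "\<And>i. M i - x i * n \<in> combine f UNIV L" by blast
  have "\<exists>p. M i - x i * n - f * p \<in> L" for i
  proof -
    obtain q l where "l \<in> L" "M i - x i * n = f * q + l" using n[of i] by (auto simp: combine_def)
    then show ?thesis by (intro exI[of _ q]) simp
  qed
  then obtain p where p: "\<And>i. M i - x i * n - f * p i \<in> L" by metis
  \<comment> \<open>In \<open>x i * M j - x j * M i\<close> the terms with \<open>n\<close> cancel,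
    so that \<open>f\<close> times the coboundary of \<open>p\<close> remains and \<open>f\<close>
    can be cancelled.\<close>
  have "m i j - (x i * p j - x j * p i) \<in> L" for i j
  proof -
    have "f * (m i j - (x i * p j - x j * p i)) = (f * m i j - (x i * M j - x j * M i))
        + (x i * (M j - x j * n - f * p j) - x j * (M i - x i * n - f * p i))"
      by (simp add: algebra_simps)
    also have "\<dots> \<in> L" using fm[of i j] p L by (blast intro: is_idealD(2,3,6))
    finally show ?thesis using reg by simp
  qed
  then show ?thesis by blast
qed

section \<open>Combinatorial consequences of depth two and three\<close>

lemma max_graded_ideal_generated_by:
  "f \<in> max_graded_ideal \<Longrightarrow> generated_by var (f :: ('v::finite, 'k::comm_ring_1) mpoly)"
  unfolding generated_by_def by (erule max_graded_ideal_obtain) blast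

lemma lookup_facet_ideal:
  assumes "f \<in> facet_ideal \<F>" "F \<in> \<F>" "Poly_Mapping.keys e \<subseteq> F"
  shows "Poly_Mapping.lookup f e = 0"
  using assms by (auto simp: facet_ideal_def mideal_def in_keys_iff)

lemma lookup_var_mult:
  "Poly_Mapping.lookup (var i * f) (Poly_Mapping.single i 1 + e) = Poly_Mapping.lookup f e"
  by (simp add: var_def)

lemma lookup_var_mult_0:
  fixes f :: "('v, 'k::comm_ring_1) mpoly"
  assumes "i \<notin> Poly_Mapping.keys e"
  shows "Poly_Mapping.lookup (var i * f) e = 0"
proof -
  have "e \<notin> Poly_Mapping.keys (var i * f)"
    unfolding var_def keys_monomial_mult using assms by (auto simp: keys_add_nat)
  then show ?thesis by (simp add: in_keys_iff)
qed

lemma mult_facet_ideal: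
  fixes r :: "('v::finite, 'k::comm_ring_1) mpoly"
  assumes "\<And>F. F \<in> \<F> \<Longrightarrow> \<not> Poly_Mapping.keys a \<subseteq> F"
  shows "r * monomial a \<in> facet_ideal \<F>"
  using assms by (intro is_idealD(3)[OF is_ideal_facet_ideal]) (simp add: facet_ideal_def)

lemma var_var_facet_ideal:
  fixes r :: "('v::finite, 'k::comm_ring_1) mpoly"
  assumes "\<And>F. F \<in> \<F> \<Longrightarrow> \<not> {i, j} \<subseteq> F"
  shows "var i * var j \<in> (facet_ideal \<F> :: ('v, 'k) mpoly set)"
proof -
  have "1 * monomial (Poly_Mapping.single i 1 + Poly_Mapping.single j 1) \<in> (facet_ideal \<F> :: ('v, 'k) mpoly set)"
    using assms by (intro mult_facet_ideal) (auto simp: keys_add_nat)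
  then show ?thesis by (simp add: var_def monomial_mult)
qed

text \<open>Degree \<open>1\<close>: a partition of the vertices that no facet crosses gives the cocycle \<open>m\<close>.\<close>

lemma depth_2_connected:
  fixes f g :: "('v::finite, 'k::comm_ring_1) mpoly"
  assumes "f \<in> max_graded_ideal" "g \<in> max_graded_ideal" "wreg [f, g] UNIV (facet_ideal \<F>)"
    and A: "\<And>F. F \<in> \<F> \<Longrightarrow> F \<subseteq> A \<or> F \<inter> A = {}"
    and F: "F \<in> \<F>" "a \<in> F" "a \<in> A" and G: "G \<in> \<F>" "b \<in> G"
  shows "b \<in> A"
proof (rule ccontr)
  assume b: "b \<notin> A"
  define m where "m i = (if i \<in> A then var i else 0 :: ('v, 'k) mpoly)" for i
  have V: "var i * var j \<in> (facet_ideal \<F> :: ('v, 'k) mpoly set)" if "i \<in> A" "j \<notin> A" for i j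
    using that A by (intro var_var_facet_ideal) blast
  have "\<exists>n. \<forall>i. m i - var i * n \<in> facet_ideal \<F>"
  proof (rule koszul_1[OF is_ideal_facet_ideal _ _ assms(3)])
    show "generated_by var f" "generated_by var g"
      using assms by (auto intro: max_graded_ideal_generated_by)
    show "var i * m j - var j * m i \<in> facet_ideal \<F>" for i j
      using V[of i j] V[of j i] is_idealD[OF is_ideal_facet_ideal[of \<F>]]
      by (auto simp: m_def mult.commute)
  qed
  then obtain n where n: "\<And>i. m i - var i * n \<in> facet_ideal \<F>" by blast
  have *: "Poly_Mapping.lookup (m i - var i * n) (Poly_Mapping.single i 1) = 0" if "i \<in> H" "H \<in> \<F>" for i H
    using lookup_facet_ideal[OF n that(2)] that by simp
  have l: "Poly_Mapping.lookup (var i * n) (Poly_Mapping.single i 1) = Poly_Mapping.lookup n 0" for i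
    using lookup_var_mult[of i n 0] by simp
  \<comment> \<open>The constant coefficient of \<open>n\<close> would have to be 1 because of
    \<open>a\<close> and 0 because of \<open>b\<close>.\<close>
  have "Poly_Mapping.lookup (m a) (Poly_Mapping.single a 1) = Poly_Mapping.lookup n 0"
    using *[OF F(2,1)] l[of a] by (simp add: lookup_minus)
  moreover have "Poly_Mapping.lookup (m b) (Poly_Mapping.single b 1) = Poly_Mapping.lookup n 0"
    using *[OF G(2,1)] l[of b] by (simp add: lookup_minus)
  ultimately show False using F(3) b by (simp add: m_def var_def monomial_def)
qed

text \<open>Degree \<open>2\<close>, multidegree \<open>0\<close>: the first simplicial cohomology vanishes.\<close>

lemma depth_3_cocycle:
  fixes f g h :: "('v::finite, 'k::comm_ring_1) mpoly" and c :: "'v \<Rightarrow> 'v \<Rightarrow> 'k"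
  assumes "f \<in> max_graded_ideal" "g \<in> max_graded_ideal" "h \<in> max_graded_ideal"
    and "wreg [f, g, h] UNIV (facet_ideal \<F>)"
    and c: "\<And>F i j k. F \<in> \<F> \<Longrightarrow> i \<in> F \<Longrightarrow> j \<in> F \<Longrightarrow> k \<in> F \<Longrightarrow> c i j - c k j + c k i = 0"
  shows "\<exists>s. \<forall>F\<in>\<F>. \<forall>i\<in>F. \<forall>j\<in>F. i \<noteq> j \<longrightarrow> c i j = s j - s i"
proof -
  let ?J = "facet_ideal \<F> :: ('v, 'k) mpoly set"
  let ?C = "\<lambda>i j. Poly_Mapping.single 0 (c i j) :: ('v, 'k) mpoly"
  \<comment> \<open>The simplicial cochain \<open>c\<close> becomes a Koszul cochain by giving the
    component at \<open>i\<close>, \<open>j\<close> the degree of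
    \<open>var i * var j\<close>.\<close>
  define m where "m i j = ?C i j * (var i * var j)" for i j
  have "\<exists>n. \<forall>i j. m i j - (var i * n j - var j * n i) \<in> ?J"
  proof (rule koszul_2[OF is_ideal_facet_ideal _ _ _ assms(4)])
    show "generated_by var f" "generated_by var g" "generated_by var h"
      using assms by (auto intro: max_graded_ideal_generated_by)
    show "var k * m i j - var i * m k j + var j * m k i \<in> ?J" for k i j
    proof -
      have eq: "var k * m i j - var i * m k j + var j * m k i =
          Poly_Mapping.single 0 (c i j - c k j + c k i) * (var i * var j * var k)"
        by (simp add: m_def algebra_simps single_add single_diff)
      show ?thesis
      proof (cases "\<exists>F\<in>\<F>. {i, j, k} \<subseteq> F")
        case True
        then have "c i j - c k j + c k i = 0" using c by auto
        then show ?thesis unfolding eq by (simp add: is_idealD[OF is_ideal_facet_ideal])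
      next
        case False
        have "var i * var j * var k =
            (monomial (Poly_Mapping.single i 1 + Poly_Mapping.single j 1 + Poly_Mapping.single k 1) :: ('v, 'k) mpoly)"
          by (simp add: var_def monomial_mult)
        then show ?thesis unfolding eq using False
          by (simp only:) (rule mult_facet_ideal, auto simp: keys_add_nat)
      qed
    qed
  qed
  then obtain n where n: "\<And>i j. m i j - (var i * n j - var j * n i) \<in> ?J" by blast
  \<comment> \<open>Comparing coefficients at \<open>var i * var j\<close> in the coboundary
    equation leaves exactly these coefficients of \<open>n\<close>.\<close>
  define s where "s i = Poly_Mapping.lookup (n i) (Poly_Mapping.single i 1)" for i
  have "c i j = s j - s i" if F: "F \<in> \<F>" "i \<in> F" "j \<in> F" for F i j
  proof -
    let ?e = "Poly_Mapping.single i 1 + Poly_Mapping.single j 1 :: 'v \<Rightarrow>\<^sub>0 nat"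
    have "Poly_Mapping.lookup (m i j - (var i * n j - var j * n i)) ?e = 0"
      using lookup_facet_ideal[OF n F(1), of ?e] F by (simp add: keys_add_nat)
    moreover have "Poly_Mapping.lookup (var i * n j) ?e = s j"
      by (simp only: lookup_var_mult s_def)
    moreover have "Poly_Mapping.lookup (var j * n i) ?e = s i"
      by (subst add.commute) (simp only: lookup_var_mult s_def)
    moreover have "Poly_Mapping.lookup (m i j) ?e = c i j"
      unfolding m_def lookup_single_0_mult var_def monomial_mult by (simp add: monomial_def)
    ultimately show ?thesis by (simp add: lookup_minus)
  qed
  then show ?thesis by blast
qed

text \<open>Degree \<open>2\<close>, multidegree \<open>-1\<close> at \<open>e\<close>: the link of \<open>e\<close> is connected, provided that the
  partition is not even crossed by a facet which avoids \<open>e\<close>.\<close>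

lemma depth_3_link:
  fixes f g h :: "('v::finite, 'k::comm_ring_1) mpoly"
  assumes "f \<in> max_graded_ideal" "g \<in> max_graded_ideal" "h \<in> max_graded_ideal"
    and "wreg [f, g, h] UNIV (facet_ideal \<F>)"
    and A: "\<And>F. F \<in> \<F> \<Longrightarrow> F - {e} \<subseteq> A \<or> F \<inter> A = {}" and e: "e \<notin> A"
    and F: "F \<in> \<F>" "a \<in> F" "a \<in> A" and G: "G \<in> \<F>" "b \<in> G" "b \<noteq> e"
  shows "b \<in> A"
proof (rule ccontr)
  assume b: "b \<notin> A"
  let ?J = "facet_ideal \<F> :: ('v, 'k) mpoly set"
  define z where "z i = (if i \<in> A then var i else 0 :: ('v, 'k) mpoly)" for i
  \<comment> \<open>The 1-cochain \<open>z\<close> of the partition, multiplied by the basis element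
    at index \<open>e\<close>.\<close>
  define m where "m i j = (if j = e then z i else 0) - (if i = e then z j else 0)" for i j
  have V: "var i * var j \<in> ?J" if "i \<in> A" "j \<notin> A" "j \<noteq> e" for i j
    using that A by (intro var_var_facet_ideal) blast
  have Z: "var i * z j - var j * z i \<in> ?J" if "i \<noteq> e" "j \<noteq> e" for i j
    using that V[of i j] V[of j i] is_idealD[OF is_ideal_facet_ideal[of \<F>]]
    by (auto simp: z_def mult.commute)
  have "\<exists>n. \<forall>i j. m i j - (var i * n j - var j * n i) \<in> ?J"
  proof (rule koszul_2[OF is_ideal_facet_ideal _ _ _ assms(4)])
    show "generated_by var f" "generated_by var g" "generated_by var h"
      using assms by (auto intro: max_graded_ideal_generated_by)
    show "var k * m i j - var i * m k j + var j * m k i \<in> ?J" for k i j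
      using Z[of k i] Z[of j k] Z[of i j] is_idealD(1)[OF is_ideal_facet_ideal[of \<F>]] e
      by (cases "i = e"; cases "j = e"; cases "k = e") (auto simp: m_def z_def split: if_splits)
  qed
  then obtain n where n: "\<And>i j. m i j - (var i * n j - var j * n i) \<in> ?J" by blast
  \<comment> \<open>The summand \<open>var e * n i\<close> has no term at the exponent of
    \<open>var i\<close>, so \<open>z i\<close> sees only the constant coefficient of
    \<open>n e\<close>. This is the same for all \<open>i\<close>, whereas \<open>z\<close>
    distinguishes \<open>a\<close> from \<open>b\<close>.\<close>
  have *: "Poly_Mapping.lookup (z i) (Poly_Mapping.single i 1) = Poly_Mapping.lookup (n e) 0"
    if "i \<noteq> e" "i \<in> H" "H \<in> \<F>" for i H
  proof -
    have "Poly_Mapping.lookup (m i e - (var i * n e - var e * n i)) (Poly_Mapping.single i 1) = 0"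
      using lookup_facet_ideal[OF n that(3)] that(2) by simp
    moreover have "Poly_Mapping.lookup (var i * n e) (Poly_Mapping.single i 1) = Poly_Mapping.lookup (n e) 0"
      using lookup_var_mult[of i "n e" 0] by simp
    moreover have "Poly_Mapping.lookup (var e * n i) (Poly_Mapping.single i 1) = 0"
      using that(1) by (intro lookup_var_mult_0) auto
    ultimately show ?thesis using that(1) by (simp add: m_def lookup_minus)
  qed
  have "a \<noteq> e" using F(3) e by auto
  from *[OF this F(2,1)] *[OF G(3,2,1)] show False
    using F(3) b by (simp add: z_def var_def monomial_def)
qed


section \<open>Shellable complexes\<close>

text \<open>Shellability, for facets of equal size: the last facet \<open>F\<close> meets the complex generated by
  the others in a union of ridges \<open>F - {v}\<close>.\<close>

inductive shellable :: "'v set set \<Rightarrow> bool" where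
  empty: "shellable {}"
| insert: "shellable \<F> \<Longrightarrow> (\<And>G. G \<in> \<F> \<Longrightarrow> \<exists>H\<in>\<F>. \<exists>v\<in>F - G. F \<inter> H = F - {v}) \<Longrightarrow>
    shellable (insert F \<F>)"

text \<open>\<open>S\<close> is the restriction of \<open>F\<close> in the shelling: a subset of
  \<open>F\<close> that lies in no earlier facet contains \<open>S\<close>, because without some
  \<open>v\<close> in \<open>S\<close> it would lie in a facet containing \<open>F - {v}\<close>. So
  the monomial of \<open>S\<close> generates the old ideal over the new one, with annihilator
  \<open>face_prime F\<close>.\<close>

lemma shelling_step:
  fixes \<F> :: "'v::finite set set"
  assumes "\<And>G. G \<in> \<F> \<Longrightarrow> \<exists>H\<in>\<F>. \<exists>v\<in>F - G. F \<inter> H = F - {v}"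
  obtains u :: "('v, 'k::comm_ring_1) mpoly" where "u \<in> facet_ideal \<F>" "u \<notin> facet_ideal (insert F \<F>)"
    "\<And>x. x \<in> facet_ideal \<F> \<Longrightarrow> \<exists>r. x - r * u \<in> facet_ideal (insert F \<F>)"
    "\<And>r. r * u \<in> facet_ideal (insert F \<F>) \<longleftrightarrow> r \<in> face_prime F"
proof -
  define S where "S = {v\<in>F. \<exists>H\<in>\<F>. F \<inter> H = F - {v}}"
  have SG: "\<not> S \<subseteq> G" if "G \<in> \<F>" for G using assms[OF that] by (auto simp: S_def)
  have SF: "S \<subseteq> F" by (auto simp: S_def)
  define u where "u = (monomial (indicator_exponent S) :: ('v, 'k) mpoly)"
  have u: "r * u \<in> facet_ideal (insert F \<F>) \<longleftrightarrow> r \<in> face_prime F" for r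
  proof -
    have "indicator_exponent S + e \<in> {e. \<forall>G\<in>insert F \<F>. \<not> Poly_Mapping.keys e \<subseteq> G} \<longleftrightarrow>
        \<not> Poly_Mapping.keys e \<subseteq> F" for e
    proof -
      have "\<not> S \<union> Poly_Mapping.keys e \<subseteq> G" if "G \<in> \<F>" for G using SG[OF that] by blast
      then show ?thesis using SF by (simp add: keys_add_nat)
    qed
    then have "(+) (indicator_exponent S) ` K \<subseteq> {e. \<forall>G\<in>insert F \<F>. \<not> Poly_Mapping.keys e \<subseteq> G} \<longleftrightarrow>
        K \<subseteq> {e. \<not> Poly_Mapping.keys e \<subseteq> F}" for K
      unfolding image_subset_iff subset_eq[of K] mem_Collect_eq[of _ "\<lambda>e. \<not> Poly_Mapping.keys e \<subseteq> F"]
      by simp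
    then show ?thesis
      unfolding u_def mult.commute[of r] facet_ideal_def face_prime_def mideal_def mem_Collect_eq
        keys_monomial_mult .
  qed
  show ?thesis
  proof (rule that[OF _ _ _ u])
    show "u \<in> facet_ideal \<F>" using SG by (auto simp: u_def facet_ideal_def)
    show "u \<notin> facet_ideal (insert F \<F>)" using u[of 1] by (simp add: face_prime_def mideal_def)
    show "\<exists>r. x - r * u \<in> facet_ideal (insert F \<F>)" if x: "x \<in> facet_ideal \<F>" for x
    proof -
      have I: "is_ideal (combine 1 (range (\<lambda>r. r * u)) (facet_ideal (insert F \<F>)))"
        by (intro is_ideal_combine is_ideal_multiples is_ideal_facet_ideal)
      have "facet_ideal \<F> \<subseteq> combine 1 (range (\<lambda>r. r * u)) (facet_ideal (insert F \<F>))"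
        unfolding facet_ideal_def[of \<F>]
      proof (rule mideal_subset_ideal[OF I])
        fix e :: "'v \<Rightarrow>\<^sub>0 nat" assume e: "e \<in> {e. \<forall>F\<in>\<F>. \<not> Poly_Mapping.keys e \<subseteq> F}"
        show "monomial e \<in> combine 1 (range (\<lambda>r. r * u)) (facet_ideal (insert F \<F>))"
        proof (cases "Poly_Mapping.keys e \<subseteq> F")
          case True
          have "S \<subseteq> Poly_Mapping.keys e"
          proof
            fix v assume "v \<in> S"
            then obtain H where H: "H \<in> \<F>" "F \<inter> H = F - {v}" by (auto simp: S_def)
            then show "v \<in> Poly_Mapping.keys e" using e True by blast
          qed
          then obtain a where "e = a + indicator_exponent S" using indicator_exponent_divides by blast
          then have "monomial e = 1 * (monomial a * u) + 0" by (simp add: u_def monomial_mult)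
          then show ?thesis using is_idealD(1)[OF is_ideal_facet_ideal] unfolding combine_def by blast
        next
          case False
          then have "monomial e \<in> (facet_ideal (insert F \<F>) :: ('v, 'k) mpoly set)"
            using e by (auto simp: facet_ideal_def)
          moreover have "monomial e = 1 * (0 * u) + monomial e" by simp
          ultimately show ?thesis unfolding combine_def by blast
        qed
      qed
      then obtain r l where "l \<in> facet_ideal (insert F \<F>)" "x = 1 * (r * u) + l"
        using x unfolding combine_def by blast
      then show ?thesis by (intro exI[of _ r]) simp
    qed
  qed
qed

lemma facet_ideal_insert_subset: "facet_ideal (insert F \<F>) \<subseteq> facet_ideal \<F>"
  by (auto simp: facet_ideal_def mideal_def)

lemma facet_ideal_empty [simp]: "facet_ideal {} = UNIV"
  by (simp add: facet_ideal_def)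

text \<open>Inserting a facet shrinks the ideal, so the new factor enters at the bottom of the chain
  and the old indices move up by one. The primes are counted from 1, hence the shift in
  \<open>p'\<close>.\<close>

lemma shellable_prime_filtration:
  fixes \<F> :: "'v::finite set set"
  assumes "shellable \<F>"
  shows "\<exists>r I p. monomial_prime_filtration (facet_ideal \<F> :: ('v, 'k::idom) mpoly set) r I p \<and>
    (\<forall>i\<in>{1..r}. p i \<in> face_prime ` \<F>)"
  using assms
proof induction
  case empty
  have "monomial_ideal (UNIV :: ('v, 'k) mpoly set)"
    using monomial_ideal_facet_ideal[of "{}"] by simp
  then show ?case
    by (intro exI[of _ 0] exI[of _ "\<lambda>_. UNIV"] exI) (simp add: monomial_prime_filtration_def monomial_ideal_chain_def)
next
  case (insert \<F> F)
  then obtain r I p where *: "monomial_prime_filtration (facet_ideal \<F> :: ('v, 'k) mpoly set) r I p"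
    "\<And>i. i \<in> {1..r} \<Longrightarrow> p i \<in> face_prime ` \<F>" by blast
  obtain u where u: "u \<in> (facet_ideal \<F> :: ('v, 'k) mpoly set)" "u \<notin> facet_ideal (insert F \<F>)"
    "\<And>x. x \<in> facet_ideal \<F> \<Longrightarrow> \<exists>r. x - r * u \<in> facet_ideal (insert F \<F>)"
    "\<And>r. r * u \<in> facet_ideal (insert F \<F>) \<longleftrightarrow> r \<in> face_prime F"
    using shelling_step[OF insert.hyps(2)] by blast
  define I' where "I' i = (case i of 0 \<Rightarrow> facet_ideal (insert F \<F>) | Suc j \<Rightarrow> I j)" for i
  define p' where "p' i = (if i = 1 then face_prime F else p (i - 1))" for i
  have I0: "I 0 = facet_ideal \<F>" using *(1) by (simp add: monomial_prime_filtration_def monomial_ideal_chain_def)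
  have "monomial_ideal_chain (facet_ideal (insert F \<F>)) (Suc r) I'"
    unfolding monomial_ideal_chain_def
  proof (intro conjI allI impI)
    show "I' (Suc r) = UNIV" using *(1) by (simp add: I'_def monomial_prime_filtration_def monomial_ideal_chain_def)
    show "monomial_ideal (I' i)" if "i \<le> Suc r" for i
      using *(1) that by (auto simp: I'_def monomial_prime_filtration_def monomial_ideal_chain_def
          monomial_ideal_facet_ideal split: nat.split)
    show "I' i \<subset> I' (Suc i)" if "i < Suc r" for i
    proof (cases i)
      case 0
      then show ?thesis using u(1,2) facet_ideal_insert_subset[of F \<F>] I0 by (auto simp: I'_def)
    next
      case (Suc j)
      then show ?thesis using *(1) that
        by (simp add: I'_def monomial_prime_filtration_def monomial_ideal_chain_def)
    qed
  qed (simp add: I'_def)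
  moreover have "primeideal (p' i) poly_ring \<and> monomial_ideal (p' i) \<and>
      module_isomorphic poly_ring (factor_module (I' i) (I' (i - 1))) (factor_module UNIV (p' i))"
    if i: "i \<in> {1..Suc r}" for i
  proof (cases "i = 1")
    case True
    have "module_isomorphic poly_ring (factor_module (facet_ideal \<F>) (facet_ideal (insert F \<F>)))
        (factor_module UNIV (face_prime F :: ('v, 'k) mpoly set))"
      by (rule module_isomorphic_cyclicI[OF is_ideal_facet_ideal is_ideal_facet_ideal is_ideal_face_prime
            facet_ideal_insert_subset u(1,3,4)])
    then show ?thesis using True
      by (simp add: I'_def p'_def I0 primeideal_iff_is_prime is_prime_face_prime monomial_ideal_face_prime)
  next
    case False
    define j where "j = i - 2"
    have j: "i = Suc (Suc j)" "Suc j \<in> {1..r}" using i False by (auto simp: j_def)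
    have "primeideal (p (Suc j)) poly_ring \<and> monomial_ideal (p (Suc j)) \<and>
        module_isomorphic poly_ring (factor_module (I (Suc j)) (I (Suc j - 1))) (factor_module UNIV (p (Suc j)))"
      using *(1) j(2) unfolding monomial_prime_filtration_def by blast
    then show ?thesis by (simp add: I'_def p'_def j(1))
  qed
  ultimately have "monomial_prime_filtration (facet_ideal (insert F \<F>)) (Suc r) I' p'"
    by (simp add: monomial_prime_filtration_def)
  moreover have "p' i \<in> face_prime ` insert F \<F>" if "i \<in> {1..Suc r}" for i
  proof (cases "i = 1")
    case False
    then have "i - 1 \<in> {1..r}" using that by auto
    from *(2)[OF this] show ?thesis using False by (simp add: p'_def)
  qed (simp add: p'_def)
  ultimately show ?case by blast
qed

lemma shellable_pretty_clean:
  fixes \<F> :: "'v::finite set set"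
  assumes "shellable \<F>" and card: "\<And>F. F \<in> \<F> \<Longrightarrow> card F = m"
  shows "pretty_clean (facet_ideal \<F> :: ('v, 'k::idom) mpoly set)"
proof -
  obtain r I p where *: "monomial_prime_filtration (facet_ideal \<F> :: ('v, 'k) mpoly set) r I p"
    "\<And>i. i \<in> {1..r} \<Longrightarrow> p i \<in> face_prime ` \<F>"
    using shellable_prime_filtration[OF assms(1)] by blast
  have "\<not> p i \<subset> p j" if i: "i \<in> {1..r}" and j: "j \<in> {1..r}" for i j
  proof
    assume sub: "p i \<subset> p j"
    obtain F G where FG: "F \<in> \<F>" "G \<in> \<F>" "p i = face_prime F" "p j = face_prime G"
      using *(2)[OF i] *(2)[OF j] by auto
    then have "G \<subseteq> F" using sub face_prime_mono_iff[where 'k = 'k] by blast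
    then have "G = F" using FG(1,2) card by (metis card_subset_eq finite)
    then show False using FG sub by simp
  qed
  then show ?thesis unfolding pretty_clean_def using *(1) by blast
qed

text \<open>Every order of the facets is a shelling, with \<open>G\<close> itself as
  \<open>H\<close>.\<close>

lemma shellable_ridges:
  fixes \<F> :: "'v::finite set set"
  assumes "\<And>F G. F \<in> \<F> \<Longrightarrow> G \<in> \<F> \<Longrightarrow> F \<noteq> G \<Longrightarrow> \<exists>v\<in>F - G. F \<inter> G = F - {v}"
  shows "shellable \<F>"
proof -
  have "finite \<F>" by simp
  then show ?thesis using assms
  proof (induction \<F> rule: finite_induct)
    case (insert F \<F>)
    have "\<exists>H\<in>\<F>. \<exists>v\<in>F - G. F \<inter> H = F - {v}" if "G \<in> \<F>" for G
      using insert.prems[of F G] that insert.hyps by blast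
    then show ?case using insert by (intro shellable.insert) auto
  qed (rule shellable.empty)
qed

lemma wreg_shellable:
  fixes \<F> :: "'v::finite set set"
  assumes "shellable \<F>" "\<And>F. F \<in> \<F> \<Longrightarrow> wreg fs UNIV (face_prime F :: ('v, 'k::comm_ring_1) mpoly set)"
  shows "wreg fs UNIV (facet_ideal \<F> :: ('v, 'k) mpoly set)"
  using assms
proof induction
  case (insert \<F> F)
  obtain u where u: "u \<in> (facet_ideal \<F> :: ('v, 'k) mpoly set)" "u \<notin> facet_ideal (insert F \<F>)"
    "\<And>x. x \<in> facet_ideal \<F> \<Longrightarrow> \<exists>r. x - r * u \<in> facet_ideal (insert F \<F>)"
    "\<And>r. r * u \<in> facet_ideal (insert F \<F>) \<longleftrightarrow> r \<in> face_prime F"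
    using shelling_step[OF insert.hyps(2)] by blast
  show ?case
    by (rule wreg_cyclic_extension[OF is_ideal_facet_ideal is_ideal_facet_ideal facet_ideal_insert_subset u(1,3,4)])
      (use insert in auto)
qed simp

section \<open>Elementary symmetric polynomials as a regular sequence\<close>

definition elem_sym :: "nat \<Rightarrow> ('v::finite, 'k::comm_ring_1) mpoly" where
  "elem_sym k = (\<Sum>S | card S = k. sqfree_monomial S)"

fun elem_syms :: "nat \<Rightarrow> ('v::finite, 'k::comm_ring_1) mpoly list" where
  "elem_syms 0 = []"
| "elem_syms (Suc m) = elem_sym (Suc m) # elem_syms m"

lemma length_elem_syms [simp]: "length (elem_syms m) = m"
  by (induction m) auto

text \<open>Every other set of size \<open>m\<close> has an element outside \<open>F\<close>, so its
  monomial vanishes modulo the prime.\<close>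

lemma elem_sym_face_prime:
  fixes F :: "'v::finite set"
  assumes "card F = m"
  shows "elem_sym m - sqfree_monomial F \<in> (face_prime F :: ('v, 'k::comm_ring_1) mpoly set)"
proof -
  have "elem_sym m - sqfree_monomial F = (\<Sum>S \<in> {S. card S = m} - {F}. sqfree_monomial S :: ('v, 'k) mpoly)"
    using assms unfolding elem_sym_def by (subst sum.remove[of _ F]) auto
  also have "\<dots> \<in> face_prime F"
  proof (rule is_ideal_sum[OF is_ideal_face_prime])
    fix S assume "S \<in> {S. card S = m} - {F}"
    then have "\<not> S \<subseteq> F" using assms card_subset_eq[of F S] by auto
    then show "sqfree_monomial S \<in> (face_prime F :: ('v, 'k) mpoly set)"
      by (simp add: sqfree_monomial_eq face_prime_def)
  qed
  finally show ?thesis .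
qed

text \<open>Modulo the top elementary symmetric polynomial \<open>x\<^sub>1 \<cdots> x\<^sub>m\<close> one is left with the boundary of
  a simplex. It is shellable, and the induction hypothesis applies to its facets.\<close>

lemma wreg_elem_syms:
  fixes F :: "'v::finite set"
  assumes "card F = m"
  shows "wreg (elem_syms m) UNIV (face_prime F :: ('v, 'k::idom) mpoly set)"
  using assms
proof (induction m arbitrary: F)
  case (Suc m)
  let ?e = "elem_sym (Suc m) :: ('v, 'k) mpoly" and ?P = "face_prime F :: ('v, 'k) mpoly set"
  let ?G = "(\<lambda>v. F - {v}) ` F"
  have P: "is_ideal ?P" by (rule is_ideal_face_prime)
  have e: "?e - sqfree_monomial F \<in> ?P" by (rule elem_sym_face_prime[OF Suc.prems])
  have "?e \<notin> ?P"
  proof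
    assume "?e \<in> ?P"
    then have "?e - (?e - sqfree_monomial F) \<in> ?P" using e P by (blast intro: is_idealD(6))
    then show False by (simp add: sqfree_monomial_eq face_prime_def)
  qed
  then have "y \<in> ?P" if "?e * y \<in> ?P" for y
    using that is_prime_face_prime[of F] by (auto simp: is_prime_def)
  moreover have "wreg (elem_syms m) UNIV (combine ?e UNIV ?P)"
  proof -
    have sub: "?P \<subseteq> facet_ideal ?G" by (auto simp: face_prime_def facet_ideal_def mideal_mono_iff)
    \<comment> \<open>Modulo \<open>?P\<close> the polynomial \<open>?e\<close> is the monomial of
      \<open>F\<close>; adjoining it leaves precisely the proper subsets of \<open>F\<close> as
      faces.\<close>
    have eq: "combine ?e UNIV ?P = facet_ideal ?G"
    proof
      have "sqfree_monomial F \<in> (facet_ideal ?G :: ('v, 'k) mpoly set)"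
        by (auto simp: facet_ideal_def sqfree_monomial_eq)
      then have "(?e - sqfree_monomial F) + sqfree_monomial F \<in> (facet_ideal ?G :: ('v, 'k) mpoly set)"
        using e sub is_idealD(2)[OF is_ideal_facet_ideal] by blast
      then have "?e \<in> facet_ideal ?G" by simp
      then show "combine ?e UNIV ?P \<subseteq> facet_ideal ?G"
        using sub is_idealD(2,4)[OF is_ideal_facet_ideal[of ?G]] unfolding combine_def by blast
      show "facet_ideal ?G \<subseteq> combine ?e UNIV ?P"
        unfolding facet_ideal_def
      proof (rule mideal_subset_ideal[OF is_ideal_combine[OF is_ideal_UNIV P]])
        fix x :: "'v \<Rightarrow>\<^sub>0 nat" assume x: "x \<in> {e. \<forall>F\<in>?G. \<not> Poly_Mapping.keys e \<subseteq> F}"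
        show "monomial x \<in> combine ?e UNIV ?P"
        proof (cases "Poly_Mapping.keys x \<subseteq> F")
          case True
          then have "F \<subseteq> Poly_Mapping.keys x" using x by blast
          then obtain a where "x = a + indicator_exponent F" using indicator_exponent_divides by blast
          then have "monomial x = ?e * monomial a + - (monomial a * (?e - sqfree_monomial F))"
            by (simp add: sqfree_monomial_eq monomial_mult algebra_simps)
          moreover have "- (monomial a * (?e - sqfree_monomial F)) \<in> ?P"
            using e P by (blast intro: is_idealD(3,5))
          ultimately show ?thesis unfolding combine_def by blast
        next
          case False
          then have "monomial x \<in> ?P" by (simp add: face_prime_def)
          moreover have "monomial x = ?e * 0 + monomial x" by simp
          ultimately show ?thesis unfolding combine_def by blast
        qed
      qed
    qed
    have "shellable ?G" by (rule shellable_ridges) auto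
    then have "wreg (elem_syms m) UNIV (facet_ideal ?G :: ('v, 'k) mpoly set)"
      using Suc by (intro wreg_shellable) auto
    then show ?thesis by (simp only: eq)
  qed
  ultimately show ?case by simp
qed simp

lemma elem_syms_max_graded_ideal:
  "set (elem_syms m) \<subseteq> (max_graded_ideal :: ('v::finite, 'k::comm_ring_1) mpoly set)"
proof (induction m)
  case (Suc m)
  have "elem_sym (Suc m) \<in> (max_graded_ideal :: ('v, 'k) mpoly set)"
    unfolding elem_sym_def max_graded_ideal_eq
  proof (rule is_ideal_sum[OF is_ideal_face_prime])
    fix S :: "'v set" assume "S \<in> {S. card S = Suc m}"
    then have "\<not> Poly_Mapping.keys (indicator_exponent S) \<subseteq> {}" by auto
    then show "sqfree_monomial S \<in> (face_prime {} :: ('v, 'k) mpoly set)"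
      unfolding sqfree_monomial_eq face_prime_def monomial_mem_mideal by blast
  qed
  then show ?case using Suc by simp
qed simp


section \<open>Filtrations of unmixed squarefree ideals\<close>

lemma module_dim_le:
  fixes M :: "(('v::finite, 'k::field) mpoly, 'b, 'n) module_scheme"
  assumes "\<And>F. F \<in> \<F> \<Longrightarrow> card F \<le> m" "facet_ideal \<F> \<subseteq> annihilator poly_ring M"
  shows "module_dim poly_ring M \<le> enat m"
  unfolding module_dim_def
proof (rule Sup_least, safe, simp only: enat_ord_simps)
  fix r and P :: "nat \<Rightarrow> ('v, 'k) mpoly set"
  assume P: "\<forall>i\<le>r. primeideal (P i) poly_ring \<and> annihilator poly_ring M \<subseteq> P i" "\<forall>i<r. P i \<subset> P (Suc i)"
  have "is_prime (P i)" if "i \<le> r" for i using P(1) that by (simp add: primeideal_iff_is_prime)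
  moreover have "facet_ideal \<F> \<subseteq> P 0" using P(1) assms(2) by blast
  ultimately show "r \<le> m" using P(2) assms(1) prime_chain_length_le[of \<F> m P r] by blast
qed

text \<open>Deleting the vertices of \<open>F\<close> one by one gives a strictly increasing chain
  of \<open>card F\<close> steps of face primes.\<close>

lemma module_dim_ge:
  fixes M :: "(('v::finite, 'k::field) mpoly, 'b, 'n) module_scheme"
  assumes "annihilator poly_ring M \<subseteq> face_prime F"
  shows "enat (card F) \<le> module_dim poly_ring M"
proof -
  obtain f where f: "bij_betw f {0..<card F} F" using ex_bij_betw_nat_finite[of F] by auto
  define P where "P i = (face_prime (F - f ` {0..<i}) :: ('v, 'k) mpoly set)" for i
  have "primeideal (P i) poly_ring" for i
    by (simp add: P_def primeideal_iff_is_prime is_prime_face_prime)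
  moreover have "annihilator poly_ring M \<subseteq> P i" for i
    using assms face_prime_mono_iff[of F "F - f ` {0..<i}", where 'k = 'k] by (auto simp: P_def)
  moreover have "P i \<subset> P (Suc i)" if "i < card F" for i
  proof -
    have "f i \<in> F" using f that by (auto simp: bij_betw_def)
    moreover have "f i \<notin> f ` {0..<i}" using f that by (auto simp: bij_betw_def dest: inj_onD)
    ultimately have "\<not> F - f ` {0..<i} \<subseteq> F - f ` {0..<Suc i}" by auto
    moreover have "F - f ` {0..<Suc i} \<subseteq> F - f ` {0..<i}" by auto
    ultimately show ?thesis unfolding P_def less_le_not_le face_prime_mono_iff by blast
  qed
  ultimately show ?thesis unfolding module_dim_def by (intro Sup_upper) blast
qed

lemma monomial_ideal_is_ideal: "monomial_ideal I \<Longrightarrow> is_ideal I"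
  by (auto simp: monomial_ideal_iff is_ideal_mideal)

lemma wreg_append: "wreg (xs @ ys) A B \<Longrightarrow> wreg xs A B"
  by (induction xs arbitrary: B) auto

lemma one_notin_facet_ideal: "F \<in> \<F> \<Longrightarrow> 1 \<notin> (facet_ideal \<F> :: ('v, 'k::comm_ring_1) mpoly set)"
  by (auto simp: facet_ideal_def mideal_def)

text \<open>In an unmixed ideal every nonzero submodule of the quotient has full dimension, so a
  filtration with strictly increasing dimensions has a single step.\<close>

lemma sequentially_cohen_macaulay_depth:
  fixes \<F> :: "'v::finite set set"
  assumes scm: "sequentially_cohen_macaulay (facet_ideal \<F> :: ('v, 'k::field) mpoly set)"
    and card: "\<And>F. F \<in> \<F> \<Longrightarrow> card F = m" and ne: "\<F> \<noteq> {}"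
  obtains xs :: "('v, 'k::field) mpoly list"
  where "length xs = m" "set xs \<subseteq> max_graded_ideal" "wreg xs UNIV (facet_ideal \<F>)"
proof -
  let ?J = "facet_ideal \<F> :: ('v, 'k) mpoly set"
  have J: "is_ideal ?J" by (rule is_ideal_facet_ideal)
  obtain r I where chain: "monomial_ideal_chain ?J r I"
    and cm: "\<And>i. i \<in> {1..r} \<Longrightarrow> cohen_macaulay (factor_module (I i) (I (i - 1)))"
    and dim: "\<And>i. i \<in> {1..<r} \<Longrightarrow> module_dim poly_ring (factor_module (I i) (I (i - 1)))
        < module_dim poly_ring (factor_module (I (i + 1)) (I i))"
    using scm unfolding sequentially_cohen_macaulay_def by blast
  have I: "I 0 = ?J" "I r = UNIV" "\<And>i. i \<le> r \<Longrightarrow> is_ideal (I i)" "\<And>i. i < r \<Longrightarrow> I i \<subset> I (Suc i)"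
    using chain monomial_ideal_is_ideal by (auto simp: monomial_ideal_chain_def)
  \<comment> \<open>An element of \<open>I 1\<close> outside \<open>?J\<close> avoids some face
    prime, which therefore contains the annihilator of the factor.\<close>
  have low: "enat m \<le> module_dim poly_ring (factor_module (I 1) (I 0))" if r1: "r \<ge> 1"
  proof -
    obtain u where u: "u \<in> I 1" "u \<notin> ?J" using I(4)[of 0] I(1) r1 by auto
    then obtain F where F: "F \<in> \<F>" "u \<notin> face_prime F" by (auto simp: facet_ideal_Inter)
    have "annihilator poly_ring (factor_module (I 1) ?J) \<subseteq> face_prime F"
    proof
      fix a assume "a \<in> annihilator poly_ring (factor_module (I 1) ?J)"
      then have "a * u \<in> ?J" using u(1) by (simp add: annihilator_factor_module J)
      then have "a * u \<in> face_prime F" using F(1) by (auto simp: facet_ideal_Inter)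
      then show "a \<in> face_prime F" using F(2) is_prime_face_prime[of F] unfolding is_prime_def by blast
    qed
    from module_dim_ge[OF this] show ?thesis using card[OF F(1)] I(1) by simp
  qed
  have up: "module_dim poly_ring (factor_module (I (Suc i)) (I i)) \<le> enat m" if "i < r" for i
  proof (rule module_dim_le[of \<F>])
    have "?J \<subseteq> I i"
      using that
    proof (induction i)
      case (Suc i)
      then show ?case using I(4)[of i] by auto
    qed (simp add: I(1))
    then show "?J \<subseteq> annihilator poly_ring (factor_module (I (Suc i)) (I i))"
      using is_idealD(4)[OF I(3)[of i]] that by (auto simp: annihilator_factor_module I(3))
  qed (simp add: card)
  have "r \<noteq> 0" using I(1,2) one_notin_facet_ideal[where 'k = 'k] ne by (metis UNIV_I all_not_in_conv)
  moreover have "\<not> 1 < r"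
  proof
    assume r: "1 < r"
    then have "module_dim poly_ring (factor_module (I 1) (I 0)) < module_dim poly_ring (factor_module (I 2) (I 1))"
      using dim[of 1] by (simp add: numeral_2_eq_2)
    with low up[of 1] r show False by (auto simp: numeral_2_eq_2)
  qed
  ultimately have r: "r = 1" by simp
  have "module_depth poly_ring max_graded_ideal (factor_module UNIV ?J) = module_dim poly_ring (factor_module UNIV ?J)"
    using cm[of 1] I(1,2) by (simp add: r cohen_macaulay_def)
  then have depth: "enat m \<le> module_depth poly_ring max_graded_ideal (factor_module UNIV ?J)"
    using low I(1,2) by (simp add: r)
  have "\<exists>ys. set ys \<subseteq> max_graded_ideal \<and> regular_sequence poly_ring (factor_module UNIV ?J) ys \<and> m \<le> length ys"
  proof (rule ccontr)
    assume n: "\<not> ?thesis"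
    \<comment> \<open>The bound \<open>m - 1\<close> used below is a contradiction only for positive
      \<open>m\<close>; for \<open>m = 0\<close> the empty sequence is long enough.\<close>
    have "m \<noteq> 0"
    proof
      assume "m = 0"
      obtain F where "F \<in> \<F>" using ne by blast
      then have "regular_sequence poly_ring (factor_module UNIV ?J) []"
        using one_notin_facet_ideal[of F \<F>, where 'k = 'k] by (simp add: regular_sequence_iff J idl_self)
      then show False using n \<open>m = 0\<close> by (metis empty_subsetI le0 list.set(1))
    qed
    have "module_depth poly_ring max_graded_ideal (factor_module UNIV ?J) \<le> enat (m - 1)"
      unfolding module_depth_def
    proof (rule Sup_least, safe, simp only: enat_ord_simps)
      fix ys assume "set ys \<subseteq> max_graded_ideal" "regular_sequence poly_ring (factor_module UNIV ?J) ys"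
      then have "length ys < m" using n by (metis not_le)
      then show "length ys \<le> m - 1" by simp
    qed
    with depth have "enat m \<le> enat (m - 1)" by (rule order_trans)
    then show False using \<open>m \<noteq> 0\<close> by simp
  qed
  then obtain ys where ys: "set ys \<subseteq> max_graded_ideal" "wreg ys UNIV ?J" "m \<le> length ys"
    by (auto simp: regular_sequence_iff J)
  show ?thesis
  proof (rule that)
    show "length (take m ys) = m" using ys(3) by simp
    show "set (take m ys) \<subseteq> max_graded_ideal" using ys(1) set_take_subset[of m ys] by blast
    show "wreg (take m ys) UNIV ?J" using wreg_append[of "take m ys" "drop m ys"] ys(2) by simp
  qed
qed

text \<open>Otherwise each face prime has an element outside \<open>p\<close>. The product of these
  elements lies in all face primes, hence in the ideal, but not in \<open>p\<close>.\<close>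

lemma prime_contains_face_prime:
  fixes p :: "('v::finite, 'k::comm_ring_1) mpoly set"
  assumes p: "is_prime p" and "facet_ideal \<F> \<subseteq> p"
  obtains F where "F \<in> \<F>" "face_prime F \<subseteq> p"
proof (rule ccontr)
  assume "\<not> thesis"
  then have "\<forall>F\<in>\<F>. \<exists>a. a \<in> face_prime F \<and> a \<notin> p" using that by blast
  then obtain a where a: "\<And>F. F \<in> \<F> \<Longrightarrow> a F \<in> face_prime F" "\<And>F. F \<in> \<F> \<Longrightarrow> a F \<notin> p" by metis
  have fin: "finite \<G>" for \<G> :: "'v set set" by simp
  have "(\<Prod>F\<in>\<F>. a F) \<in> face_prime F" if "F \<in> \<F>" for F
    using is_idealD(4)[OF is_ideal_face_prime a(1)[OF that]] that by (simp add: prod.remove[OF fin that])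
  then have "(\<Prod>F\<in>\<F>. a F) \<in> p" using assms(2) by (auto simp: facet_ideal_Inter)
  moreover have "(\<Prod>F\<in>\<G>. a F) \<notin> p" if "\<G> \<subseteq> \<F>" for \<G>
    using fin[of \<G>] that
  proof (induction \<G> rule: finite_induct)
    case (insert F \<G>)
    then show ?case using a(2)[of F] p by (auto simp: is_prime_def)
  qed (use p in \<open>simp add: is_prime_def\<close>)
  ultimately show False by blast
qed

text \<open>A multiplier \<open>s\<close> outside \<open>p i\<close> kills the part of the filtration below \<open>i\<close>, which makes \<open>p i\<close>
  the annihilator of an element of \<open>R / J\<close>; these annihilators lie in minimal primes.\<close>

lemma pretty_clean_primes:
  fixes \<F> :: "'v::finite set set" and J :: "('v, 'k::field) mpoly set"
  assumes J: "J = facet_ideal \<F>" and card: "\<And>F. F \<in> \<F> \<Longrightarrow> card F = m"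
    and I: "I 0 = J" "\<And>i. i \<le> r \<Longrightarrow> is_ideal (I i)" "\<And>i. i < r \<Longrightarrow> I i \<subseteq> I (Suc i)"
    and p: "\<And>i. i < r \<Longrightarrow> is_prime (p i)"
    and u: "\<And>i. i < r \<Longrightarrow> u i \<in> I (Suc i)" "\<And>i x. i < r \<Longrightarrow> x \<in> I (Suc i) \<Longrightarrow> \<exists>a. x - a * u i \<in> I i"
      "\<And>i a. i < r \<Longrightarrow> a * u i \<in> I i \<longleftrightarrow> a \<in> p i"
    and pretty: "\<And>i j. i < r \<Longrightarrow> j < r \<Longrightarrow> p i \<subset> p j \<Longrightarrow> j < i"
    and i: "i < r"
  shows "p i \<in> face_prime ` \<F>"
  using i
proof (induction i rule: less_induct)
  case (less i)
  have JI: "J \<subseteq> I k" if "k \<le> r" for k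
    using that
  proof (induction k)
    case (Suc k)
    then show ?case using I(3)[of k] by auto
  qed (simp add: I(1))
  have pi: "is_prime (p i)" using p less.prems by blast
  have "a \<in> p i" if "a \<in> J" for a
    using JI[of i] less.prems u(3)[OF less.prems] is_idealD(4)[OF I(2)[of i]] that by fastforce
  then have "facet_ideal \<F> \<subseteq> p i" using J by blast
  then obtain G where G: "G \<in> \<F>" "face_prime G \<subseteq> p i" using prime_contains_face_prime[OF pi] by blast
  show ?case
  proof (rule ccontr)
    assume n: "p i \<notin> face_prime ` \<F>"
    \<comment> \<open>By induction \<open>p k\<close> is a face prime, hence different from
      \<open>p i\<close>; prettiness excludes a strict inclusion because k < i.\<close>
    have "\<exists>s. s \<in> p k \<and> s \<notin> p i" if "k < i" for k
    proof -
      have "p k \<in> face_prime ` \<F>" using less.IH[OF that] that less.prems by simp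
      then have "p k \<noteq> p i" using n by metis
      moreover have "\<not> p k \<subset> p i" using pretty[of k i] that less.prems by auto
      ultimately show ?thesis by blast
    qed
    then obtain t where t: "\<And>k. k < i \<Longrightarrow> t k \<in> p k" "\<And>k. k < i \<Longrightarrow> t k \<notin> p i" by metis
    \<comment> \<open>Each \<open>t k\<close> pushes \<open>I (Suc k)\<close> down into
      \<open>I k\<close>, and the product stays outside the prime \<open>p i\<close>.\<close>
    have "k \<le> i \<Longrightarrow> \<exists>s. s \<notin> p i \<and> (\<forall>x\<in>I k. s * x \<in> J)" for k
    proof (induction k)
      case 0
      have "1 \<notin> p i" using pi by (simp add: is_prime_def)
      then show ?case using I(1) by (intro exI[of _ 1]) simp
    next
      case (Suc k)
      then obtain s where s: "s \<notin> p i" "\<And>x. x \<in> I k \<Longrightarrow> s * x \<in> J" by auto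
      have k: "k < r" "is_ideal (I k)" using Suc.prems less.prems I(2) by auto
      have "s * t k \<notin> p i" using s(1) t(2)[of k] Suc.prems pi by (auto simp: is_prime_def)
      moreover have "s * t k * x \<in> J" if x: "x \<in> I (Suc k)" for x
      proof -
        obtain a where a: "x - a * u k \<in> I k" using u(2)[OF k(1) x] by blast
        have "t k * u k \<in> I k" using u(3)[OF k(1)] t(1)[of k] Suc.prems by simp
        then have "t k * (x - a * u k) + a * (t k * u k) \<in> I k"
          using a is_idealD(3)[OF k(2)] by (intro is_idealD(2)[OF k(2)]) blast+
        then have "t k * x \<in> I k" by (simp add: algebra_simps)
        from s(2)[OF this] show ?thesis by (simp add: mult.assoc)
      qed
      ultimately show ?case by blast
    qed
    then obtain s where s: "s \<notin> p i" "\<And>x. x \<in> I i \<Longrightarrow> s * x \<in> J" by blast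
    have "s * u i \<notin> J" using s(1) u(3)[OF less.prems] JI[of i] less.prems by auto
    then obtain F where F: "F \<in> \<F>" "s * u i \<notin> face_prime F" unfolding J by (auto simp: facet_ideal_Inter)
    \<comment> \<open>\<open>p i\<close> kills the class of \<open>s * u i\<close>. So
      \<open>p i\<close> lies between \<open>face_prime G\<close> and \<open>face_prime F\<close>,
      and equal facet sizes force all three to agree.\<close>
    have "p i \<subseteq> face_prime F"
    proof
      fix q assume "q \<in> p i"
      then have "s * (q * u i) \<in> J" using s(2) u(3)[OF less.prems] by blast
      then have "q * (s * u i) \<in> face_prime F" using F(1) unfolding J by (auto simp: facet_ideal_Inter algebra_simps)
      then show "q \<in> face_prime F" using F(2) is_prime_face_prime[of F] unfolding is_prime_def by blast
    qed
    moreover from this have "F \<subseteq> G" using G(2) face_prime_mono_iff[where 'k = 'k] by blast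
    then have "F = G" using card F(1) G(1) by (metis card_subset_eq finite)
    ultimately have "p i = face_prime F" using G(2) by blast
    then show False using n F(1) by blast
  qed
qed

text \<open>R / J is itself Cohen-Macaulay, its depth and dimension both being \<open>m\<close>, so
  the chain with the single step from J to R serves.\<close>

lemma pretty_clean_sequentially_cohen_macaulay:
  fixes \<F> :: "'v::finite set set"
  assumes pc: "pretty_clean (facet_ideal \<F> :: ('v, 'k::field) mpoly set)"
    and card: "\<And>F. F \<in> \<F> \<Longrightarrow> card F = m"
  shows "sequentially_cohen_macaulay (facet_ideal \<F> :: ('v, 'k) mpoly set)"
proof (cases "\<F> = {}")
  case True
  \<comment> \<open>Without facets the ideal is the whole ring, and the chain of length 0
    serves.\<close>
  have "monomial_ideal (UNIV :: ('v, 'k) mpoly set)" using monomial_ideal_facet_ideal[of "{}"] by simp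
  then have "monomial_ideal_chain (UNIV :: ('v, 'k) mpoly set) 0 (\<lambda>_. UNIV)" by (simp add: monomial_ideal_chain_def)
  then show ?thesis unfolding True facet_ideal_empty sequentially_cohen_macaulay_def
    by (intro exI[of _ 0] exI[of _ "\<lambda>_. UNIV"]) simp
next
  case False
  then obtain F where F: "F \<in> \<F>" by blast
  let ?J = "facet_ideal \<F> :: ('v, 'k) mpoly set"
  let ?M = "factor_module UNIV ?J"
  have J: "is_ideal ?J" by (rule is_ideal_facet_ideal)
  obtain r I p where fil: "monomial_prime_filtration ?J r I p"
    and pretty: "\<And>i j. i \<in> {1..r} \<Longrightarrow> j \<in> {1..r} \<Longrightarrow> p i \<subset> p j \<Longrightarrow> j < i"
    using pc unfolding pretty_clean_def by blast
  have I: "I 0 = ?J" "I r = UNIV" "\<And>i. i \<le> r \<Longrightarrow> is_ideal (I i)" "\<And>i. i < r \<Longrightarrow> I i \<subseteq> I (Suc i)"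
    using fil monomial_ideal_is_ideal by (auto simp: monomial_prime_filtration_def monomial_ideal_chain_def)
  have p: "is_prime (p (Suc i))"
    and iso: "module_isomorphic poly_ring (factor_module (I (Suc i)) (I i)) (factor_module UNIV (p (Suc i)))"
    if "i < r" for i
  proof -
    have "Suc i \<in> {1..r}" using that by simp
    then have "primeideal (p (Suc i)) poly_ring \<and> monomial_ideal (p (Suc i)) \<and>
        module_isomorphic poly_ring (factor_module (I (Suc i)) (I (Suc i - 1))) (factor_module UNIV (p (Suc i)))"
      using fil unfolding monomial_prime_filtration_def by blast
    then show "is_prime (p (Suc i))"
      "module_isomorphic poly_ring (factor_module (I (Suc i)) (I i)) (factor_module UNIV (p (Suc i)))"
      by (simp_all add: primeideal_iff_is_prime)
  qed
  have "\<exists>u. u \<in> I (Suc i) \<and> (\<forall>x\<in>I (Suc i). \<exists>a. x - a * u \<in> I i) \<and> (\<forall>a. a * u \<in> I i \<longleftrightarrow> a \<in> p (Suc i))"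
    if "i < r" for i
  proof -
    have "is_ideal (p (Suc i))" using p[OF that] by (simp add: is_prime_def)
    from module_isomorphic_cyclicD[OF I(3)[of i] I(3)[of "Suc i"] this I(4)[OF that] iso[OF that]] that
    show ?thesis by (metis Suc_leI less_imp_le)
  qed
  then obtain u where u: "\<And>i. i < r \<Longrightarrow> u i \<in> I (Suc i)"
    "\<And>i x. i < r \<Longrightarrow> x \<in> I (Suc i) \<Longrightarrow> \<exists>a. x - a * u i \<in> I i"
    "\<And>i a. i < r \<Longrightarrow> a * u i \<in> I i \<longleftrightarrow> a \<in> p (Suc i)" by metis
  have pF: "p (Suc i) \<in> face_prime ` \<F>" if "i < r" for i
  proof (rule pretty_clean_primes[where p = "\<lambda>i. p (Suc i)" and I = I and u = u and r = r, OF refl card I(1,3,4) p u _ that])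
    show "j < i" if "i < r" "j < r" "p (Suc i) \<subset> p (Suc j)" for i j
      using pretty[of "Suc i" "Suc j"] that by simp
  qed
  \<comment> \<open>Downward induction from \<open>I r = UNIV\<close>: each step adds a factor R / P
    F, on which the sequence is regular.\<close>
  have reg: "wreg (elem_syms m) UNIV (I i)" if "i \<le> r" for i
    using that
  proof (induction rule: inc_induct)
    case (step i)
    have "wreg (elem_syms m) UNIV (p (Suc i))" using pF[OF step.hyps(2)] wreg_elem_syms[OF card] by auto
    with step show ?case
      by (intro wreg_cyclic_extension[OF I(3)[of i] I(3)[of "Suc i"] I(4)[of i] u(1)[of i] u(2)[of i] u(3)[of i]]) auto
  qed (simp add: I(2))
  have JF: "?J \<subseteq> face_prime F" using F by (auto simp: facet_ideal_Inter)
  have "?J \<subseteq> max_graded_ideal"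
    using JF face_prime_mono_iff[of F "{}", where 'k = 'k] by (auto simp: max_graded_ideal_eq)
  then have "idl (set (elem_syms m) \<union> ?J) \<subseteq> max_graded_ideal"
    using elem_syms_max_graded_ideal by (intro idl_minimal) (auto simp: max_graded_ideal_eq is_ideal_face_prime)
  moreover have "1 \<notin> (max_graded_ideal :: ('v, 'k) mpoly set)"
    by (simp add: max_graded_ideal_eq face_prime_def mideal_def)
  ultimately have rs: "regular_sequence poly_ring ?M (elem_syms m)"
    using reg[of 0] I(1) by (auto simp: regular_sequence_iff J)
  have "module_depth poly_ring max_graded_ideal ?M = enat m"
    unfolding module_depth_def
  proof (rule antisym)
    show "Sup {enat (length xs) |xs. set xs \<subseteq> max_graded_ideal \<and> regular_sequence poly_ring ?M xs} \<le> enat m"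
    proof (rule Sup_least, safe, simp only: enat_ord_simps)
      fix xs assume "regular_sequence poly_ring ?M xs"
      then show "length xs \<le> m" using regular_sequence_length_le[of \<F> m xs] card by simp
    qed
    have "enat (length (elem_syms m :: ('v, 'k) mpoly list)) \<le>
        Sup {enat (length xs) |xs. set xs \<subseteq> max_graded_ideal \<and> regular_sequence poly_ring ?M xs}"
      using rs elem_syms_max_graded_ideal by (intro Sup_upper) blast
    then show "enat m \<le> Sup {enat (length xs) |xs. set xs \<subseteq> max_graded_ideal \<and> regular_sequence poly_ring ?M xs}"
      by simp
  qed
  moreover have ann: "annihilator poly_ring ?M = ?J"
    using is_idealD(4)[OF J] by (auto simp: annihilator_factor_module J) (metis mult.right_neutral)
  have "module_dim poly_ring ?M = enat m"
    using module_dim_le[of \<F> m ?M] module_dim_ge[of ?M F] card[OF F] card JF ann by (auto intro: antisym)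
  moreover have "coset ?J 1 \<noteq> ?J" using one_notin_facet_ideal[OF F] by (simp add: coset_eq_self_iff J)
  then have "carrier ?M \<noteq> {\<zero>\<^bsub>?M\<^esub>}" by (auto simp: factor_module_carrier factor_module_zero)
  ultimately have cm: "cohen_macaulay ?M" by (simp add: cohen_macaulay_def)
  define I' where "I' i = (if i = 0 then ?J else UNIV)" for i :: nat
  have "monomial_ideal_chain ?J 1 I'"
    using monomial_ideal_facet_ideal[of \<F>] monomial_ideal_facet_ideal[of "{}"] one_notin_facet_ideal[OF F]
    by (auto simp: monomial_ideal_chain_def I'_def)
  moreover have "cohen_macaulay (factor_module (I' i) (I' (i - 1)))" if "i \<in> {1..1}" for i
    using that cm by (simp add: I'_def)
  ultimately show ?thesis unfolding sequentially_cohen_macaulay_def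
    by (intro exI[of _ 1] exI[of _ I']) simp
qed


section \<open>Complexes on five vertices\<close>

text \<open>Chordal graphs have a simplicial vertex: here \<open>adj\<close> is the adjacency of the complement of a
  graph on five vertices, \<open>C4\<close> and \<open>C5\<close> exclude the long induced cycles, and \<open>W\<close> is the vertex set
  of an induced subgraph. This is decided propositionally.\<close>

lemma simplicial_vertex_5:
  fixes adj :: "'v \<Rightarrow> 'v \<Rightarrow> bool"
  assumes sym: "\<And>x y. adj x y \<longleftrightarrow> adj y x" and V: "distinct [a, b, c, d, e]" "W \<subseteq> {a, b, c, d, e}" "W \<noteq> {}"
    and C4: "\<And>p q r s. distinct [p, q, r, s] \<Longrightarrow>
      adj p q \<longrightarrow> adj r s \<longrightarrow> adj p r \<or> adj p s \<or> adj q r \<or> adj q s"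
    and C5: "\<And>p q r s t. distinct [p, q, r, s, t] \<Longrightarrow> adj p q \<longrightarrow> adj q r \<longrightarrow> adj r s \<longrightarrow> adj s t \<longrightarrow>
      adj t p \<longrightarrow> adj p r \<or> adj q s \<or> adj r t \<or> adj s p \<or> adj t q"
  shows "\<exists>v\<in>W. \<forall>p\<in>W - {v}. \<forall>q\<in>W - {v}. p \<noteq> q \<longrightarrow> adj p q \<longrightarrow> adj v p \<or> adj v q"
proof -
  \<comment> \<open>The 15 pairs of disjoint edges on five vertices. Two such edges of
    \<open>adj\<close> with no \<open>adj\<close> edge between them form an induced 4-cycle of the
    complement.\<close>
  have D4: "distinct [a, b, c, d]" "distinct [a, c, b, d]" "distinct [a, d, b, c]"
    "distinct [a, b, c, e]" "distinct [a, c, b, e]" "distinct [a, e, b, c]"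
    "distinct [a, b, d, e]" "distinct [a, d, b, e]" "distinct [a, e, b, d]"
    "distinct [a, c, d, e]" "distinct [a, d, c, e]" "distinct [a, e, c, d]"
    "distinct [b, c, d, e]" "distinct [b, d, c, e]" "distinct [b, e, c, d]"
    using V(1) by auto
  \<comment> \<open>The 12 pentagons on five vertices. A pentagon is self-complementary, so
    \<open>C5\<close> may speak of \<open>adj\<close> instead of its complement.\<close>
  have D5: "distinct [a, b, c, d, e]" "distinct [a, b, c, e, d]" "distinct [a, b, d, c, e]"
    "distinct [a, b, d, e, c]" "distinct [a, b, e, c, d]" "distinct [a, b, e, d, c]"
    "distinct [a, c, b, d, e]" "distinct [a, c, b, e, d]" "distinct [a, c, d, b, e]"
    "distinct [a, c, e, b, d]" "distinct [a, d, b, c, e]" "distinct [a, d, c, b, e]"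
    using V(1) by auto
  have simplicial: "v \<in> W \<longrightarrow> (p \<in> W \<longrightarrow> q \<in> W \<longrightarrow> adj p q \<longrightarrow> adj v p \<or> adj v q) \<longrightarrow>
      (p \<in> W \<longrightarrow> r \<in> W \<longrightarrow> adj p r \<longrightarrow> adj v p \<or> adj v r) \<longrightarrow>
      (p \<in> W \<longrightarrow> s \<in> W \<longrightarrow> adj p s \<longrightarrow> adj v p \<or> adj v s) \<longrightarrow>
      (q \<in> W \<longrightarrow> r \<in> W \<longrightarrow> adj q r \<longrightarrow> adj v q \<or> adj v r) \<longrightarrow>
      (q \<in> W \<longrightarrow> s \<in> W \<longrightarrow> adj q s \<longrightarrow> adj v q \<or> adj v s) \<longrightarrow>
      (r \<in> W \<longrightarrow> s \<in> W \<longrightarrow> adj r s \<longrightarrow> adj v r \<or> adj v s) \<longrightarrow> ?thesis"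
    if W: "W \<subseteq> {v, p, q, r, s}" for v p q r s
  proof (intro impI bexI[of _ v] ballI)
    fix x y
    assume xy: "x \<in> W - {v}" "y \<in> W - {v}" "x \<noteq> y" "adj x y"
    then have "x = p \<or> x = q \<or> x = r \<or> x = s" "y = p \<or> y = q \<or> y = r \<or> y = s" using W by auto
    moreover have "x \<in> W" "y \<in> W" "adj y x" using xy sym by auto
    moreover assume "p \<in> W \<longrightarrow> q \<in> W \<longrightarrow> adj p q \<longrightarrow> adj v p \<or> adj v q"
      "p \<in> W \<longrightarrow> r \<in> W \<longrightarrow> adj p r \<longrightarrow> adj v p \<or> adj v r"
      "p \<in> W \<longrightarrow> s \<in> W \<longrightarrow> adj p s \<longrightarrow> adj v p \<or> adj v s"
      "q \<in> W \<longrightarrow> r \<in> W \<longrightarrow> adj q r \<longrightarrow> adj v q \<or> adj v r"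
      "q \<in> W \<longrightarrow> s \<in> W \<longrightarrow> adj q s \<longrightarrow> adj v q \<or> adj v s"
      "r \<in> W \<longrightarrow> s \<in> W \<longrightarrow> adj r s \<longrightarrow> adj v r \<or> adj v s"
    ultimately show "adj v x \<or> adj v y"
      using xy(3,4) by (elim disjE; simp add: disj_commute)
  qed
  have "W \<subseteq> {a, b, c, d, e}" "W \<subseteq> {b, a, c, d, e}" "W \<subseteq> {c, a, b, d, e}" "W \<subseteq> {d, a, b, c, e}"
    "W \<subseteq> {e, a, b, c, d}" by (rule subset_trans[OF V(2)], blast)+
  note S = this[THEN simplicial]
  have "a \<in> W \<or> b \<in> W \<or> c \<in> W \<or> d \<in> W \<or> e \<in> W" using V(2,3) by blast
  then show ?thesis
    using S D4[THEN C4] D5[THEN C5] sym[of a b] sym[of a c] sym[of a d] sym[of a e] sym[of b c]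
      sym[of b d] sym[of b e] sym[of c d] sym[of c e] sym[of d e]
    by argo
qed

text \<open>The facets \<open>- {x, y}\<close> for the edges \<open>x y\<close> within \<open>W\<close> are shelled along a perfect elimination
  order of the complementary graph, starting with the edges at a simplicial vertex \<open>v\<close>.\<close>

lemma shellable_star_union:
  fixes adj :: "'v::finite \<Rightarrow> 'v \<Rightarrow> bool"
  assumes "shellable \<G>" and v: "v \<in> W"
    and simplicial: "\<And>p q. p \<in> W - {v} \<Longrightarrow> q \<in> W - {v} \<Longrightarrow> p \<noteq> q \<Longrightarrow> adj p q \<Longrightarrow> adj v p \<or> adj v q"
    and "\<G> \<subseteq> {- {x, y} | x y. x \<in> W - {v} \<and> y \<in> W - {v} \<and> x \<noteq> y \<and> adj x y}"
  shows "shellable (\<G> \<union> {- {v, w} | w. w \<in> W - {v} \<and> adj v w})" (is "shellable (_ \<union> ?S)")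
  using assms(1,4)
proof (induction rule: shellable.induct)
  case empty
  show ?case
    unfolding Un_empty_left
  proof (rule shellable_ridges)
    fix F G assume "F \<in> ?S" "G \<in> ?S" "F \<noteq> G"
    then obtain w x where *: "F = - {v, w}" "G = - {v, x}" "w \<noteq> v" "x \<noteq> v" "w \<noteq> x" by auto
    then show "\<exists>v\<in>F - G. F \<inter> G = F - {v}" by (intro bexI[of _ x]) auto
  qed
next
  case (insert \<G> F)
  obtain p q where F: "F = - {p, q}" "p \<in> W - {v}" "q \<in> W - {v}" "p \<noteq> q" "adj p q"
    using insert.prems by blast
  \<comment> \<open>The star comes first in the shelling. A later facet \<open>F\<close> contains
    \<open>v\<close>, which all star facets omit, and simpliciality provides a star facet that meets
    \<open>F\<close> in \<open>F - {v}\<close>.\<close>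
  have star: "\<exists>H\<in>?S. \<exists>x\<in>F - - {v, w}. F \<inter> H = F - {x}" for w
    using simplicial[OF F(2-5)]
  proof
    assume "adj v p"
    then show ?thesis using F by (intro bexI[of _ "- {v, p}"] bexI[of _ v]) auto
  next
    assume "adj v q"
    then show ?thesis using F by (intro bexI[of _ "- {v, q}"] bexI[of _ v]) auto
  qed
  have "shellable (insert F (\<G> \<union> ?S))"
  proof (rule shellable.insert)
    show "shellable (\<G> \<union> ?S)" using insert by blast
    show "\<exists>H\<in>\<G> \<union> ?S. \<exists>x\<in>F - G. F \<inter> H = F - {x}" if G: "G \<in> \<G> \<union> ?S" for G
    proof (cases "G \<in> \<G>")
      case True
      from insert.hyps(2)[OF this] show ?thesis by blast
    next
      case False
      then obtain w where "G = - {v, w}" using G by blast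
      with star[of w] show ?thesis by blast
    qed
  qed
  then show ?case by simp
qed

lemma shellable_chordal:
  fixes adj :: "'v::finite \<Rightarrow> 'v \<Rightarrow> bool"
  assumes sym: "\<And>x y. adj x y \<longleftrightarrow> adj y x"
    and ex: "\<And>W. W \<noteq> {} \<Longrightarrow> \<exists>v\<in>W. \<forall>p\<in>W - {v}. \<forall>q\<in>W - {v}. p \<noteq> q \<longrightarrow> adj p q \<longrightarrow> adj v p \<or> adj v q"
  shows "shellable {- {x, y} | x y. x \<in> W \<and> y \<in> W \<and> x \<noteq> y \<and> adj x y}" (is "shellable (?E W)")
proof -
  have "finite W" by simp
  then show ?thesis
  proof (induction W rule: finite_psubset_induct)
    case (psubset W)
    show ?case
    proof (cases "W = {}")
      case True
      then show ?thesis using shellable.empty by simp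
    next
      case False
      then obtain v where v: "v \<in> W" "\<And>p q. p \<in> W - {v} \<Longrightarrow> q \<in> W - {v} \<Longrightarrow> p \<noteq> q \<Longrightarrow> adj p q \<Longrightarrow> adj v p \<or> adj v q"
        using ex by meson
      have "shellable (?E (W - {v}))" using v(1) by (intro psubset.IH) auto
      from shellable_star_union[where W = W and v = v and adj = adj, OF this v order.refl]
      have "shellable (?E (W - {v}) \<union> {- {v, w} | w. w \<in> W - {v} \<and> adj v w})" .
      moreover have "?E W = ?E (W - {v}) \<union> {- {v, w} | w. w \<in> W - {v} \<and> adj v w}"
      proof (intro equalityI subsetI)
        fix F assume "F \<in> ?E W"
        then obtain x y where xy: "F = - {x, y}" "x \<in> W" "y \<in> W" "x \<noteq> y" "adj x y" by blast
        consider "x = v" | "y = v" | "x \<noteq> v" "y \<noteq> v" by blast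
        then show "F \<in> ?E (W - {v}) \<union> {- {v, w} | w. w \<in> W - {v} \<and> adj v w}"
        proof cases
          case 2
          then have "F = - {v, x}" "adj v x" using xy sym by auto
          then show ?thesis using xy 2 by blast
        qed (use xy in blast)+
      qed (use v(1) in blast)
      ultimately show ?thesis by simp
    qed
  qed
qed

text \<open>An edge that meets the vertex set of a shellable subgraph can be appended to its
  shelling, so a maximal shellable subgraph absorbs everything connected to it.\<close>

lemma shellable_connected_graph:
  fixes \<F> :: "'v::finite set set"
  assumes card: "\<And>F. F \<in> \<F> \<Longrightarrow> card F = 2"
    and conn: "\<And>A F G. (\<And>H. H \<in> \<F> \<Longrightarrow> H \<subseteq> A \<or> H \<inter> A = {}) \<Longrightarrow> F \<in> \<F> \<Longrightarrow> F \<inter> A \<noteq> {} \<Longrightarrow> G \<in> \<F> \<Longrightarrow> G \<subseteq> A"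
  shows "shellable \<F>"
proof (cases "\<F> = {}")
  case True
  then show ?thesis using shellable.empty by simp
next
  case False
  then obtain F0 where F0: "F0 \<in> \<F>" by blast
  have "shellable {F0}" by (rule shellable.insert[OF shellable.empty]) simp
  then have "{F0} \<in> {\<S>. \<S> \<subseteq> \<F> \<and> shellable \<S>}" using F0 by simp
  moreover have "finite {\<S>. \<S> \<subseteq> \<F> \<and> shellable \<S>}" by simp
  ultimately obtain \<S> where S: "\<S> \<subseteq> \<F>" "shellable \<S>" "{F0} \<subseteq> \<S>"
    and max: "\<And>\<S>'. \<S>' \<subseteq> \<F> \<Longrightarrow> shellable \<S>' \<Longrightarrow> \<S> \<subseteq> \<S>' \<Longrightarrow> \<S> = \<S>'"
    using finite_has_maximal2[of "{\<S>. \<S> \<subseteq> \<F> \<and> shellable \<S>}" "{F0}"] by auto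
  have disj: "F \<inter> \<Union>\<S> = {}" if F: "F \<in> \<F>" "F \<notin> \<S>" for F
  proof (rule ccontr)
    assume meet: "F \<inter> \<Union>\<S> \<noteq> {}"
    have ridge: "F \<inter> H = F - {x}" if "H \<in> \<S>" "F = {x, y}" "y \<in> H" for H x y
    proof -
      have "\<not> F \<subseteq> H" using card_subset_eq[of H F] that(1) F card S(1) by auto
      then show ?thesis using that by auto
    qed
    have "\<exists>H\<in>\<S>. \<exists>v\<in>F - G. F \<inter> H = F - {v}" if G: "G \<in> \<S>" for G
    proof -
      have "\<not> F \<subseteq> G" using card_subset_eq[of G F] G F card S(1) by auto
      then obtain x where x: "x \<in> F" "x \<notin> G" by blast
      obtain y where y: "F = {x, y}" "x \<noteq> y" using card[OF F(1)] x(1) by (auto simp: card_2_iff)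
      show ?thesis
      \<comment> \<open>If \<open>y\<close> is not covered, then \<open>x\<close> is, and
        \<open>y\<close> lies outside \<open>G\<close>; the two ends swap roles.\<close>
      proof (cases "y \<in> \<Union>\<S>")
        case True
        then obtain H where "H \<in> \<S>" "y \<in> H" by blast
        then show ?thesis using ridge[OF _ y(1)] x by blast
      next
        case False
        then obtain H where H: "H \<in> \<S>" "x \<in> H" using meet y(1) by blast
        have "F = {y, x}" using y(1) by blast
        from ridge[OF H(1) this H(2)] H(1) show ?thesis using y False G by blast
      qed
    qed
    from shellable.insert[OF S(2) this] have "\<S> = insert F \<S>" using F S(1) by (intro max) auto
    then show False using F(2) by blast
  qed
  have "\<F> \<subseteq> \<S>"
  proof
    fix F assume F: "F \<in> \<F>"
    have "F \<subseteq> \<Union>\<S>"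
    proof (rule conn[OF _ F0 _ F])
      show "H \<subseteq> \<Union>\<S> \<or> H \<inter> \<Union>\<S> = {}" if "H \<in> \<F>" for H using disj[OF that] by blast
      have "F0 \<noteq> {}" using card[OF F0] by auto
      then show "F0 \<inter> \<Union>\<S> \<noteq> {}" using S(3) by blast
    qed
    moreover have "F \<noteq> {}" using card[OF F] by auto
    ultimately show "F \<in> \<S>" using disj[OF F] by blast
  qed
  then show ?thesis using S(1,2) by (metis subset_antisym)
qed


section \<open>Cohomological obstructions to depth three on five vertices\<close>

context
  fixes f g h :: "('v::finite, 'k::field) mpoly" and \<F> :: "'v set set" and adj :: "'v \<Rightarrow> 'v \<Rightarrow> bool"
  assumes fgh: "f \<in> max_graded_ideal" "g \<in> max_graded_ideal" "h \<in> max_graded_ideal"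
    "wreg [f, g, h] UNIV (facet_ideal \<F>)"
    and adj_def: "\<And>x y. adj x y \<longleftrightarrow> - {x, y} \<in> \<F>"
    and edges: "\<And>F. F \<in> \<F> \<Longrightarrow> \<exists>x y. x \<noteq> y \<and> F = - {x, y}"
begin

text \<open>The only facets through \<open>e\<close> would be {p, q, e} and {r, s, e}, so the link
  of \<open>e\<close> falls into two segments. If no facet joins the segments,
  \<open>depth_3_link\<close> applies. Otherwise the connection closes a loop through
  \<open>e\<close> that carries a nontrivial 1-cocycle.\<close>

lemma no_induced_C4:
  assumes V: "UNIV = {p, q, r, s, e}" and dist: "distinct [p, q, r, s, e]"
    and pq: "adj p q" and rs: "adj r s"
  shows "adj p r \<or> adj p s \<or> adj q r \<or> adj q s"
proof (rule ccontr)
  assume n: "\<not> ?thesis"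
  have neq: "p \<noteq> q" "p \<noteq> r" "p \<noteq> s" "p \<noteq> e" "q \<noteq> r" "q \<noteq> s" "q \<noteq> e" "r \<noteq> s" "r \<noteq> e" "s \<noteq> e" using dist by auto
  have F1: "- {p, q} \<in> \<F>" "r \<in> - {p, q}" "s \<in> - {p, q}" "e \<in> - {p, q}" using pq adj_def neq by auto
  have F2: "- {r, s} \<in> \<F>" "p \<in> - {r, s}" "q \<in> - {r, s}" "e \<in> - {r, s}" using rs adj_def neq by auto
  have nadj: "\<not> adj p r" "\<not> adj p s" "\<not> adj q r" "\<not> adj q s" "\<not> adj r p" "\<not> adj s p" "\<not> adj r q" "\<not> adj s q"
    using n unfolding adj_def by (simp_all add: insert_commute)
  have link: "F - {e} \<subseteq> {p, q} \<or> F \<inter> {p, q} = {}" if F: "F \<in> \<F>" "e \<in> F" for F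
  proof -
    obtain x y where xy: "x \<noteq> y" "F = - {x, y}" using edges[OF F(1)] by blast
    have "adj x y" using F(1) xy(2) by (simp add: adj_def)
    moreover have "x \<in> {p, q, r, s, e}" "y \<in> {p, q, r, s, e}" using V by blast+
    then have "x \<in> {p, q, r, s}" "y \<in> {p, q, r, s}" using F(2) xy(2) by blast+
    ultimately have "{x, y} = {p, q} \<or> {x, y} = {r, s}"
      using xy(1) by (elim insertE emptyE) (simp_all add: nadj insert_commute)
    then show ?thesis using xy(2) V by auto
  qed
  show False
  proof (cases "\<exists>F\<in>\<F>. \<exists>x\<in>{p, q}. \<exists>y\<in>{r, s}. x \<in> F \<and> y \<in> F")
    case True
    then obtain F x y where F: "F \<in> \<F>" "x \<in> F" "y \<in> F" and xy: "x \<in> {p, q}" "y \<in> {r, s}" by blast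
    \<comment> \<open>\<open>k i j - k j i\<close> counts passages from {p, q} to \<open>e\<close>.
      It is a cocycle since the vertices other than \<open>e\<close> of a facet through
      \<open>e\<close> are all in {p, q} or all outside.\<close>
    define k where "k i j = (if i \<in> {p, q} \<and> j = e then 1 else 0 :: 'k)" for i j
    have "\<exists>t. \<forall>F\<in>\<F>. \<forall>i\<in>F. \<forall>j\<in>F. i \<noteq> j \<longrightarrow> k i j - k j i = t j - t i"
    proof (rule depth_3_cocycle[OF fgh])
      fix F i j l assume F: "F \<in> \<F>" "i \<in> F" "j \<in> F" "l \<in> F"
      show "k i j - k j i - (k l j - k j l) + (k l i - k i l) = 0"
      proof (cases "e \<in> F")
        case True
        then have "F - {e} \<subseteq> {p, q} \<or> F \<inter> {p, q} = {}" using link F(1) by blast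
        then have "(\<forall>x\<in>F. x \<in> {p, q} \<longleftrightarrow> x \<noteq> e) \<or> (\<forall>x\<in>F. x \<notin> {p, q})" using neq by blast
        then show ?thesis
        proof
          assume "\<forall>x\<in>F. x \<in> {p, q} \<longleftrightarrow> x \<noteq> e"
          then have "k a b = (if a \<noteq> e \<and> b = e then 1 else 0)" if "a \<in> F" for a b
            using that unfolding k_def by presburger
          then show ?thesis using F(2-4) by simp
        next
          assume "\<forall>x\<in>F. x \<notin> {p, q}"
          then have "k a b = 0" if "a \<in> F" for a b using that unfolding k_def by presburger
          then show ?thesis using F(2-4) by simp
        qed
      next
        case False
        then have "k a b = 0" if "b \<in> F" for a b using that by (auto simp: k_def)
        then show ?thesis using F(2-4) by simp
      qed
    qed
    then obtain t where t: "\<And>F i j. F \<in> \<F> \<Longrightarrow> i \<in> F \<Longrightarrow> j \<in> F \<Longrightarrow> i \<noteq> j \<Longrightarrow> k i j - k j i = t j - t i" by blast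
    have "1 = t e - t x"
      using t[OF F2(1), of x e] F2 xy neq by (auto simp: k_def split: if_splits)
    moreover have "0 = t e - t y"
      using t[OF F1(1), of y e] F1 xy neq by (auto simp: k_def split: if_splits)
    moreover have "0 = t y - t x"
      using t[OF F] xy neq by (auto simp: k_def split: if_splits)
    ultimately show False by simp
  next
    case False
    have "r \<in> {p, q}"
    proof (rule depth_3_link[OF fgh, where e = e and F = "- {r, s}" and a = p and G = "- {p, q}"])
      show "F - {e} \<subseteq> {p, q} \<or> F \<inter> {p, q} = {}" if "F \<in> \<F>" for F
        using False that V by blast
    qed (use F1 F2 neq in auto)
    then show False using neq by auto
  qed
qed

text \<open>The facets would be the five triples of cyclically consecutive vertices. They form a
  Moebius strip, whose first cohomology is nonzero over every field.\<close>

lemma no_induced_C5: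
  assumes V: "UNIV = {p, q, r, s, t}" and dist: "distinct [p, q, r, s, t]"
    and cyc: "adj p q" "adj q r" "adj r s" "adj s t" "adj t p"
  shows "adj p r \<or> adj q s \<or> adj r t \<or> adj s p \<or> adj t q"
proof (rule ccontr)
  assume n: "\<not> ?thesis"
  have neq: "p \<noteq> q" "p \<noteq> r" "p \<noteq> s" "p \<noteq> t" "q \<noteq> r" "q \<noteq> s" "q \<noteq> t" "r \<noteq> s" "r \<noteq> t" "s \<noteq> t" using dist by auto
  \<comment> \<open>Marks the edges that cross the cut between \<open>t\<close> and \<open>p\<close>
    in the cyclic order; summed along a closed path, \<open>k i j - k j i\<close> gives the winding
    number.\<close>
  define k where "k i j = (if i = t \<and> j = p \<or> i = s \<and> j = p \<or> i = t \<and> j = q then 1 else 0 :: 'k)" for i j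
  have nadj: "\<not> adj p r" "\<not> adj q s" "\<not> adj r t" "\<not> adj s p" "\<not> adj t q"
    "\<not> adj r p" "\<not> adj s q" "\<not> adj t r" "\<not> adj p s" "\<not> adj q t"
    using n unfolding adj_def by (simp_all add: insert_commute)
  have "\<exists>c. \<forall>F\<in>\<F>. \<forall>i\<in>F. \<forall>j\<in>F. i \<noteq> j \<longrightarrow> k i j - k j i = c j - c i"
  proof (rule depth_3_cocycle[OF fgh])
    fix F i j l assume F: "F \<in> \<F>" "i \<in> F" "j \<in> F" "l \<in> F"
    obtain x y where xy: "x \<noteq> y" "F = - {x, y}" using edges[OF F(1)] by blast
    have "adj x y" using F(1) xy(2) by (simp add: adj_def)
    moreover have "x \<in> {p, q, r, s, t}" "y \<in> {p, q, r, s, t}" using V by blast+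
    ultimately have "{x, y} = {p, q} \<or> {x, y} = {q, r} \<or> {x, y} = {r, s} \<or> {x, y} = {s, t} \<or> {x, y} = {t, p}"
      using xy(1) by (elim insertE emptyE) (simp_all add: nadj insert_commute)
    then have "F = {r, s, t} \<or> F = {s, t, p} \<or> F = {t, p, q} \<or> F = {p, q, r} \<or> F = {q, r, s}"
      unfolding xy(2) Compl_eq_Diff_UNIV V using neq by (elim disjE) auto
    then show "k i j - k j i - (k l j - k j l) + (k l i - k i l) = 0"
      using F(2-4) neq neq[symmetric] by (elim disjE) (auto simp: k_def)
  qed
  then obtain c where c: "\<And>F i j. F \<in> \<F> \<Longrightarrow> i \<in> F \<Longrightarrow> j \<in> F \<Longrightarrow> i \<noteq> j \<Longrightarrow> k i j - k j i = c j - c i" by blast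
  have F: "- {p, q} \<in> \<F>" "- {q, r} \<in> \<F>" "- {r, s} \<in> \<F>" "- {s, t} \<in> \<F>"
    using cyc by (auto simp: adj_def)
  note neq' = neq neq[symmetric]
  \<comment> \<open>The path p, q, r, s, t, p winds around once, so its values add up to 1.\<close>
  have "0 = c q - c p" using c[OF F(4), of p q] neq' by (simp add: k_def)
  moreover have "0 = c r - c q" using c[OF F(4), of q r] neq' by (simp add: k_def)
  moreover have "0 = c s - c r" using c[OF F(1), of r s] neq' by (simp add: k_def)
  moreover have "0 = c t - c s" using c[OF F(1), of s t] neq' by (simp add: k_def)
  moreover have "1 = c p - c t" using c[OF F(2), of t p] neq' by (simp add: k_def)
  ultimately show False by simp
qed

end

lemma card_complement: "card (- F :: 'v::finite set) = CARD('v) - card F"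
  by (simp add: Compl_eq_Diff_UNIV card_Diff_subset)

lemma shellable_of_depth:
  fixes \<F> :: "'v::finite set set" and xs :: "('v, 'k::field) mpoly list"
  assumes n: "CARD('v) = 5" and m: "m \<le> 4" and card: "\<And>F. F \<in> \<F> \<Longrightarrow> card F = m"
    and xs: "length xs = m" "set xs \<subseteq> max_graded_ideal" "wreg xs UNIV (facet_ideal \<F>)"
  shows "shellable \<F>"
proof -
  have cardC: "card (- F) = 5 - m" if "F \<in> \<F>" for F
    using card_complement[of F] card[OF that] n by simp
  consider "m = 0" | "m = 1" | "m = 2" | "m = 3" | "m = 4" using m by linarith
  then show ?thesis
  proof cases
    case 1
    then show ?thesis using card by (intro shellable_ridges) auto
  next
    case 2
    show ?thesis
    proof (rule shellable_ridges)
      fix F G assume "F \<in> \<F>" "G \<in> \<F>" "F \<noteq> G"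
      moreover obtain a b where "F = {a}" "G = {b}"
        using card[OF \<open>F \<in> \<F>\<close>] card[OF \<open>G \<in> \<F>\<close>] 2 by (auto simp: card_1_singleton_iff)
      ultimately show "\<exists>v\<in>F - G. F \<inter> G = F - {v}" by auto
    qed
  next
    case 3
    then obtain f g where fg: "xs = [f, g]" using xs(1) by (auto simp: numeral_2_eq_2 length_Suc_conv)
    show ?thesis
    proof (rule shellable_connected_graph)
      fix A F G
      assume A: "\<And>H. H \<in> \<F> \<Longrightarrow> H \<subseteq> A \<or> H \<inter> A = {}" and F: "F \<in> \<F>" "F \<inter> A \<noteq> {}" and G: "G \<in> \<F>"
      obtain a where "a \<in> F" "a \<in> A" using F(2) by blast
      then show "G \<subseteq> A"
        using depth_2_connected[OF _ _ _ A F(1) _ _ G, of f g a] xs fg by auto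
    qed (use card 3 in auto)
  next
    case 4
    then obtain f g h where fgh: "xs = [f, g, h]" using xs(1) by (auto simp: numeral_3_eq_3 length_Suc_conv)
    define adj where "adj x y \<longleftrightarrow> - {x, y} \<in> \<F>" for x y
    have edges: "\<exists>x y. x \<noteq> y \<and> F = - {x, y}" if F: "F \<in> \<F>" for F
    proof -
      obtain x y where "x \<noteq> y" "- F = {x, y}" using cardC[OF F] 4 by (auto simp: card_2_iff)
      then show ?thesis by (metis double_compl)
    qed
    have sym: "adj x y \<longleftrightarrow> adj y x" for x y by (simp add: adj_def insert_commute)
    have reg: "f \<in> max_graded_ideal" "g \<in> max_graded_ideal" "h \<in> max_graded_ideal" "wreg [f, g, h] UNIV (facet_ideal \<F>)"
      using xs fgh by auto
    have U: "set vs = UNIV" if "distinct vs" "length vs = 5" for vs :: "'v list"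
      using that n by (intro card_subset_eq) (simp_all add: distinct_card)
    obtain vs :: "'v list" where vs: "distinct vs" "set vs = UNIV" using finite_distinct_list[OF finite[of "UNIV :: 'v set"]] by blast
    then have "length vs = 5" using n distinct_card by fastforce
    then obtain a b c d e where abc: "vs = [a, b, c, d, e]"
      by (auto simp: numeral_eq_Suc length_Suc_conv)
    have "shellable {- {x, y} | x y. x \<in> UNIV \<and> y \<in> UNIV \<and> x \<noteq> y \<and> adj x y}"
    proof (rule shellable_chordal[OF sym])
      fix W :: "'v set" assume W: "W \<noteq> {}"
      show "\<exists>v\<in>W. \<forall>p\<in>W - {v}. \<forall>q\<in>W - {v}. p \<noteq> q \<longrightarrow> adj p q \<longrightarrow> adj v p \<or> adj v q"
      proof (rule simplicial_vertex_5[OF sym])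
        show "distinct [a, b, c, d, e]" "W \<subseteq> {a, b, c, d, e}" using vs abc by auto
        fix p q r s :: 'v
        { assume dist: "distinct [p, q, r, s]"
          have "card (set [p, q, r, s]) \<noteq> CARD('v)" using n distinct_card[OF dist] by simp
          then obtain x where "x \<notin> set [p, q, r, s]" by (metis UNIV_eq_I)
          then have "distinct [p, q, r, s, x]" using dist by auto
          then show "adj p q \<longrightarrow> adj r s \<longrightarrow> adj p r \<or> adj p s \<or> adj q r \<or> adj q s"
            using no_induced_C4[OF reg adj_def edges, of p q r s x] U[of "[p, q, r, s, x]"] by auto }
        { fix t assume "distinct [p, q, r, s, t]"
          then show "adj p q \<longrightarrow> adj q r \<longrightarrow> adj r s \<longrightarrow> adj s t \<longrightarrow> adj t p \<longrightarrow>
              adj p r \<or> adj q s \<or> adj r t \<or> adj s p \<or> adj t q"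
            using no_induced_C5[OF reg adj_def edges, of p q r s t] U[of "[p, q, r, s, t]"] by auto }
      qed (rule W)
    qed
    moreover have "\<F> = {- {x, y} | x y. x \<in> UNIV \<and> y \<in> UNIV \<and> x \<noteq> y \<and> adj x y}"
      using edges by (auto simp: adj_def) metis
    ultimately show ?thesis by simp
  next
    case 5
    show ?thesis
    proof (rule shellable_ridges)
      fix F G assume FG: "F \<in> \<F>" "G \<in> \<F>" "F \<noteq> G"
      obtain a b where "- F = {a}" "- G = {b}"
        using cardC[OF FG(1)] cardC[OF FG(2)] 5 by (auto simp: card_1_singleton_iff)
      then have "F = - {a}" "G = - {b}" by (metis double_compl)+
      then show "\<exists>v\<in>F - G. F \<inter> G = F - {v}" using FG(3) by (intro bexI[of _ b]) auto
    qed
  qed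
qed


section \<open>Alexander duality\<close>

lemma idl_sqfree_monomials:
  "idl (sqfree_monomial ` S) = mideal {e. \<exists>F\<in>S. F \<subseteq> Poly_Mapping.keys (e :: 'v::finite \<Rightarrow>\<^sub>0 nat)}"
proof -
  have "{a + x | a x. x \<in> indicator_exponent ` S} = {e. \<exists>F\<in>S. \<exists>a. e = a + indicator_exponent F}" by blast
  also have "\<dots> = {e. \<exists>F\<in>S. F \<subseteq> Poly_Mapping.keys e}" by (simp only: indicator_exponent_divides)
  finally have "idl (monomial ` indicator_exponent ` S) = mideal {e. \<exists>F\<in>S. F \<subseteq> Poly_Mapping.keys e}"
    by (simp only: idl_monomials)
  then show ?thesis by (simp add: image_image sqfree_monomial_eq)
qed

lemma stanley_reisner_ideal_eq:
  fixes \<Delta> :: "'v::finite set set"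
  assumes "simplicial_complex \<Delta>"
  shows "stanley_reisner_ideal \<Delta> = (mideal {e. Poly_Mapping.keys e \<notin> \<Delta>} :: ('v, 'k::comm_ring_1) mpoly set)"
proof -
  have "{sqfree_monomial F | F. F \<notin> \<Delta>} = (sqfree_monomial ` (- \<Delta>) :: ('v, 'k) mpoly set)" by auto
  moreover have "(\<exists>F\<in>- \<Delta>. F \<subseteq> K) \<longleftrightarrow> K \<notin> \<Delta>" for K
    using assms by (auto simp: simplicial_complex_def)
  ultimately show ?thesis
    unfolding stanley_reisner_ideal_def by (simp only: idl_sqfree_monomials)
qed

lemma total_degree_indicator_exponent: "total_degree (indicator_exponent F) = card F"
  by (simp add: total_degree_def)

lemma total_degree_eq_0: "total_degree (a :: 'v::finite \<Rightarrow>\<^sub>0 nat) = 0 \<Longrightarrow> a = 0"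
  by (rule poly_mapping_eqI) (simp add: total_degree_eq)

text \<open>A generator \<open>g\<close> is a multiple of a squarefree monomial of the ideal, which
  is in turn a multiple of a generator of the same degree. Hence \<open>g\<close> equals that
  squarefree monomial.\<close>

lemma single_degree_generators:
  fixes I :: "('v::finite, 'k::field) mpoly set"
  assumes "sqfree_monomial_ideal I" "single_degree d I"
  obtains \<D> where "I = mideal {e. \<exists>D\<in>\<D>. D \<subseteq> Poly_Mapping.keys e}" "\<And>D. D \<in> \<D> \<Longrightarrow> card D = d"
proof -
  obtain S where S: "I = idl (sqfree_monomial ` S)" using assms(1) by (auto simp: sqfree_monomial_ideal_def)
  obtain G where G: "I = idl (monomial ` G)" "\<And>e. e \<in> G \<Longrightarrow> total_degree e = d"
    using assms(2) by (auto simp: single_degree_def minimal_monomial_generators_def)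
  have mem: "monomial e \<in> I \<longleftrightarrow> (\<exists>F\<in>S. F \<subseteq> Poly_Mapping.keys e)" for e
    by (simp add: S idl_sqfree_monomials)
  have mem': "monomial e \<in> I \<longleftrightarrow> (\<exists>a g. g \<in> G \<and> e = a + g)" for e
    by (auto simp: G(1) idl_monomials)
  have sqf: "g = indicator_exponent (Poly_Mapping.keys g) \<and> card (Poly_Mapping.keys g) = d" if g: "g \<in> G" for g
  proof -
    have "monomial (0 + g) \<in> I" using g mem' by blast
    then obtain F where F: "F \<in> S" "F \<subseteq> Poly_Mapping.keys g" using mem by auto
    then obtain a where a: "g = a + indicator_exponent F" using indicator_exponent_divides by blast
    have "monomial (indicator_exponent F) \<in> I" using F(1) mem by auto
    then obtain b g' where b: "g' \<in> G" "indicator_exponent F = b + g'" using mem' by blast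
    have "total_degree g = total_degree a + (total_degree b + total_degree g')"
      by (simp only: a b(2) total_degree_add)
    then have "a = 0" using G(2)[OF g] G(2)[OF b(1)] by (intro total_degree_eq_0) simp
    then have "g = indicator_exponent F" using a by simp
    then show ?thesis using G(2)[OF g] by (simp add: total_degree_indicator_exponent)
  qed
  show ?thesis
  proof (rule that)
    have "monomial ` G = (sqfree_monomial ` Poly_Mapping.keys ` G :: ('v, 'k) mpoly set)"
      using sqf by (force simp: sqfree_monomial_eq image_image intro!: image_cong)
    then show "I = mideal {e. \<exists>D\<in>Poly_Mapping.keys ` G. D \<subseteq> Poly_Mapping.keys e}"
      using G(1) by (simp only: idl_sqfree_monomials)
    show "card D = d" if "D \<in> Poly_Mapping.keys ` G" for D using that sqf by auto
  qed
qed

text \<open>\<open>B\<close> is a face of the dual exactly if its complement contains some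
  \<open>D\<close>, that is, if \<open>B\<close> lies in \<open>- D\<close>; so the sets
  \<open>- D\<close> generate the dual complex.\<close>

lemma alexander_dual_eq:
  fixes I :: "('v::finite, 'k::field) mpoly set"
  assumes I: "I = mideal {e. \<exists>D\<in>\<D>. D \<subseteq> Poly_Mapping.keys e}"
  shows "alexander_dual I = facet_ideal (uminus ` \<D>)"
proof -
  define \<Delta> where "\<Delta> = {F. \<forall>D\<in>\<D>. \<not> D \<subseteq> F}"
  have cplx: "simplicial_complex \<Delta>" by (auto simp: \<Delta>_def simplicial_complex_def)
  have "(THE \<Delta>. simplicial_complex \<Delta> \<and> I = stanley_reisner_ideal \<Delta>) = \<Delta>"
  proof (rule the_equality)
    show "simplicial_complex \<Delta> \<and> I = stanley_reisner_ideal \<Delta>"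
      using cplx by (simp add: stanley_reisner_ideal_eq I \<Delta>_def)
    fix \<Delta>' assume *: "simplicial_complex \<Delta>' \<and> I = stanley_reisner_ideal \<Delta>'"
    \<comment> \<open>The squarefree monomials in the ideal determine the complex.\<close>
    have "F \<in> \<Delta>' \<longleftrightarrow> monomial (indicator_exponent F) \<notin> I" for F
      using * by (auto simp: stanley_reisner_ideal_eq)
    then show "\<Delta>' = \<Delta>" by (auto simp: I \<Delta>_def)
  qed
  moreover have "alexander_dual_complex \<Delta> = {B. \<exists>D\<in>\<D>. B \<subseteq> - D}"
  proof -
    have "A \<in> alexander_dual_complex \<Delta> \<longleftrightarrow> - A \<notin> \<Delta>" for A
      by (auto simp: alexander_dual_complex_def Compl_eq_Diff_UNIV[symmetric])
    moreover have "D \<subseteq> - A \<longleftrightarrow> A \<subseteq> - D" for A D :: "'v set" by blast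
    ultimately show ?thesis by (auto simp: \<Delta>_def)
  qed
  moreover have "simplicial_complex {B. \<exists>D\<in>\<D>. B \<subseteq> - D}" by (auto simp: simplicial_complex_def)
  ultimately show ?thesis
    by (simp add: alexander_dual_def stanley_reisner_ideal_eq facet_ideal_def)
qed

theorem theorem2p14:
  fixes I :: "('v :: finite, 'k :: field) mpoly set" and d :: nat
  assumes "CARD('v) = 5"
    and "sqfree_monomial_ideal I"
    and "single_degree d I"
    and "1 \<le> d" and "d \<le> CARD('v)"
  shows "sequentially_cohen_macaulay (alexander_dual I) \<longleftrightarrow> pretty_clean (alexander_dual I)"
proof -
  obtain \<D> where D: "I = mideal {e. \<exists>D\<in>\<D>. D \<subseteq> Poly_Mapping.keys e}" "\<And>D. D \<in> \<D> \<Longrightarrow> card D = d"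
    using single_degree_generators[OF assms(2,3)] by blast
  define \<F> where "\<F> = uminus ` \<D>"
  have dual: "alexander_dual I = facet_ideal \<F>" unfolding \<F>_def by (rule alexander_dual_eq[OF D(1)])
  have card: "card F = 5 - d" if "F \<in> \<F>" for F
    using that D(2) assms(1) by (auto simp: \<F>_def card_complement)
  show ?thesis
    unfolding dual
  proof
    assume scm: "sequentially_cohen_macaulay (facet_ideal \<F> :: ('v, 'k) mpoly set)"
    have "shellable \<F>"
    \<comment> \<open>No facets means \<open>I = 0\<close>, whose dual is the whole ring.\<close>
    proof (cases "\<F> = {}")
      case False
      obtain xs :: "('v, 'k) mpoly list"
        where "length xs = 5 - d" "set xs \<subseteq> max_graded_ideal" "wreg xs UNIV (facet_ideal \<F>)"
        using sequentially_cohen_macaulay_depth[OF scm card False] by blast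
      \<comment> \<open>\<open>1 \<le> d\<close> bounds the facet size \<open>5 - d\<close> by 4,
        the range of \<open>shellable_of_depth\<close>.\<close>
      then show ?thesis using assms(4) by (intro shellable_of_depth[OF assms(1) _ card]) auto
    qed (use shellable.empty in simp)
    then show "pretty_clean (facet_ideal \<F> :: ('v, 'k) mpoly set)" using card by (rule shellable_pretty_clean)
  next
    assume "pretty_clean (facet_ideal \<F> :: ('v, 'k) mpoly set)"
    then show "sequentially_cohen_macaulay (facet_ideal \<F> :: ('v, 'k) mpoly set)"
      using card by (rule pretty_clean_sequentially_cohen_macaulay)
  qed
qed

end
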